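(* Let $T>0$ and $R>0$, let $F:H\to H$ be Lipschitz continuous and bounded, and let $g,h\in C_b(H)$. Then there exists a unique function $u\in C^1_\gamma(H)$ such that $$u(t,x)=P_th(x)+\int_0^t P_{t-s}\big[\mathcal H(\cdot,Du(s,\cdot))\big](x)\,ds,\qquad t\in[0,T],\ x\in H.$$
   Context: Setting. $H$ is a real separable (infinite-dimensional) Hilbert space with inner product $\langle\cdot,\cdot\rangle$ and norm $|\cdot|$, and $(e_n)_{n\ge1}$ is a fixed orthonormal basis of $H$. Let $\alpha\in(1,2)$ and $(\beta_n)_n\subset(0,\infty)$. On a stochastic basis $(\Omega,\mathcal F,(\mathcal F_t),\mathbb P)$ satisfying the usual assumptions, $(Z^n)_n$ is a sequence of independent one-dimensional $\alpha$-stable Lévy processes with $\mathbb E[e^{i\xi Z^n_t}]=e^{-t|\xi|^\alpha}$ for $\xi\in\mathbb R$, $t\ge0$, $n\in\mathbb N$. Standing hypothesis. $A:D(A)\subset H\to H$ is a self-adjoint operator such that: (i) $(e_n)_n\subset D(A)$ and there is a sequence $(\gamma_n)_n\subset(0,\infty)$ with $\gamma_n\to\infty$ as $n\to\infty$ and $Ae_n=-\gamma_ne_n$ for all $n\in\mathbb N$; (ii) there exist $\gamma\in[1/\alpha,1)$ and $\bar C>0$ such that $\beta_n\ge\bar C\,\gamma_n^{\frac1\alpha-\gamma}$ for all $n\in\mathbb N$; (iii) $\sum_{n\ge1}\beta_n^\alpha\gamma_n^{-1}<\infty$. The number $\gamma$ is fixed as in (ii). $(e^{tA})_{t\ge0}$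 is the semigroup generated by $A$, i.e. $e^{tA}e_n=e^{-\gamma_nt}e_n$. Ornstein-Uhlenbeck process and semigroup. For $x\in H$, $Z^x_{A,t}=e^{tA}x+\sum_{n=1}^\infty\beta_n\int_0^te^{-\gamma_n(t-s)}dZ^n_s\,e_n$, $t\ge0$, which under the standing hypothesis is a well-defined $H$-valued process. For bounded Borel measurable $\phi:H\to\mathbb R$, $P_t\phi(x)=\mathbb E[\phi(Z^x_{A,t})]$, $t\ge0$, $x\in H$. Function spaces. $C_b(H)$ is the space of bounded continuous functions $H\to\mathbb R$ with the sup norm $\|\cdot\|_0$. $C^1_b(H)$ is the space of bounded continuous Fréchet differentiable functions $H\to\mathbb R$ with bounded continuous Fréchet derivative $D\phi:H\to H$ (and $\|D\phi\|_0=\sup_{x}|D\phi(x)|$). $C^1_\gamma(H)$ is the space of continuous bounded functions $u:[0,T]\times H\to\mathbb R$ such that $u(t,\cdot)\in C^1_b(H)$ for every $t\in(0,T]$ and $\sup_{t\in(0,T]}t^\gamma\|Du(t,\cdot)\|_0<\infty$, where $D$ denotes the Fréchet derivative in the space variable. Hamiltonian. $\mathcal H:H\times H\to\mathbb R$ is defined by $$\mathcal H(x,p)=\inf_{\lambda\in H,\,|\lambda|\le R}\Big[\langle\lambda,p\rangle+\tfrac12|\lambda|^2\Big]+\langle F(x),p\rangle+g(x).$$ The expression $\mathcal H(\cdot,Du(s,\cdot))$ denotes the function $y\mapsto\mathcal H(y,Du(s,y))$, $s\in(0,T]$. *)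

theory Defs
  imports "HOL-Probability.Probability"
begin

text \<open>
  A separable Hilbert space is a type of sort \<open>{real_inner, banach, polish_space}\<close>;
  a countably infinite orthonormal basis, here indexed from \<open>0\<close>, makes it infinite-dimensional.
  Time-indexed families are functions on all of \<open>real\<close>, of which only the values at
  times \<open>t \<ge> 0\<close> are ever used.
\<close>

section \<open>Hilbert space operators and semigroups\<close>

definition orthonormal_basis :: "(nat \<Rightarrow> 'h::{real_inner, banach, polish_space}) \<Rightarrow> bool" where
  "orthonormal_basis e \<longleftrightarrow>
     (\<forall>i j. e i \<bullet> e j = (if i = j then 1 else 0)) \<and> closure (span (range e)) = UNIV"

text \<open>
  An unbounded operator is a pair of a domain \<open>D\<close> and a function \<open>A\<close> that matters only on \<open>D\<close>.
  The last conjunct says that the graph of the adjoint equals the graph of \<open>A\<close> (including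
  equality of the domains, so this is more than symmetry).
\<close>

definition self_adjoint :: "'h::{real_inner, banach, polish_space} set \<Rightarrow> ('h \<Rightarrow> 'h) \<Rightarrow> bool" where
  "self_adjoint D A \<longleftrightarrow>
     subspace D \<and> closure D = UNIV \<and>
     (\<forall>x\<in>D. \<forall>y\<in>D. A (x + y) = A x + A y) \<and> (\<forall>c. \<forall>x\<in>D. A (c *\<^sub>R x) = c *\<^sub>R A x) \<and>
     (\<forall>y z. (\<forall>x\<in>D. A x \<bullet> y = x \<bullet> z) \<longleftrightarrow> y \<in> D \<and> z = A y)"

definition c0_semigroup :: "(real \<Rightarrow> 'h::{real_inner, banach, polish_space} \<Rightarrow> 'h) \<Rightarrow> bool" where
  "c0_semigroup S \<longleftrightarrow>
     (\<forall>t\<ge>0. bounded_linear (S t)) \<and> S 0 = id \<and>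
     (\<forall>s\<ge>0. \<forall>t\<ge>0. S (s + t) = S s \<circ> S t) \<and>
     (\<forall>x. ((\<lambda>t. S t x) \<longlongrightarrow> x) (at_right 0))"

definition semigroup_generated_by ::
  "'h::{real_inner, banach, polish_space} set \<Rightarrow> ('h \<Rightarrow> 'h) \<Rightarrow> (real \<Rightarrow> 'h \<Rightarrow> 'h) \<Rightarrow> bool" where
  "semigroup_generated_by D A S \<longleftrightarrow>
     c0_semigroup S \<and>
     (\<forall>x y. ((\<lambda>t. (S t x - x) /\<^sub>R t) \<longlongrightarrow> y) (at_right 0) \<longleftrightarrow> x \<in> D \<and> y = A x)"

section \<open>Stochastic basis and stable processes\<close>

definition stochastic_basis :: "'w measure \<Rightarrow> (real \<Rightarrow> 'w measure) \<Rightarrow> bool" where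
  "stochastic_basis M \<F> \<longleftrightarrow>
     prob_space M \<and> complete_measure M \<and>
     (\<forall>t\<ge>0. subalgebra M (\<F> t)) \<and>
     (\<forall>s\<ge>0. \<forall>t\<ge>s. sets (\<F> s) \<subseteq> sets (\<F> t)) \<and>
     null_sets M \<subseteq> sets (\<F> 0) \<and>
     (\<forall>t\<ge>0. sets (\<F> t) = (\<Inter>s\<in>{t<..}. sets (\<F> s)))"

definition cadlag :: "(real \<Rightarrow> real) \<Rightarrow> bool" where
  "cadlag f \<longleftrightarrow>
     (\<forall>t\<ge>0. continuous (at_right t) f) \<and> (\<forall>t>0. \<exists>l. (f \<longlongrightarrow> l) (at_left t))"

definition levy_process ::
  "'w measure \<Rightarrow> (real \<Rightarrow> 'w measure) \<Rightarrow> (real \<Rightarrow> 'w \<Rightarrow> real) \<Rightarrow> bool" where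
  "levy_process M \<F> Z \<longleftrightarrow>
     (\<forall>t\<ge>0. Z t \<in> borel_measurable (\<F> t)) \<and>
     (AE \<omega> in M. Z 0 \<omega> = 0) \<and>
     (\<forall>s\<ge>0. \<forall>t\<ge>s. prob_space.indep_set M (sets (\<F> s))
        (sets (vimage_algebra (space M) (\<lambda>\<omega>. Z t \<omega> - Z s \<omega>) borel))) \<and>
     (\<forall>s\<ge>0. \<forall>t\<ge>s. distr M borel (\<lambda>\<omega>. Z t \<omega> - Z s \<omega>) = distr M borel (Z (t - s))) \<and>
     (\<forall>t\<ge>0. \<forall>\<epsilon>>0.
        ((\<lambda>s. measure M {\<omega>\<in>space M. \<bar>Z s \<omega> - Z t \<omega>\<bar> > \<epsilon>}) \<longlongrightarrow> 0) (at t within {0..})) \<and>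
     (AE \<omega> in M. cadlag (\<lambda>t. Z t \<omega>))"

definition stable_levy_process ::
  "'w measure \<Rightarrow> (real \<Rightarrow> 'w measure) \<Rightarrow> real \<Rightarrow> (real \<Rightarrow> 'w \<Rightarrow> real) \<Rightarrow> bool" where
  "stable_levy_process M \<F> \<alpha> Z \<longleftrightarrow>
     levy_process M \<F> Z \<and>
     (\<forall>t\<ge>0. \<forall>\<xi>. char (distr M borel (Z t)) \<xi> = of_real (exp (- t * \<bar>\<xi>\<bar> powr \<alpha>)))"

text \<open>Independence of whole processes, each regarded as a random path.\<close>

definition independent_processes :: "'w measure \<Rightarrow> (nat \<Rightarrow> real \<Rightarrow> 'w \<Rightarrow> real) \<Rightarrow> bool" where
  "independent_processes M Z \<longleftrightarrow>
     prob_space.indep_vars M (\<lambda>_. Pi\<^sub>M {0..} (\<lambda>_. borel)) (\<lambda>n \<omega>. \<lambda>t\<in>{0..}. Z n t \<omega>) UNIV"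

section \<open>Stochastic integral of a deterministic continuous integrand\<close>

text \<open>
  \<open>\<integral>\<^sub>0\<^sup>t f dZ\<close> is the limit in probability, as the mesh tends to \<open>0\<close>, of the left-point Riemann
  sums over the partitions \<open>0 = p 0 \<le> p 1 \<le> \<dots> \<le> p m = t\<close>. It is determined almost surely, and
  \<open>stoch_integral\<close> picks a version; the transition semigroup below does not depend on the choice.
\<close>

definition riemann_sum ::
  "(real \<Rightarrow> 'w \<Rightarrow> real) \<Rightarrow> (real \<Rightarrow> real) \<Rightarrow> nat \<Rightarrow> (nat \<Rightarrow> real) \<Rightarrow> 'w \<Rightarrow> real" where
  "riemann_sum Z f m p \<omega> = (\<Sum>i<m. f (p i) * (Z (p (Suc i)) \<omega> - Z (p i) \<omega>))"

definition has_stoch_integral ::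
  "'w measure \<Rightarrow> (real \<Rightarrow> 'w \<Rightarrow> real) \<Rightarrow> (real \<Rightarrow> real) \<Rightarrow> real \<Rightarrow> ('w \<Rightarrow> real) \<Rightarrow> bool" where
  "has_stoch_integral M Z f t I \<longleftrightarrow>
     I \<in> borel_measurable M \<and>
     (\<forall>\<epsilon>>0. \<exists>\<delta>>0. \<forall>m p.
        p 0 = 0 \<and> p m = t \<and> (\<forall>i<m. p i \<le> p (Suc i) \<and> p (Suc i) - p i < \<delta>) \<longrightarrow>
        measure M {\<omega>\<in>space M. \<bar>riemann_sum Z f m p \<omega> - I \<omega>\<bar> > \<epsilon>} < \<epsilon>)"

definition stoch_integral ::
  "'w measure \<Rightarrow> (real \<Rightarrow> 'w \<Rightarrow> real) \<Rightarrow> (real \<Rightarrow> real) \<Rightarrow> real \<Rightarrow> 'w \<Rightarrow> real" where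
  "stoch_integral M Z f t = (SOME I. has_stoch_integral M Z f t I)"

section \<open>Ornstein--Uhlenbeck process and its transition semigroup\<close>

text \<open>
  Here \<open>S t\<close> is \<open>e\<^bsup>tA\<^esup>\<close> and \<open>\<gamma>s n\<close> is the \<open>n\<close>-th eigenvalue of \<open>-A\<close>. The series is taken pathwise
  in the norm of the Hilbert space; its value is arbitrary where it diverges.
\<close>

definition ou_process ::
  "'w measure \<Rightarrow> (nat \<Rightarrow> real \<Rightarrow> 'w \<Rightarrow> real) \<Rightarrow> (real \<Rightarrow> 'h \<Rightarrow> 'h) \<Rightarrow> (nat \<Rightarrow> 'h) \<Rightarrow>
   (nat \<Rightarrow> real) \<Rightarrow> (nat \<Rightarrow> real) \<Rightarrow> 'h::{real_inner, banach, polish_space} \<Rightarrow> real \<Rightarrow> 'w \<Rightarrow> 'h" where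
  "ou_process M Z S e \<gamma>s \<beta> x t \<omega> =
     S t x + (\<Sum>n. (\<beta> n * stoch_integral M (Z n) (\<lambda>s. exp (- \<gamma>s n * (t - s))) t \<omega>) *\<^sub>R e n)"

definition ou_semigroup ::
  "'w measure \<Rightarrow> (nat \<Rightarrow> real \<Rightarrow> 'w \<Rightarrow> real) \<Rightarrow> (real \<Rightarrow> 'h \<Rightarrow> 'h) \<Rightarrow> (nat \<Rightarrow> 'h) \<Rightarrow>
   (nat \<Rightarrow> real) \<Rightarrow> (nat \<Rightarrow> real) \<Rightarrow>
   real \<Rightarrow> ('h::{real_inner, banach, polish_space} \<Rightarrow> real) \<Rightarrow> 'h \<Rightarrow> real" where
  "ou_semigroup M Z S e \<gamma>s \<beta> t \<phi> x =
     prob_space.expectation M (\<lambda>\<omega>. \<phi> (ou_process M Z S e \<gamma>s \<beta> x t \<omega>))"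

section \<open>Function spaces and the Hamiltonian\<close>

text \<open>The Fr\'echet derivative of a real function, identified with a vector by Riesz.\<close>

definition grad :: "('h::{real_inner, banach, polish_space} \<Rightarrow> real) \<Rightarrow> 'h \<Rightarrow> 'h" where
  "grad \<phi> x = (THE d. GDERIV \<phi> x :> d)"

definition C1b :: "('h::{real_inner, banach, polish_space} \<Rightarrow> real) set" where
  "C1b = {\<phi> \<in> bcontfun. (\<forall>x. GDERIV \<phi> x :> grad \<phi> x) \<and> grad \<phi> \<in> bcontfun}"

text \<open>
  Functions on \<open>[0,T] \<times> H\<close> are represented by extensional functions, so that equality of
  functions is equality on \<open>[0,T] \<times> H\<close>.
\<close>

definition C1_weighted ::
  "real \<Rightarrow> real \<Rightarrow> (real \<times> 'h::{real_inner, banach, polish_space} \<Rightarrow> real) set" where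
  "C1_weighted T \<gamma> =
     {u \<in> extensional ({0..T} \<times> UNIV).
        continuous_on ({0..T} \<times> UNIV) u \<and> bounded (u ` ({0..T} \<times> UNIV)) \<and>
        (\<forall>t\<in>{0<..T}. (\<lambda>x. u (t, x)) \<in> C1b) \<and>
        bdd_above ((\<lambda>t. t powr \<gamma> * (SUP x. norm (grad (\<lambda>x. u (t, x)) x))) ` {0<..T})}"

definition hamiltonian ::
  "real \<Rightarrow> ('h \<Rightarrow> 'h) \<Rightarrow> ('h \<Rightarrow> real) \<Rightarrow> 'h::{real_inner, banach, polish_space} \<Rightarrow> 'h \<Rightarrow> real" where
  "hamiltonian R F g x p =
     (INF l\<in>{l. norm l \<le> R}. l \<bullet> p + 1/2 * (norm l)\<^sup>2) + F x \<bullet> p + g x"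

text \<open>
  The mild equation for a given transition semigroup \<open>P\<close>. Integrability is required explicitly
  because the library integral of a non-integrable function is \<open>0\<close>; the point \<open>s = 0\<close>, where the
  gradient need not exist, is left out of the domain of integration.
\<close>

definition mild_solution ::
  "real \<Rightarrow> (real \<Rightarrow> ('h \<Rightarrow> real) \<Rightarrow> 'h \<Rightarrow> real) \<Rightarrow> ('h \<Rightarrow> 'h \<Rightarrow> real) \<Rightarrow> ('h \<Rightarrow> real) \<Rightarrow>
   (real \<times> 'h::{real_inner, banach, polish_space} \<Rightarrow> real) \<Rightarrow> bool" where
  "mild_solution T P \<H> h u \<longleftrightarrow>
     (\<forall>t\<in>{0..T}. \<forall>x.
        set_integrable lborel {0<..t} (\<lambda>s. P (t - s) (\<lambda>y. \<H> y (grad (\<lambda>z. u (s, z)) y)) x) \<and>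
        u (t, x) = P t h x +
          (LINT s:{0<..t}|lborel. P (t - s) (\<lambda>y. \<H> y (grad (\<lambda>z. u (s, z)) y)) x))"

end

theory Submission
  imports Defs
begin

text \<open>
  A symmetric \<open>\<alpha>\<close>-stable variable has the law of \<open>sqrt
      (2 \<sigma>) G\<close>, with \<open>\<sigma>\<close> positive \<open>\<alpha>/2\<close>-stable and
  \<open>G\<close> an independent standard Gaussian. Hence the Ornstein--Uhlenbeck variable at time \<open>t\<close> has the
  law of an explicit series over independent pairs \<open>(\<sigma>\<^sub>n, G\<^sub>n)\<close>, on one probability space for
  all \<open>t\<close>. A shift in the direction \<open>e\<^sub>n\<close> is a shift of \<open>G\<^sub>n\<close>, and integrating by parts
      in \<open>G\<^sub>n\<close>
  expresses the partial derivatives of \<open>P\<^sub>t \<phi>\<close> as correlations of \<open>\<phi>\<close> with the orthogonal scores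
  \<open>G\<^sub>n / sqrt (2 \<sigma>\<^sub>n)\<close>, suitably scaled. These are square integrable because \<open>1/\<sigma>\<close> has a finite mean,
  so Bessel's inequality bounds the whole gradient by a multiple of \<open>t powr (- \<gamma>)\<close>. The mild equation
  is then solved for \<open>w = D u\<close> by Picard iteration in a norm with weight
  \<open>t powr \<gamma> * exp (- \<theta> * t)\<close>, for large \<open>\<theta>\<close>.
\<close>

section \<open>Positive stable laws\<close>

text \<open>The bound of order \<open>t powr (- \<gamma>)\<close> has to hold for every bounded
  continuous function, because the Hamiltonian composed with \<open>D u\<close> is no smoother than
  that. The noise has infinite second moments, so its coordinates cannot serve as weights; the
  scores can, since they involve only the mean of 1/\<sigma>. The exponent comes from comparing the
  decay \<open>exp (- l n * t)\<close> of the n-th mode with the scale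
  \<open>\<beta> n * c n t\<close> of its noise: the lower bound on \<beta> bounds their quotient by
  \<open>t powr (- \<gamma>)\<close> times a bounded function of \<open>l n * t\<close>, uniformly
  in n. The iteration runs on the gradient because the right-hand side of the equation sees
  \<open>u\<close> only through \<open>D u\<close>; \<open>u\<close> itself then has an explicit
  formula. The time integral is singular at s = 0 and at s = t, integrably so since \<gamma> < 1,
  and the exponential weight gives a contraction on all of [0,T] at once, with no subdivision of the
  interval. The given process enters only through its law at each fixed time, which permits the
  change of probability space.\<close>

text \<open>
  Sibuya's law has the generating function \<open>1 - (1 - s) powr a\<close>. The sum of \<open>n\<close> independent copies,
  scaled by \<open>n powr (- 1 / a)\<close>, has a Laplace transform tending to \<open>exp (- (l powr a))\<close>.
\<close>

lemma sibuya_weight_nonneg: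
  fixes a :: real
  assumes "0 < a" "a < 1"
  shows "(-1) ^ n * (a gchoose Suc n) \<ge> 0"
proof (induction n)
  case 0
  then show ?case using assms by simp
next
  case (Suc n)
  \<comment> \<open>Consecutive coefficients differ by the factor (a - (n + 1)) / (n + 2), which is
    negative because a < 1; the alternating sign absorbs it.\<close>
  have "(a gchoose Suc (Suc n)) = (a gchoose Suc n) * (a - real (Suc n)) / real (Suc (Suc n))"
    using gbinomial_absorb_comp[of a "Suc n"] gbinomial_absorption[of "Suc n" a]
    by (simp add: field_simps)
  then have "(-1) ^ Suc n * (a gchoose Suc (Suc n)) =
      - ((-1) ^ n * (a gchoose Suc n)) * (a - real (Suc n)) / real (Suc (Suc n))"
    by simp
  also have "\<dots> = ((-1) ^ n * (a gchoose Suc n)) * ((real (Suc n) - a) / real (Suc (Suc n)))"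
    by (simp add: field_simps)
  finally have "(-1) ^ Suc n * (a gchoose Suc (Suc n)) = \<dots>" .
  moreover have "0 \<le> (real (Suc n) - a) / real (Suc (Suc n))"
    using assms by simp
  ultimately show ?case using Suc by (simp only: mult_nonneg_nonneg)
qed

text \<open>The binomial series gives the generating function only for s < 1. Total mass 1 follows
  by letting s increase to 1: partial sums are continuous there and stay at most 1, while the full
  sum is at least 1 - (1 - s) powr a. The weight \<open>q n\<close> is the mass at n + 1, whence the
  image under \<open>Suc\<close>.\<close>

lemma sibuya_pmf:
  fixes a :: real
  assumes a: "0 < a" "a < 1"
  shows "\<exists>p :: nat pmf. \<forall>s. 0 \<le>
      s \<longrightarrow> s < 1 \<longrightarrow> measure_pmf.expectation p (\<lambda>k. s ^ k) = 1 - (1 - s) powr a"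
proof -
  define q where "q n = (-1) ^ n * (a gchoose Suc n)" for n
  have q0: "q n \<ge> 0" for n
    unfolding q_def using sibuya_weight_nonneg[OF a] by simp
  have gf: "(\<lambda>n. q n * s ^ Suc n) sums (1 - (1 - s) powr a)" if "0 \<le> s" "s < 1" for s
  proof -
    have "(\<lambda>n. (a gchoose n) * (-s) ^ n) sums (1 + (-s)) powr a"
      by (rule gen_binomial_real) (use that in auto)
    then have "(\<lambda>n. (a gchoose Suc n) * (-s) ^ Suc n) sums ((1 + (-s)) powr a - 1)"
      by (subst sums_Suc_iff) simp
    then have "(\<lambda>n. - ((a gchoose Suc n) * (-s) ^ Suc n)) sums - ((1 + (-s)) powr a - 1)"
      by (rule sums_minus)
    moreover have "- ((a gchoose Suc n) * (-s) ^ Suc n) = q n * s ^ Suc n" for n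
      unfolding q_def power_minus[of s] by simp
    ultimately show ?thesis by (simp only: minus_diff_eq uminus_add_conv_diff[symmetric]) simp
  qed
  have part: "sum q {..<N} \<le> 1" for N
  proof -
    have lim: "((\<lambda>s. \<Sum>n<N. q n * s ^ Suc n) \<longlongrightarrow> (\<Sum>n<N. q n * 1 ^ Suc n)) (at_left 1)"
      by (intro tendsto_intros)
    have "(\<Sum>n<N. q n * s ^ Suc n) \<le> 1" if "0 \<le> s" "s < 1" for s
    proof -
      have "(\<Sum>n<N. q n * s ^ Suc n) \<le> 1 - (1 - s) powr a"
        using gf[OF that] q0 that sum_le_suminf[of "\<lambda>n. q n * s ^ Suc n" "{..<N}"] by (auto simp: sums_iff)
      then show ?thesis by (smt (verit) powr_ge_zero)
    qed
    then have "\<forall>\<^sub>F s in at_left 1. (\<Sum>n<N. q n * s ^ Suc n) \<le> 1"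
      unfolding eventually_at_left_field by (intro exI[of _ 0]) auto
    from tendsto_upperbound[OF lim this] show ?thesis by simp
  qed
  have summ: "summable q"
    using part q0 by (intro summableI_nonneg_bounded)
  have ge: "suminf q \<ge> 1 - (1 - s) powr a" if "0 \<le> s" "s < 1" for s
  proof -
    have "1 - (1 - s) powr a = (\<Sum>n. q n * s ^ Suc n)"
      using gf[OF that] by (simp add: sums_iff)
    also have "\<dots> \<le> suminf q"
    proof (rule suminf_le)
      show "q n * s ^ Suc n \<le> q n" for n
        using q0[of n] that power_le_one[of s "Suc n"] by (simp add: mult_left_le del: power_Suc)
    qed (use gf[OF that] summ in \<open>auto simp: sums_iff\<close>)
    finally show ?thesis .
  qed
  have "((\<lambda>s::real. 1 - (1 - s) powr a) \<longlongrightarrow> 1 - 0) (at_left 1)"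
  proof (intro tendsto_intros)
    have "((\<lambda>s::real. (1 - s) powr a) \<longlongrightarrow> (1 - 1) powr a) (at_left 1)"
      using a by (intro tendsto_powr' tendsto_intros) (auto simp: eventually_at_left_field intro!: exI[of _ 0])
    then show "((\<lambda>s::real. (1 - s) powr a) \<longlongrightarrow> 0) (at_left 1)" by simp
  qed
  moreover have "\<forall>\<^sub>F s in at_left 1. 1 - (1 - s) powr a \<le> suminf q"
    using ge unfolding eventually_at_left_field by (intro exI[of _ 0]) auto
  ultimately have "suminf q \<ge> 1"
    using tendsto_upperbound[of "\<lambda>s. 1 - (1 - s) powr a" "1 - 0" "at_left 1" "suminf q"] by simp
  moreover have "suminf q \<le> 1"
    using part summ by (intro suminf_le_const)
  ultimately have "q sums 1"
    using summ by (simp add: sums_iff)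
  then have "(\<integral>\<^sup>+ n. ennreal (q n) \<partial>count_space UNIV) = 1"
    using q0 by (subst nn_integral_count_space_nat, subst suminf_ennreal_eq) auto
  then have p: "pmf (embed_pmf q) n = q n" for n
    using q0 by (intro pmf_embed_pmf) auto
  define p where "p = map_pmf Suc (embed_pmf q)"
  have "measure_pmf.expectation p (\<lambda>k. s ^ k) = 1 - (1 - s) powr a" if s: "0 \<le> s" "s < 1" for s
  proof -
    have sm: "summable (\<lambda>n. norm (q n * s ^ Suc n))"
      using gf[OF s] q0 s by (simp add: sums_iff)
    have "measure_pmf.expectation p (\<lambda>k. s ^ k) = (\<integral>n. s ^ Suc n \<partial>measure_pmf (embed_pmf q))"
      unfolding p_def by (simp add: integral_map_pmf)
    also have "\<dots> = (\<integral>n. pmf (embed_pmf q) n *\<^sub>R s ^ Suc n \<partial>count_space UNIV)"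
      by (subst measure_pmf_eq_density, subst integral_density) auto
    also have "\<dots> = (\<integral>n. q n * s ^ Suc n \<partial>count_space UNIV)"
      by (simp add: p)
    also have "\<dots> = (\<Sum>n. q n * s ^ Suc n)"
      using sm by (intro integral_count_space_nat) (simp add: integrable_count_space_nat_iff)
    also have "\<dots> = 1 - (1 - s) powr a"
      using gf[OF s] by (simp add: sums_iff)
    finally show ?thesis .
  qed
  then show ?thesis by blast
qed

text \<open>The sum of independent copies is built by monadic binding, one summand at a time, so no
  product space is needed and the generating functions multiply.\<close>

lemma iid_sum_pmf:
  fixes p :: "nat pmf"
  shows "\<exists>r :: nat pmf. \<forall>s::real. 0 \<le> s \<longrightarrow> s < 1 \<longrightarrow>
    measure_pmf.expectation r (\<lambda>k. s ^ k) = measure_pmf.expectation p (\<lambda>k. s ^ k) ^ n"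
proof (induction n)
  case 0
  show ?case by (intro exI[of _ "return_pmf 0"]) simp
next
  case (Suc n)
  then obtain r where r: "\<And>s::real. 0 \<le> s \<Longrightarrow> s < 1 \<Longrightarrow>
    measure_pmf.expectation r (\<lambda>k. s ^ k) = measure_pmf.expectation p (\<lambda>k. s ^ k) ^ n" by blast
  show ?case
  proof (intro exI[of _ "bind_pmf p (\<lambda>j. map_pmf ((+) j) r)"] allI impI)
    fix s :: real assume s: "0 \<le> s" "s < 1"
    have "measure_pmf.expectation (bind_pmf p (\<lambda>j. map_pmf ((+) j) r)) (\<lambda>k. s ^ k) =
       (\<integral>j. (\<integral>k. s ^ k \<partial>measure_pmf (map_pmf ((+) j) r)) \<partial>measure_pmf p)"
      unfolding measure_pmf_bind
    proof (rule integral_bind[where K="count_space UNIV" and B=1 and B'=1])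
      show "(\<lambda>x. measure_pmf (map_pmf ((+) x) r)) \<in> measurable (measure_pmf p) (subprob_algebra (count_space UNIV))"
        by (auto simp: measurable_def space_subprob_algebra intro!: measure_pmf_in_subprob_algebra measure_pmf.subprob_space_axioms)
    qed (use s in \<open>auto simp: power_le_one\<close>)
    also have "\<dots> = measure_pmf.expectation p (\<lambda>k. s ^ k) ^ Suc n"
      by (simp add: integral_map_pmf power_add r[OF s])
    finally show "measure_pmf.expectation (bind_pmf p (\<lambda>j. map_pmf ((+) j) r)) (\<lambda>k. s ^ k) =
      measure_pmf.expectation p (\<lambda>k. s ^ k) ^ Suc n" .
  qed
qed

text \<open>With y = x n / (n + 1), the inequalities 1 - y <= exp (- y) and 1 / (1 - y) <= exp (y /
  (1 - y)) squeeze the power between exp (- x n / (1 - y)) and exp (- x n).\<close>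

lemma power_one_minus_tendsto_exp:
  fixes x :: "nat \<Rightarrow> real"
  assumes x: "x \<longlonglongrightarrow> l" and pos: "\<And>n. 0 \<le> x n" "\<And>n. x n < Suc n"
  shows "(\<lambda>n. (1 - x n / Suc n) ^ Suc n) \<longlonglongrightarrow> exp (- l)"
proof -
  define y where "y n = x n / Suc n" for n
  have y: "y \<longlonglongrightarrow> 0"
    unfolding y_def using tendsto_mult[OF x LIMSEQ_inverse_real_of_nat] by (simp add: divide_inverse)
  have y01: "0 \<le> y n" "y n < 1" for n
    using pos[of n] by (auto simp: y_def field_simps)
  have up: "(1 - y n) ^ Suc n \<le> exp (- x n)" for n
  proof -
    have "(1 - y n) ^ Suc n \<le> exp (- y n) ^ Suc n"
      using y01[of n] exp_ge_add_one_self[of "- y n"] by (intro power_mono) auto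
    also have "\<dots> = exp (- x n)"
      by (simp add: exp_of_nat_mult[symmetric] y_def del: power_Suc of_nat_Suc)
    finally show ?thesis .
  qed
  have lo: "exp (- x n / (1 - y n)) \<le> (1 - y n) ^ Suc n" for n
  proof -
    have "1 / (1 - y n) \<le> exp (y n / (1 - y n))"
      using exp_ge_add_one_self[of "y n / (1 - y n)"] y01[of n] by (simp add: field_simps)
    then have "exp (- y n / (1 - y n)) \<le> 1 - y n"
      using y01[of n] by (simp add: exp_minus field_simps)
    then have "exp (- y n / (1 - y n)) ^ Suc n \<le> (1 - y n) ^ Suc n"
      by (intro power_mono) auto
    then show ?thesis
      by (simp add: exp_of_nat_mult[symmetric] y_def del: power_Suc of_nat_Suc)
  qed
  have l1: "(\<lambda>n. exp (- x n / (1 - y n))) \<longlonglongrightarrow> exp (- l / (1 - 0))"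
    by (intro tendsto_intros x y) auto
  have l2: "(\<lambda>n. exp (- x n)) \<longlonglongrightarrow> exp (- l)"
    by (intro tendsto_intros x)
  have "(\<lambda>n. (1 - y n) ^ Suc n) \<longlonglongrightarrow> exp (- l)"
    by (rule tendsto_sandwich[OF _ _ _ l2]) (use l1 up lo in \<open>auto simp del: power_Suc\<close>)
  then show ?thesis by (simp add: y_def)
qed

text \<open>The derivative of 1 - exp (- l h) at h = 0 is l. Along h = (n + 1) powr (- 1 / a) the
  difference quotient is raised to the power a, and then h powr a = 1 / (n + 1) produces the factor
  n + 1.\<close>

lemma one_minus_exp_powr_limit:
  fixes a l :: real
  assumes a: "0 < a" and l: "0 < l"
  shows "(\<lambda>n. Suc n * (1 - exp (- l * Suc n powr (- 1 / a))) powr a) \<longlonglongrightarrow> l powr a"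
proof -
  have "((\<lambda>h. - exp (- l * h)) has_real_derivative l) (at 0)"
    by (auto intro!: derivative_eq_intros)
  then have d: "((\<lambda>h. (- exp (- l * h) - - exp (- l * 0)) / (h - 0)) \<longlongrightarrow> l) (at 0)"
    by (simp add: has_field_derivative_iff)
  have h0: "(\<lambda>n. real (Suc n) powr (- 1 / a)) \<longlonglongrightarrow> 0"
  proof (rule tendsto_neg_powr)
    show "filterlim (\<lambda>n. real (Suc n)) at_top sequentially"
      using filterlim_compose[OF filterlim_real_sequentially filterlim_Suc] .
  qed (use a in auto)
  have "filterlim (\<lambda>n. real (Suc n) powr (- 1 / a)) (at 0) sequentially"
    using h0 by (auto simp: filterlim_at)
  from filterlim_compose[OF d this]
  have "(\<lambda>n. (1 - exp (- l * Suc n powr (- 1 / a))) / Suc n powr (- 1 / a)) \<longlonglongrightarrow> l"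
    by simp
  then have "(\<lambda>n. ((1 - exp (- l * Suc n powr (- 1 / a))) / Suc n powr (- 1 / a)) powr a) \<longlonglongrightarrow> l powr a"
    using l by (intro tendsto_powr tendsto_const) auto
  moreover have "((1 - exp (- l * Suc n powr (- 1 / a))) / Suc n powr (- 1 / a)) powr a =
    Suc n * (1 - exp (- l * Suc n powr (- 1 / a))) powr a" for n
  proof -
    have "(real (Suc n) powr (- 1 / a)) powr a = 1 / Suc n"
      using a by (simp only: powr_powr) (simp add: powr_minus_divide)
    then show ?thesis using l by (subst powr_divide) auto
  qed
  ultimately show ?thesis by simp
qed

text \<open>\<open>\<nu> n\<close> is the law of the scaled sum of n + 1 Sibuya variables. A bound
  on the Laplace transforms that is uniform in n gives tightness, and a weak subsequential limit
  inherits the limiting transform. Replacing x by \<open>max x 0\<close> makes the integrand bounded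
  and continuous on the whole line, as weak convergence requires.\<close>

theorem positive_stable_exists:
  fixes a :: real
  assumes a: "0 < a" "a < 1"
  shows "\<exists>\<mu>. real_distribution \<mu> \<and> (AE x in \<mu>. 0 < x) \<and>
    (\<forall>l\<ge>0. (\<integral>x. exp (- l * x) \<partial>\<mu>) = exp (- (l powr a)))"
proof -
  obtain p where p: "\<And>s. 0 \<le> s \<Longrightarrow> s < 1 \<Longrightarrow> measure_pmf.expectation p (\<lambda>k::nat. s ^ k) = 1
      - (1 - s) powr a"
    using sibuya_pmf[OF a] by blast
  have "\<exists>r :: nat \<Rightarrow> nat pmf. \<forall>n s. 0 \<le> s \<longrightarrow> s < 1 \<longrightarrow>
      measure_pmf.expectation (r n) (\<lambda>k. s ^ k) = (1 - (1 - s) powr a) ^ n"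
    using iid_sum_pmf[of p] p by (intro choice allI) auto
  then obtain r :: "nat \<Rightarrow> nat pmf" where r: "\<And>n s. 0 \<le> s \<Longrightarrow> s < 1 \<Longrightarrow>
      measure_pmf.expectation (r n) (\<lambda>k. s ^ k) = (1 - (1 - s) powr a) ^ n" by blast
  define c where "c n = real (Suc n) powr (- 1 / a)" for n
  define \<nu> where "\<nu> n = distr (measure_pmf (r (Suc n))) borel (\<lambda>k. real k * c n)" for n
  have c0: "c n > 0" for n by (simp add: c_def)
  have rd: "real_distribution (\<nu> n)" for n
    unfolding \<nu>_def by (intro prob_space.real_distribution_distr[OF prob_space_measure_pmf]) simp
  have lap: "(\<integral>x. exp (- l * max x 0) \<partial>\<nu> n) = (1 - (1 - exp (- l * c n)) powr a) ^ Suc n" if "l > 0" for l n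
  proof -
    have "(\<integral>x. exp (- l * max x 0) \<partial>\<nu> n) = measure_pmf.expectation (r (Suc n)) (\<lambda>k. exp (- l * c n) ^ k)"
    proof -
      have "max (real k * c n) 0 = real k * c n" for k
        using c0[of n] by (intro max_absorb1) simp
      then have "exp (- l * max (real k * c n) 0) = exp (- l * c n) ^ k" for k
        by (subst exp_of_nat_mult[symmetric]) (simp add: mult_ac)
      then show ?thesis
        unfolding \<nu>_def by (subst integral_distr) auto
    qed
    then show ?thesis using r[of "exp (- l * c n)" "Suc n"] that c0[of n] by simp
  qed
  have bnd: "0 \<le> 1 - exp (- l * c n)" "1 - exp (- l * c n) < 1" "1 - exp (- l * c n) \<le> l * c n" if "l > 0" for l n
    using that c0[of n] exp_ge_add_one_self[of "- l * c n"] by auto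
  have ca: "Suc n * c n powr a = 1" for n
    using a by (simp only: c_def powr_powr) (simp add: powr_minus_divide)
  \<comment> \<open>Bernoulli's inequality together with \<open>ca\<close> removes n from the bound;
    tightness rests on this.\<close>
  have lap_ge: "(\<integral>x. exp (- l * max x 0) \<partial>\<nu> n) \<ge> 1 - l powr a" if "l > 0" for l n
  proof -
    have y: "(1 - exp (- l * c n)) powr a \<le> 1"
      using bnd[OF that, of n] a by (intro powr_le1) auto
    have "1 - l powr a = 1 - Suc n * (l * c n) powr a"
      using ca[of n] that c0[of n] by (simp add: powr_mult algebra_simps)
    also have "\<dots> \<le> 1 - Suc n * (1 - exp (- l * c n)) powr a"
      using bnd[OF that, of n] a by (intro diff_left_mono mult_left_mono powr_mono2) auto
    also have "\<dots> = 1 + Suc n * (- ((1 - exp (- l * c n)) powr a))" by simp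
    also have "\<dots> \<le> (1 + (- ((1 - exp (- l * c n)) powr a))) ^ Suc n"
      using y by (intro Bernoulli_inequality) auto
    finally show ?thesis by (simp only: lap[OF that] diff_conv_add_uminus)
  qed
  have lap_lim: "(\<lambda>n. \<integral>x. exp (- l * max x 0) \<partial>\<nu> n) \<longlonglongrightarrow> exp (- (l powr a))" if l: "l > 0" for l
  proof -
    define x where "x n = Suc n * (1 - exp (- l * c n)) powr a" for n
    have "(1 - exp (- l * c n)) powr a < 1" for n
      using bnd[OF l, of n] a powr_less_mono2[of a "1 - exp (- l * c n)" 1] by auto
    then have "x n < Suc n" for n
      unfolding x_def by (metis mult.right_neutral mult_strict_left_mono of_nat_0_less_iff zero_less_Suc)
    moreover have "x \<longlonglongrightarrow> l powr a"
      using one_minus_exp_powr_limit[OF a(1) l] unfolding x_def c_def .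
    moreover have "0 \<le> x n" for n by (simp add: x_def)
    ultimately have "(\<lambda>n. (1 - x n / Suc n) ^ Suc n) \<longlonglongrightarrow> exp (- (l powr a))"
      by (intro power_one_minus_tendsto_exp)
    then show ?thesis
      unfolding lap[OF l] x_def by (simp del: power_Suc of_nat_Suc)
  qed
  have tight: "tight \<nu>"
    unfolding tight_def
  proof (intro conjI allI impI)
    fix e :: real assume e: "e > 0"
    have e1: "0 < 1 - exp (- 1 :: real)" by simp
    \<comment> \<open>Chosen for a Markov-type estimate: where x > 1 / l the integrand 1 - exp (- l
      x) is at least 1 - exp (- 1), while its mean is at most l powr a, so the tail beyond 1 / l has
      mass at most e / 2.\<close>
    define l where "l = (e * (1 - exp (- 1)) / 2) powr (1 / a)"
    have l: "l > 0" "l powr a = e * (1 - exp (- 1)) / 2"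
      using e e1 a by (auto simp: l_def powr_powr)
    have "measure (\<nu> n) {-1<..inverse l} > 1 - e" for n
    proof -
      interpret real_distribution "\<nu> n" by (rule rd)
      have int: "integrable (\<nu> n) (\<lambda>x. exp (- l * max x 0))"
        by (rule integrable_const_bound[where B=1]) (use l in auto)
      have neg: "prob {..-1} = 0"
      proof -
        have "(\<lambda>k. real k * c n) -` {..-1} = {}"
        proof -
          have "- 1 < real k * c n" for k
          proof -
            have "0 \<le> real k * c n" using c0[of n] by simp
            then show ?thesis by linarith
          qed
          then show ?thesis using leD by auto
        qed
        then show ?thesis
          unfolding \<nu>_def by (subst measure_distr) auto
      qed
      have "prob {inverse l<..} * (1 - exp (- 1)) = (\<integral>x. indicator {inverse l<..} x * (1 - exp (-1)) \<partial>\<nu> n)"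
        by simp
      also have "\<dots> \<le> (\<integral>x. 1 - exp (- l * max x 0) \<partial>\<nu> n)"
      proof (intro integral_mono)
        fix x assume "x \<in> space (\<nu> n)"
        have "exp (- l * max x 0) \<le> exp (-1)" if "x > inverse l"
        proof -
          have "l * inverse l \<le> l * max x 0"
            using that l by (intro mult_left_mono) auto
          then show ?thesis using l by simp
        qed
        then show "indicator {inverse l<..} x * (1 - exp (-1)) \<le> 1 - exp (- l * max x 0)"
          using l by (auto simp: indicator_def)
      qed (use int in \<open>auto intro!: integrable_real_indicator simp: emeasure_eq_measure\<close>)
      also have "\<dots> = 1 - (\<integral>x. exp (- l * max x 0) \<partial>\<nu> n)"
        using int prob_space by simp
      also have "\<dots> \<le> e / 2 * (1 - exp (- 1))"
        using lap_ge[OF l(1), of n] l(2) by simp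
      finally have up: "prob {inverse l<..} \<le> e / 2"
        using e1 by (simp only: mult_le_cancel_right_pos)
      have "UNIV = {..-1} \<union> {-1<..inverse l} \<union> {inverse l<..}" by auto
      then have "1 = prob ({..-1} \<union> {-1<..inverse l} \<union> {inverse l<..})"
        using prob_space by (simp only: space_eq_univ)
      also have "\<dots> \<le> prob {..-1} + prob {-1<..inverse l} + prob {inverse l<..}"
        by (intro order_trans[OF measure_Un_le] add_right_mono measure_Un_le) auto
      finally show ?thesis using neg up e by simp
    qed
    then show "\<exists>a b. a < b \<and> (\<forall>n. 1 - e < measure (\<nu> n) {a<..b})"
      using l(1) by (intro exI[of _ "-1"] exI[of _ "inverse l"]) (simp add: less_trans[of "-1" 0])
  qed (use rd in auto)
  obtain s \<mu> where s: "strict_mono (s :: nat \<Rightarrow> nat)" and \<mu>: "real_distribution \<mu>" and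
    wc: "weak_conv_m (\<nu> \<circ> id \<circ> s) \<mu>"
    using tight_imp_convergent_subsubsequence[OF tight, of id] by (auto simp: strict_mono_def)
  interpret real_distribution \<mu> by fact
  have mu_lap: "(\<integral>x. exp (- l * max x 0) \<partial>\<mu>) = exp (- (l powr a))" if l: "l > 0" for l
  proof (rule LIMSEQ_unique)
    have "isCont (\<lambda>x. exp (- l * max x 0)) x" for x :: real
      by (intro continuous_intros)
    then show "(\<lambda>n. \<integral>x. exp (- l * max x 0) \<partial>\<nu> (s n)) \<longlonglongrightarrow>
        (\<integral>x. exp (- l * max x 0) \<partial>\<mu>)"
      using weak_conv_imp_integral_bdd_continuous_conv[OF _ \<mu> wc, of "\<lambda>x. exp (- l * max x 0)" 1] rd l
      by (auto simp: o_def)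
    show "(\<lambda>n. \<integral>x. exp (- l * max x 0) \<partial>\<nu> (s n)) \<longlonglongrightarrow> exp (- (l powr a))"
      using LIMSEQ_subseq_LIMSEQ[OF lap_lim[OF l] s] by (simp add: o_def)
  qed
  \<comment> \<open>The integrand equals 1 on the nonpositive half-line, so the mass there is below
    the transform at every l, and that tends to 0 as l grows.\<close>
  have lap_ge: "prob {..0} \<le> exp (- (l powr a))" if l: "l > 0" for l
  proof -
    have "prob {..0} = (\<integral>x. indicator {..0} x \<partial>\<mu>)" by simp
    also have "\<dots> \<le> (\<integral>x. exp (- l * max x 0) \<partial>\<mu>)"
    proof (rule integral_mono)
      show "integrable \<mu> (\<lambda>x. exp (- l * max x 0))"
        using l by (intro integrable_const_bound[where B=1]) auto
    qed (use l in \<open>auto intro!: integrable_real_indicator simp: emeasure_eq_measure split: split_indicator\<close>)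
    finally show ?thesis by (simp only: mu_lap[OF l])
  qed
  have "((\<lambda>l. exp (- (l powr a))) \<longlongrightarrow> 0) at_top"
  proof (rule filterlim_compose[OF exp_at_bot])
    show "filterlim (\<lambda>l. - (l powr a)) at_bot at_top"
    proof -
      have "filterlim (\<lambda>l. exp (a * ln l)) at_top at_top"
        by (intro filterlim_compose[OF exp_at_top] filterlim_tendsto_pos_mult_at_top[OF tendsto_const a(1) ln_at_top])
      moreover have "\<forall>\<^sub>F l in at_top. exp (a * ln l) = l powr a"
        using eventually_gt_at_top[of "0 :: real"] by eventually_elim (simp add: powr_def)
      ultimately have "filterlim (\<lambda>l::real. l powr a) at_top at_top"
        by (simp add: filterlim_cong)
      then show ?thesis by (simp add: filterlim_uminus_at_bot)
    qed
  qed
  moreover have "\<forall>\<^sub>F l in at_top. prob {..0} \<le> exp (- (l powr a))"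
    using eventually_gt_at_top[of 0] by eventually_elim (rule lap_ge)
  ultimately have "prob {..0} \<le> 0"
    by (intro tendsto_lowerbound[of _ _ at_top]) auto
  then have pos: "AE x in \<mu>. 0 < x"
    using prob_eq_0[of "{..0}"] measure_nonneg[of \<mu> "{..0}"] by (auto simp: not_le)
  have "(\<integral>x. exp (- l * x) \<partial>\<mu>) = exp (- (l powr a))" if "l \<ge> 0" for l
  proof (cases "l = 0")
    case True
    then show ?thesis using a prob_space by simp
  next
    case False
    have "(\<integral>x. exp (- l * x) \<partial>\<mu>) = (\<integral>x. exp (- l * max x 0) \<partial>\<mu>)"
    proof (intro integral_cong_AE)
      show "AE x in \<mu>. exp (- l * x) = exp (- l * max x 0)"
        using pos by eventually_elim simp
    qed auto
    then show ?thesis using mu_lap that False by simp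
  qed
  with \<mu> pos show ?thesis by blast
qed

text \<open>
  \<open>1 / x\<close> is the integral of \<open>exp (- l * x)\<close> over \<open>l \<ge> 0\<close>, so its mean is the integral of the
  Laplace transform.
\<close>

lemma positive_stable_inverse_moment:
  fixes a :: real
  assumes a: "1 / 2 \<le> a" and \<mu>: "real_distribution \<mu>" "AE x in \<mu>. 0 < x"
    and lap: "\<And>l. l \<ge> 0 \<Longrightarrow> (\<integral>x. exp (- l * x) \<partial>\<mu>) = exp (- (l powr a))"
  shows "integrable \<mu> (\<lambda>x. 1 / x)"
proof -
  interpret real_distribution \<mu> by fact
  interpret pair_sigma_finite \<mu> lborel ..
  have inv: "(\<integral>\<^sup>+l. ennreal (exp (- l * x)) * indicator {0..} l \<partial>lborel) = ennreal (1 / x)" if "x > 0" for x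
  proof -
    have "((\<lambda>l. - exp (- l * x) / x) \<longlongrightarrow> - 0 / x) at_top"
    proof (intro tendsto_intros filterlim_compose[OF exp_at_bot])
      show "filterlim (\<lambda>l. - l * x) at_bot at_top"
        using filterlim_tendsto_pos_mult_at_top[OF tendsto_const that filterlim_ident]
        by (simp add: filterlim_uminus_at_bot mult.commute)
    qed (use that in auto)
    then have "(\<integral>\<^sup>+l. ennreal (exp (- l * x)) * indicator {0..} l \<partial>lborel) = ennreal (0 - (- exp (- 0 * x) / x))"
      using that by (intro nn_integral_FTC_atLeast) (auto intro!: derivative_eq_intros)
    then show ?thesis by simp
  qed
  have "(\<integral>\<^sup>+x. ennreal (norm (1 / x)) \<partial>\<mu>) =
      (\<integral>\<^sup>+x. (\<integral>\<^sup>+l. ennreal (exp (- l * x)) * indicator {0..} l \<partial>lborel) \<partial>\<mu>)"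
  proof (rule nn_integral_cong_AE)
    show "AE x in \<mu>. ennreal (norm (1 / x)) = (\<integral>\<^sup>+l. ennreal (exp (- l * x)) * indicator {0..} l \<partial>lborel)"
      using \<mu>(2)
    proof eventually_elim
      case (elim x)
      then show ?case unfolding inv[OF elim] by simp
    qed
  qed
  also have "\<dots> = (\<integral>\<^sup>+l. (\<integral>\<^sup>+x. ennreal (exp (- l * x)) * indicator {0..} l \<partial>\<mu>) \<partial>lborel)"
    by (rule Fubini'[symmetric]) simp
  also have "\<dots> = (\<integral>\<^sup>+l. ennreal (exp (- (l powr a))) * indicator {0..} l \<partial>lborel)"
  proof (intro nn_integral_cong)
    fix l :: real
    have "(\<integral>\<^sup>+x. ennreal (exp (- l * x)) \<partial>\<mu>) = ennreal (exp (- (l powr a)))" if "l \<ge> 0"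
    proof -
      have "integrable \<mu> (\<lambda>x. exp (- l * x))"
        using \<mu>(2) that by (intro integrable_const_bound[where B=1]) (auto elim!: eventually_mono)
      then show ?thesis using lap[OF that] by (simp add: nn_integral_eq_integral)
    qed
    then show "(\<integral>\<^sup>+x. ennreal (exp (- l * x)) * indicator {0..} l \<partial>\<mu>) = ennreal (exp (- (l powr a))) * indicator {0..} l"
      by (auto simp: indicator_def)
  qed
  also have "\<dots> \<le> (\<integral>\<^sup>+l. indicator {0..1} l + ennreal (256 / l\<^sup>2) * indicator {1..} l \<partial>lborel)"
  proof (intro nn_integral_mono)
    fix l :: real
    \<comment> \<open>For l > 1 and a >= 1/2 the transform is at most exp (- sqrt l). The inequality
      exp y >= (1 + y / 4) ^ 4 at y = sqrt l bounds its inverse from below by l^2 / 256, with 256 =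
      4 ^ 4.\<close>
    have "exp (- (l powr a)) \<le> 256 / l\<^sup>2" if l: "l > 1"
    proof -
      have "l powr (1/2) \<le> l powr a" using a l by (intro powr_mono) auto
      then have "exp (sqrt l) \<le> exp (l powr a)" using l by (simp add: powr_half_sqrt)
      moreover have "l\<^sup>2 / 256 \<le> exp (sqrt l)"
      proof -
        have "l\<^sup>2 / 256 = (sqrt l / 4) ^ 4"
          using l by (simp add: power_divide power4_eq_xxxx power2_eq_square)
        also have "\<dots> \<le> (1 + sqrt l / real 4) ^ 4"
          using l by (intro power_mono) auto
        also have "\<dots> \<le> exp (sqrt l)"
        proof (rule exp_ge_one_plus_x_over_n_power_n)
          have "0 \<le> sqrt l" using l by simp
          then show "- real 4 \<le> sqrt l" by linarith
        qed simp
        finally show ?thesis .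
      qed
      ultimately have "l\<^sup>2 / 256 \<le> exp (l powr a)" by linarith
      then show ?thesis using l by (simp add: exp_minus field_simps)
    qed
    moreover have "ennreal (exp (- (l powr a))) * indicator {0..} l \<le> indicator {0..1} l" if "\<not> l > 1"
      using that by (auto simp: indicator_def)
    ultimately show "ennreal (exp (- (l powr a))) * indicator {0..} l \<le> indicator {0..1} l + ennreal (256 / l\<^sup>2) * indicator {1..} l"
      by (cases "l > 1") (simp_all add: ennreal_leI add_increasing2)
  qed
  also have "\<dots> = 1 + (\<integral>\<^sup>+l. ennreal (256 / l\<^sup>2) * indicator {1..} l \<partial>lborel)"
    by (subst nn_integral_add) auto
  also have "(\<integral>\<^sup>+l. ennreal (256 / l\<^sup>2) * indicator {1..} l \<partial>lborel) = ennreal (0 - (- 256 / 1))"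
  proof (rule nn_integral_FTC_atLeast[where F="\<lambda>l. - 256 / l"])
    show "((\<lambda>l::real. - 256 / l) \<longlongrightarrow> 0) at_top"
      by (rule real_tendsto_divide_at_top[OF tendsto_const]) (rule filterlim_ident)
  qed (auto intro!: derivative_eq_intros simp: power2_eq_square)
  also have "1 + \<dots> < \<infinity>" by simp
  finally show ?thesis
    by (intro integrableI_bounded) auto
qed

section \<open>Orthonormal expansions and the semigroup\<close>

lemma norm_sum_orthonormal:
  fixes e :: "nat \<Rightarrow> 'h::real_inner"
  assumes ons: "\<And>i j. e i \<bullet> e j = (if i = j then 1 else 0)" and "finite I"
  shows "(norm (\<Sum>n\<in>I. c n *\<^sub>R e n))\<^sup>2 = (\<Sum>n\<in>I. (c n)\<^sup>2)"
  unfolding power2_norm_eq_inner using \<open>finite I\<close>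
  by (simp add: inner_sum_left inner_sum_right ons power2_eq_square sum.delta' if_distrib cong: if_cong)

lemma summable_orthonormal:
  fixes e :: "nat \<Rightarrow> 'h::{real_inner, banach}"
  assumes ons: "\<And>i j. e i \<bullet> e j = (if i = j then 1 else 0)" and c: "summable (\<lambda>n. (c n)\<^sup>2)"
  shows "summable (\<lambda>n. c n *\<^sub>R e n)"
  unfolding summable_Cauchy
proof (intro allI impI)
  fix r :: real assume r: "0 < r"
  then obtain N where N: "\<And>m n. m \<ge> N \<Longrightarrow> norm (\<Sum>k=m..<n. (c k)\<^sup>2) < r\<^sup>2"
    using c[unfolded summable_Cauchy, rule_format, of "r\<^sup>2"] by auto
  have "norm (\<Sum>k=m..<n. c k *\<^sub>R e k) < r" if "m \<ge> N" for m n
  proof (rule power2_less_imp_less)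
    show "(norm (\<Sum>k=m..<n. c k *\<^sub>R e k))\<^sup>2 < r\<^sup>2"
      using N[OF that, of n] norm_sum_orthonormal[OF ons, of "{m..<n}" c] by (simp add: sum_nonneg)
  qed (use r in simp)
  then show "\<exists>N. \<forall>m\<ge>N. \<forall>n. norm (\<Sum>k=m..<n. c k *\<^sub>R e k) < r" by blast
qed

lemma norm_suminf_orthonormal:
  fixes e :: "nat \<Rightarrow> 'h::{real_inner, banach}"
  assumes ons: "\<And>i j. e i \<bullet> e j = (if i = j then 1 else 0)" and c: "summable (\<lambda>n. (c n)\<^sup>2)"
  shows "(norm (\<Sum>n. c n *\<^sub>R e n))\<^sup>2 = (\<Sum>n. (c n)\<^sup>2)"
proof (rule LIMSEQ_unique)
  show "(\<lambda>N. \<Sum>n<N. (c n)\<^sup>2) \<longlonglongrightarrow> (\<Sum>n. (c n)\<^sup>2)"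
    using c by (rule summable_LIMSEQ)
  have "(\<lambda>N. (norm (\<Sum>n<N. c n *\<^sub>R e n))\<^sup>2) \<longlonglongrightarrow> (norm (\<Sum>n. c n *\<^sub>R e n))\<^sup>2"
    by (intro tendsto_intros summable_LIMSEQ summable_orthonormal ons c)
  then show "(\<lambda>N. \<Sum>n<N. (c n)\<^sup>2) \<longlonglongrightarrow> (norm (\<Sum>n. c n *\<^sub>R e n))\<^sup>2"
    by (simp add: norm_sum_orthonormal[OF ons])
qed

lemma inner_suminf_orthonormal:
  fixes e :: "nat \<Rightarrow> 'h::{real_inner, banach}"
  assumes ons: "\<And>i j. e i \<bullet> e j = (if i = j then 1 else 0)" and c: "summable (\<lambda>n. (c n)\<^sup>2)"
  shows "(\<Sum>n. c n *\<^sub>R e n) \<bullet> e m = c m"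
proof -
  have "(\<Sum>n. c n *\<^sub>R e n) \<bullet> e m = (\<Sum>n. (c n *\<^sub>R e n) \<bullet> e m)"
    by (intro bounded_linear.suminf[OF bounded_linear_inner_left] summable_orthonormal ons c)
  also have "\<dots> = (\<Sum>n. if n = m then c n else 0)"
    by (intro suminf_cong) (simp add: ons)
  also have "\<dots> = c m"
    using suminf_split_initial_segment[of "\<lambda>n. if n = m then c n else 0" "Suc m"]
    by (simp add: suminf_finite[of "{m}"])
  finally show ?thesis .
qed

lemma bessel_inequality_sum:
  fixes e :: "nat \<Rightarrow> 'h::real_inner"
  assumes ons: "\<And>i j. e i \<bullet> e j = (if i = j then 1 else 0)"
  shows "(\<Sum>n<N. (x \<bullet> e n)\<^sup>2) \<le> (norm x)\<^sup>2"
proof -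
  let ?s = "\<Sum>n<N. (x \<bullet> e n) *\<^sub>R e n"
  have "0 \<le> (x - ?s) \<bullet> (x - ?s)" by simp
  also have "\<dots> = x \<bullet> x - 2 * (x \<bullet> ?s) + ?s \<bullet> ?s"
    by (simp add: inner_diff_left inner_diff_right inner_commute)
  also have "x \<bullet> ?s = (\<Sum>n<N. (x \<bullet> e n)\<^sup>2)"
    by (simp add: inner_sum_right power2_eq_square)
  also have "?s \<bullet> ?s = (\<Sum>n<N. (x \<bullet> e n)\<^sup>2)"
    using norm_sum_orthonormal[OF ons, of "{..<N}" "\<lambda>n. x \<bullet> e n"] by (simp add: power2_norm_eq_inner)
  finally show ?thesis by (simp add: power2_norm_eq_inner)
qed

lemma summable_coefficients:
  fixes e :: "nat \<Rightarrow> 'h::real_inner"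
  assumes ons: "\<And>i j. e i \<bullet> e j = (if i = j then 1 else 0)"
  shows "summable (\<lambda>n. (x \<bullet> e n)\<^sup>2)"
  by (rule summableI_nonneg_bounded[where x="(norm x)\<^sup>2"]) (use bessel_inequality_sum[OF ons] in auto)

lemma orthonormal_basis_inner: "orthonormal_basis e \<Longrightarrow> e i \<bullet> e j = (if i = j then 1 else 0)"
  by (simp add: orthonormal_basis_def)

text \<open>The vectors orthogonal to x - y form a closed subspace that contains the basis; it is
  therefore everything and contains x - y itself.\<close>

lemma orthonormal_basis_eqI:
  assumes e: "orthonormal_basis e" and eq: "\<And>n. x \<bullet> e n = y \<bullet> e n"
  shows "x = y"
proof -
  have "span (range e) \<subseteq> {z. (x - y) \<bullet> z = 0}"
    by (rule span_minimal[OF _ subspace_hyperplane]) (use eq in \<open>auto simp: inner_diff_left\<close>)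
  then have "closure (span (range e)) \<subseteq> {z. (x - y) \<bullet> z = 0}"
    by (intro closure_minimal closed_hyperplane)
  then have "(x - y) \<bullet> (x - y) = 0"
    using e unfolding orthonormal_basis_def by blast
  then show ?thesis by simp
qed

lemma orthonormal_basis_expansion:
  assumes e: "orthonormal_basis e"
  shows "(\<Sum>n. (x \<bullet> e n) *\<^sub>R e n) = x"
  by (rule orthonormal_basis_eqI[OF e])
    (intro inner_suminf_orthonormal summable_coefficients orthonormal_basis_inner[OF e])

lemma orthonormal_basis_parseval:
  assumes e: "orthonormal_basis e"
  shows "(norm x)\<^sup>2 = (\<Sum>n. (x \<bullet> e n)\<^sup>2)"
  using norm_suminf_orthonormal[of e "\<lambda>n. x \<bullet> e n"] summable_coefficients[of e x]
  by (simp add: orthonormal_basis_inner[OF e] orthonormal_basis_expansion[OF e])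

text \<open>Dominated convergence for orthogonal series. The dominating coefficients are only square
  summable, so the series need not converge absolutely; Tannery's theorem is applied instead to the
  squared norm of the difference, dominated by the squares of \<open>2 * b n\<close>.\<close>

lemma tendsto_suminf_orthonormal:
  fixes e :: "nat \<Rightarrow> 'h::{real_inner, banach}" and c :: "'a \<Rightarrow> nat \<Rightarrow> real"
  assumes ons: "\<And>i j. e i \<bullet> e j = (if i = j then 1 else 0)" and b: "summable (\<lambda>n. (b n)\<^sup>2)"
    and lim: "\<And>n. ((\<lambda>k. c k n) \<longlongrightarrow> d n) F" and bound: "eventually (\<lambda>k. \<forall>n. \<bar>c k n\<bar> \<le>
        b n) F"
    and F: "F \<noteq> bot"
  shows "((\<lambda>k. \<Sum>n. c k n *\<^sub>R e n) \<longlongrightarrow> (\<Sum>n. d n *\<^sub>R e n)) F"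
proof -
  have dom: "summable (\<lambda>n. (f n)\<^sup>2)" if "\<And>n. \<bar>f n\<bar> \<le> b n" for f
    by (rule summable_comparison_test[OF _ b]) (use that
        in \<open>auto intro!: exI[of _ 0] abs_le_square_iff[THEN iffD1] intro: order_trans[OF _ abs_ge_self]\<close>)
  have db: "\<bar>d n\<bar> \<le> b n" for n
    using bound by (intro tendsto_upperbound[OF tendsto_rabs[OF lim] _ F]) (auto elim: eventually_mono)
  have b2: "summable (\<lambda>n. (2 * b n)\<^sup>2)"
    using summable_mult[OF b, of 4] by (simp add: power_mult_distrib)
  have ev: "eventually (\<lambda>(n, k). norm ((c k n - d n)\<^sup>2) \<le> (2 * b n)\<^sup>2) (at_top \<times>\<^sub>F F)"
    unfolding eventually_prod_filter
  proof (intro exI conjI allI impI)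
    show "\<forall>\<^sub>F n in sequentially. True" by simp
    show "\<forall>\<^sub>F k in F. \<forall>n. \<bar>c k n\<bar> \<le> b n" by (rule bound)
    show "case (n, k) of (n, k) \<Rightarrow> norm ((c k n - d n)\<^sup>2) \<le> (2 * b n)\<^sup>2" if "\<forall>n. \<bar>c k n\<bar> \<le>
        b n" for n k
    proof -
      have "\<bar>c k n - d n\<bar> \<le> 2 * b n" using spec[OF that, of n] db[of n] by linarith
      then show ?thesis
        using power_mono[of "\<bar>c k n - d n\<bar>" "2 * b n" 2] by simp
    qed
  qed
  have sq: "((\<lambda>k. \<Sum>n. (c k n - d n)\<^sup>2) \<longlongrightarrow> (\<Sum>n. 0)) F"
    by (rule tannerys_theorem[THEN conjunct2, THEN conjunct2, OF _ ev b2 F])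
      (use lim in \<open>auto intro!: tendsto_eq_intros\<close>)
  have "eventually (\<lambda>k. (\<Sum>n. (c k n - d n)\<^sup>2) = (norm ((\<Sum>n. c k n *\<^sub>R e n) - (\<Sum>n. d n *\<^sub>R e n)))\<^sup>2) F"
    using bound
  proof eventually_elim
    case (elim k)
    have s: "summable (\<lambda>n. c k n *\<^sub>R e n)" "summable (\<lambda>n. d n *\<^sub>R e n)"
      using elim db by (auto intro!: summable_orthonormal ons dom)
    have "summable (\<lambda>n. (c k n - d n)\<^sup>2)"
    proof (rule summable_comparison_test[OF _ b2], intro exI[of _ 0] allI impI)
      fix n
      have "\<bar>c k n - d n\<bar> \<le> 2 * b n" using spec[OF elim, of n] db[of n] by linarith
      then show "norm ((c k n - d n)\<^sup>2) \<le> (2 * b n)\<^sup>2"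
        using power_mono[of "\<bar>c k n - d n\<bar>" "2 * b n" 2] by simp
    qed
    from norm_suminf_orthonormal[OF ons this] show ?case
      by (simp add: suminf_diff[OF s] scaleR_diff_left)
  qed
  with sq have "((\<lambda>k. (norm ((\<Sum>n. c k n *\<^sub>R e n) - (\<Sum>n. d n *\<^sub>R e n)))\<^sup>2) \<longlongrightarrow> 0) F"
    by (simp add: filterlim_cong)
  from tendsto_real_sqrt[OF this] show ?thesis
    by (simp add: LIM_zero_iff tendsto_norm_zero_iff)
qed

section \<open>Strongly continuous semigroups near time zero and on eigenvectors\<close>

text \<open>Strong continuity at 0 bounds each orbit only on a time interval that depends on x. The
  closed sets \<open>E k\<close> nevertheless cover the space, so by Baire's theorem one of them
  contains a ball, and linearity carries the bound from that ball to the origin at the cost of a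
  factor 2.\<close>

lemma c0_semigroup_locally_bounded:
  assumes S: "c0_semigroup (S :: real \<Rightarrow> 'h::{real_inner, banach, polish_space} \<Rightarrow> 'h)"
  shows "\<exists>\<delta>>0. \<exists>B\<ge>0. \<forall>t\<in>{0..\<delta>}. \<forall>x. norm (S t x) \<le> B * norm x"
proof -
  have bl: "bounded_linear (S t)" if "t \<ge> 0" for t using S that by (auto simp: c0_semigroup_def)
  define E where "E k = {x. \<forall>t\<in>{0..1 / real (Suc k)}. norm (S t x) \<le> real k}" for k
  have clE: "closed (E k)" for k
  proof -
    have "E k = (\<Inter>t\<in>{0..1 / real (Suc k)}. {x. norm (S t x) \<le> real k})" by (auto simp: E_def)
    also have "closed \<dots>"
    proof (intro closed_INT ballI closed_Collect_le continuous_intros)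
      fix t assume "t \<in> {0..1 / real (Suc k)}"
      then show "continuous_on UNIV (S t)"
        using linear_continuous_on[OF bl] by simp
    qed
    finally show ?thesis .
  qed
  have cover: "\<exists>k. x \<in> E k" for x
  proof -
    have "((\<lambda>t. S t x) \<longlongrightarrow> x) (at_right 0)" using S by (auto simp: c0_semigroup_def)
    then have "\<forall>\<^sub>F t in at_right 0. norm (S t x - x) < 1"
      by (auto simp: tendsto_iff dist_norm)
    then obtain b where b: "b > 0" "\<And>t. 0 < t \<Longrightarrow> t < b \<Longrightarrow> norm (S t x - x) < 1"
      by (auto simp: eventually_at_right_field)
    have S0: "S 0 x = x" using S by (auto simp: c0_semigroup_def)
    obtain k1 :: nat where k1: "1 / b < real k1" using reals_Archimedean2 by blast
    obtain k2 :: nat where k2: "norm x + 1 < real k2" using reals_Archimedean2 by blast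
    define k where "k = max k1 k2"
    have "1 / real (Suc k) < b"
    proof -
      have "1 / b < real (Suc k)" using k1 by (simp add: k_def)
      then show ?thesis using b(1) by (simp add: field_simps)
    qed
    moreover have "norm (S t x) \<le> real k" if "0 \<le> t" "t < b" for t
    proof -
      have "norm (S t x) \<le> norm x + norm (S t x - x)" by (rule norm_triangle_sub)
      also have "\<dots> \<le> norm x + 1" using b(2)[of t] that S0 by (cases "t = 0") auto
      finally show ?thesis using k2 by (simp add: k_def)
    qed
    ultimately show ?thesis by (intro exI[of _ k]) (auto simp: E_def)
  qed
  have "\<exists>k. interior (E k) \<noteq> {}"
  proof (rule ccontr)
    assume "\<not> ?thesis"
    then have "Met_TC.mtopology interior_of \<Union>(range E) = {}"
      using clE by (intro Met_TC.metric_Baire_category_alt) (auto simp: complete_UNIV)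
    moreover have "\<Union>(range E) = UNIV" using cover by auto
    ultimately show False by simp
  qed
  then obtain k x0 where "x0 \<in> interior (E k)" by blast
  then obtain r where r: "r > 0" "cball x0 r \<subseteq> E k"
    by (auto simp: mem_interior_cball)
  define B where "B = 2 * real k / r"
  have "norm (S t y) \<le> B * norm y" if t: "t \<in> {0..1 / real (Suc k)}" for t y
  proof (cases "y = 0")
    case True
    then show ?thesis using bl[of t] t by (simp add: linear_simps)
  next
    case False
    interpret bounded_linear "S t" using bl t by simp
    define z where "z = (r / norm y) *\<^sub>R y"
    have z: "norm z = r" using False r by (simp add: z_def)
    have "x0 + z \<in> E k" "x0 \<in> E k" using r z by (auto simp: dist_norm subset_iff)
    then have "norm (S t (x0 + z)) \<le> k" "norm (S t x0) \<le> k" using t by (auto simp: E_def)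
    moreover have "S t z = S t (x0 + z) - S t x0" by (simp add: add)
    ultimately have "norm (S t z) \<le> 2 * real k" using norm_triangle_ineq4[of "S t (x0 + z)" "S t x0"] by simp
    then have "r / norm y * norm (S t y) \<le> 2 * real k" using r by (simp add: z_def scaleR)
    then show ?thesis using r False by (simp add: B_def field_simps)
  qed
  moreover have "B \<ge> 0" using r by (simp add: B_def)
  ultimately show ?thesis by (intro exI[of _ "1 / real (Suc k)"]) auto
qed

text \<open>The function g t = exp (c t) S t v ought to be constant, but only its right derivative
  at 0 is at hand, and it vanishes. Cutting [0,t] into equal pieces of length h and telescoping
  bounds the norm of g t - v by t K times the norm of (g h - v) / h, which tends to 0. The local
  bound K restricts this to small t; the semigroup law extends it.\<close>

lemma semigroup_eigenvector:
  assumes gen: "semigroup_generated_by D A S" and v: "v \<in> D" "A v = - c *\<^sub>R v" and t: "t \<ge> 0"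
  shows "S t v = exp (- c * t) *\<^sub>R v"
proof -
  have S: "c0_semigroup S" using gen by (simp add: semigroup_generated_by_def)
  have bl: "bounded_linear (S t)" if "t \<ge> 0" for t using S that by (auto simp: c0_semigroup_def)
  have S_add: "S (s + t) x = S s (S t x)" if "s \<ge> 0" "t \<ge> 0" for s t x
    using S that by (auto simp: c0_semigroup_def)
  obtain \<delta> B where \<delta>: "\<delta> > 0" and B: "B \<ge> 0" "\<And>t x. t \<in> {0..\<delta>} \<Longrightarrow> norm (S t x) \<le>
      B * norm x"
    using c0_semigroup_locally_bounded[OF S] by blast
  define g where "g t = exp (c * t) *\<^sub>R S t v" for t
  define K where "K = exp (\<bar>c\<bar> * \<delta>) * B"
  have K: "K \<ge> 0" using B by (simp add: K_def)
  have step: "norm (g (k * h) - v) \<le> k * (K * norm (g h - v))" if "h \<ge> 0" "k * h \<le> \<delta>" for k :: nat and h :: real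
    using that(2)
  proof (induction k)
    case 0
    then show ?case using S by (simp add: g_def c0_semigroup_def)
  next
    case (Suc k)
    have le: "k * h \<le> \<delta>" "0 \<le> k * h" using Suc(2) that by (auto simp: algebra_simps)
    interpret bounded_linear "S (k * h)" using bl le by simp
    have "S (k * h) (g h - v) = exp (c * h) *\<^sub>R S (Suc k * h) v - S (k * h) v"
      using S_add[of "k * h" h v] le that by (simp add: g_def diff scaleR distrib_right add.commute)
    then have "g (Suc k * h) - g (k * h) = exp (c * (k * h)) *\<^sub>R S (k * h) (g h - v)"
      by (simp add: g_def scaleR_diff_right exp_add[symmetric] distrib_left distrib_right)
    then have "norm (g (Suc k * h) - g (k * h)) = exp (c * (k * h)) * norm (S (k * h) (g h - v))" by simp
    also have "\<dots> \<le> exp (\<bar>c\<bar> * \<delta>) * (B * norm (g h - v))"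
    proof (rule mult_mono)
      have "c * (k * h) \<le> \<bar>c\<bar> * (k * h)" using le by (intro mult_right_mono) auto
      also have "\<dots> \<le> \<bar>c\<bar> * \<delta>" using le by (intro mult_left_mono) auto
      finally show "exp (c * (k * h)) \<le> exp (\<bar>c\<bar> * \<delta>)" by simp
    qed (use B le in auto)
    finally have "norm (g (Suc k * h) - g (k * h)) \<le> K * norm (g h - v)" by (simp add: K_def)
    moreover have "norm (g (Suc k * h) - v) \<le> norm (g (Suc k * h) - g (k * h)) + norm (g (k * h) - v)"
      using norm_triangle_ineq[of "g (Suc k * h) - g (k * h)" "g (k * h) - v"] by simp
    ultimately show ?case using Suc.IH[OF le(1)] by (simp add: algebra_simps)
  qed
  have lim: "((\<lambda>h. (S h v - v) /\<^sub>R h) \<longlongrightarrow> - c *\<^sub>R v) (at_right 0)"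
    using gen v by (auto simp: semigroup_generated_by_def)
  have "((\<lambda>h. exp (c * h)) has_real_derivative c) (at 0)"
    by (auto intro!: derivative_eq_intros)
  then have e1: "((\<lambda>h. (exp (c * h) - 1) / h) \<longlongrightarrow> c) (at_right 0)"
    by (auto simp: has_field_derivative_iff intro: tendsto_mono[OF at_le])
  have "((\<lambda>h. exp (c * h) *\<^sub>R ((S h v - v) /\<^sub>R h) + ((exp (c * h) - 1) / h) *\<^sub>R v) \<longlongrightarrow>
      exp (c * 0) *\<^sub>R (- c *\<^sub>R v) + c *\<^sub>R v) (at_right 0)"
    by (intro tendsto_intros lim e1)
  moreover have "exp (c * h) *\<^sub>R ((S h v - v) /\<^sub>R h) + ((exp (c * h) - 1) / h) *\<^sub>R v = (g h - v) /\<^sub>R h" for h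
    by (simp add: g_def algebra_simps divide_inverse)
  ultimately have glim: "((\<lambda>h. (g h - v) /\<^sub>R h) \<longlongrightarrow> 0) (at_right 0)" by simp
  have small: "g t = v" if t: "0 \<le> t" "t \<le> \<delta>" for t
  proof (cases "t = 0")
    case True
    then show ?thesis using S by (simp add: g_def c0_semigroup_def)
  next
    case False
    then have t0: "t > 0" using t by simp
    have "filterlim (\<lambda>m. t / real (Suc m)) (at_right 0) sequentially"
      using t0 LIMSEQ_inverse_real_of_nat tendsto_mult_right_zero[OF LIMSEQ_inverse_real_of_nat, of t]
      by (auto simp: filterlim_at divide_inverse)
    from filterlim_compose[OF glim this]
    have "(\<lambda>m. t * (K * norm ((g (t / real (Suc m)) - v) /\<^sub>R (t / real (Suc m))))) \<longlonglongrightarrow> t * (K * norm (0 :: 'a))"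
      by (intro tendsto_intros)
    moreover have "norm (g t - v) \<le> t * (K * norm ((g (t / real (Suc m)) - v) /\<^sub>R (t / real (Suc m))))" for m
    proof -
      define h where "h = t / real (Suc m)"
      have h: "h > 0" "real (Suc m) * h = t" using t0 by (simp_all add: h_def)
      have "norm (g t - v) \<le> real (Suc m) * (K * norm (g h - v))"
        using step[of h "Suc m"] h t by (simp del: of_nat_Suc)
      also have "\<dots> = t * (K * norm ((g h - v) /\<^sub>R h))"
      proof -
        have "norm ((g h - v) /\<^sub>R h) = norm (g h - v) / h"
          using h by (simp only: norm_scaleR) (simp add: divide_inverse mult.commute)
        then have "t * (K * norm ((g h - v) /\<^sub>R h)) = (t / h) * (K * norm (g h - v))" by simp
        moreover have "t / h = real (Suc m)" using h by (simp add: field_simps)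
        ultimately show ?thesis by (simp only:)
      qed
      finally show ?thesis by (simp only: h_def)
    qed
    ultimately have "norm (g t - v) \<le> 0"
      by (intro LIMSEQ_le_const) auto
    then show ?thesis by simp
  qed
  have S_small: "S t v = exp (- c * t) *\<^sub>R v" if "0 \<le> t" "t \<le> \<delta>" for t
  proof -
    have "exp (- c * t) *\<^sub>R g t = S t v" by (simp add: g_def exp_minus)
    then show ?thesis using small[OF that] by simp
  qed
  obtain m :: nat where m: "t / \<delta> < m" using reals_Archimedean2 by blast
  have m0: "m > 0" using m t \<delta> by (cases m) (auto simp: divide_less_0_iff)
  define s where "s = t / m"
  have s: "0 \<le> s" "s \<le> \<delta>" using m m0 t \<delta> by (auto simp: s_def field_simps)
  have "S (k * s) v = exp (- c * (k * s)) *\<^sub>R v" for k :: nat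
  proof (induction k)
    case 0
    then show ?case using S by (simp add: c0_semigroup_def)
  next
    case (Suc k)
    interpret bounded_linear "S s" using bl s by simp
    have "S (Suc k * s) v = S s (S (k * s) v)"
      using S_add[of s "k * s" v] s by (simp add: algebra_simps)
    also have "\<dots> = S s (exp (- c * (k * s)) *\<^sub>R v)" by (simp only: Suc)
    also have "\<dots> = exp (- c * (Suc k * s)) *\<^sub>R v"
      by (simp add: scaleR S_small[OF s] exp_add[symmetric] algebra_simps)
    finally show ?case .
  qed
  from this[of m] show ?thesis using m0 by (simp add: s_def)
qed

lemma semigroup_expansion:
  assumes e: "orthonormal_basis e" and gen: "semigroup_generated_by D A S"
    and eig: "range e \<subseteq> D" "\<And>n. A (e n) = - c n *\<^sub>R e n" and t: "t \<ge> 0"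
  shows "S t x = (\<Sum>n. (exp (- c n * t) * (x \<bullet> e n)) *\<^sub>R e n)"
proof -
  interpret bounded_linear "S t"
    using gen t by (auto simp: semigroup_generated_by_def c0_semigroup_def)
  have "S t (e n) = exp (- c n * t) *\<^sub>R e n" for n
    using eig by (intro semigroup_eigenvector[OF gen _ _ t]) auto
  then show ?thesis
    using suminf[OF summable_orthonormal[OF orthonormal_basis_inner[OF e] summable_coefficients[OF orthonormal_basis_inner[OF e], of x]]]
    by (simp add: orthonormal_basis_expansion[OF e] scaleR mult.commute)
qed

section \<open>Stochastic integrals\<close>

text \<open>Right continuity and left limits bound the path near every point, and compactness
  reduces these to finitely many neighbourhoods.\<close>

lemma cadlag_bounded:
  assumes z: "cadlag z"
  shows "\<exists>B. \<forall>s\<in>{0..t}. \<bar>z s\<bar> \<le> B"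
proof -
  have "\<exists>d>0. \<exists>B. \<forall>r\<in>{0..}. \<bar>r - s\<bar> < d \<longrightarrow> \<bar>z r\<bar> \<le> B" if s: "s \<ge> 0" for s
  proof -
    have "(z \<longlongrightarrow> z s) (at_right s)"
      using z s by (auto simp: cadlag_def continuous_within)
    then have "\<forall>\<^sub>F r in at_right s. dist (z r) (z s) < 1"
      by (rule tendstoD) simp
    then obtain b where b: "b > s" "\<And>r. s < r \<Longrightarrow> r < b \<Longrightarrow> dist (z r) (z s) < 1"
      by (auto simp: eventually_at_right_field)
    have right: "\<bar>z r\<bar> \<le> \<bar>z s\<bar> + 1" if "s \<le> r" "r < b" for r
      using b(2)[of r] that by (cases "r = s") (auto simp: dist_real_def)
    show ?thesis
    proof (cases "s = 0")
      case True
      then show ?thesis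
        using b(1) right by (intro exI[of _ b] conjI exI[of _ "\<bar>z s\<bar> + 1"]) auto
    next
      case False
      then have "s > 0" using s by simp
      then obtain l where "(z \<longlongrightarrow> l) (at_left s)"
        using z unfolding cadlag_def by blast
      then have "\<forall>\<^sub>F r in at_left s. dist (z r) l < 1"
        by (rule tendstoD) simp
      then obtain a where a: "a < s" "\<And>r. a < r \<Longrightarrow> r < s \<Longrightarrow> dist (z r) l < 1"
        by (auto simp: eventually_at_left_field)
      have left: "\<bar>z r\<bar> \<le> \<bar>l\<bar> + 1" if "a < r" "r < s" for r
        using a(2)[of r] that by (auto simp: dist_real_def)
      have "\<bar>z r\<bar> \<le> max (\<bar>z s\<bar> + 1) (\<bar>l\<bar> + 1)" if "\<bar>r - s\<bar> < min (b - s) (s - a)" for r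
        using left[of r] right[of r] that by (cases "r < s") (auto simp: le_max_iff_disj)
      then show ?thesis
        using a(1) b(1) by (intro exI[of _ "min (b - s) (s - a)"] conjI exI[of _ "max (\<bar>z s\<bar> + 1) (\<bar>l\<bar> + 1)"]) auto
    qed
  qed
  then have "\<forall>s. \<exists>d B. s \<ge> 0 \<longrightarrow> d > 0 \<and> (\<forall>r\<in>{0..}. \<bar>r
      - s\<bar> < d \<longrightarrow> \<bar>z r\<bar> \<le> B)" by blast
  then obtain d B where dB: "\<forall>s. s \<ge> 0 \<longrightarrow> d s > 0 \<and> (\<forall>r\<in>{0..}. \<bar>r
      - s\<bar> < d s \<longrightarrow> \<bar>z r\<bar> \<le> B s)"
    unfolding choice_iff by blast
  then have d: "\<And>s. s \<ge> 0 \<Longrightarrow> d s > 0"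
    and B: "\<And>s r. s \<ge> 0 \<Longrightarrow> r \<ge> 0 \<Longrightarrow> \<bar>r - s\<bar> < d s \<Longrightarrow> \<bar>z r\<bar> \<le> B s"
    by auto
  have "compact {0..t}" by simp
  then obtain C where C: "C \<subseteq> {0..t}" "finite C" "{0..t} \<subseteq> (\<Union>s\<in>C. ball s (d s))"
    by (rule compactE_image[of _ "{0..t}" "\<lambda>s. ball s (d s)"]) (use d in auto)
  have "\<bar>z r\<bar> \<le> (\<Sum>s\<in>C. \<bar>B s\<bar>)" if r: "r \<in> {0..t}" for r
  proof -
    obtain s where s: "s \<in> C" "r \<in> ball s (d s)" using C(3) r by blast
    then have "\<bar>z r\<bar> \<le> B s" using C(1) r by (intro B) (auto simp: dist_real_def abs_minus_commute)
    also have "\<dots> \<le> \<bar>B s\<bar>" by simp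
    also have "\<dots> \<le> (\<Sum>s\<in>C. \<bar>B s\<bar>)" using s C(2) by (intro member_le_sum) auto
    finally show ?thesis .
  qed
  then show ?thesis by blast
qed

lemma sum_by_parts_partition:
  fixes f z :: "'a \<Rightarrow> real"
  shows "(\<Sum>i<m. f (p i) * (z (p (Suc i)) - z (p i))) =
    f (p m) * z (p m) - f (p 0) * z (p 0) - (\<Sum>i<m. z (p (Suc i)) * (f (p (Suc i)) - f (p i)))"
  by (induction m) (simp_all add: algebra_simps)

definition fine_partition :: "real \<Rightarrow> real \<Rightarrow> nat \<Rightarrow> (nat \<Rightarrow> real) \<Rightarrow> bool" where
  "fine_partition t d m p \<longleftrightarrow> p 0 = 0 \<and> p m = t \<and> (\<forall>i<m. p i \<le> p (Suc i) \<and> p (Suc i) - p i < d)"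

lemma fine_partition_mono:
  assumes "fine_partition t d m p" "i \<le> j" "j \<le> m"
  shows "p i \<le> p j"
  using assms(2,3)
proof (induction rule: dec_induct)
  case (step k)
  then show ?case using assms(1) by (auto simp: fine_partition_def intro: order_trans)
qed simp

text \<open>Cells are open on the left, so repeated partition points produce empty cells and every s
  in (0,t] lies in exactly one cell.\<close>

lemma fine_partition_cell:
  assumes p: "fine_partition t d m p" and s: "0 < s" "s \<le> t"
  shows "\<exists>i<m. p i < s \<and> s \<le> p (Suc i) \<and> (\<forall>j<m. p j < s \<and> s \<le> p (Suc j) \<longrightarrow> j = i)"
proof -
  have m0: "m \<noteq> 0" using p s by (auto simp: fine_partition_def intro: ccontr)
  then have ex: "s \<le> p (Suc (m - 1))" using p s by (simp add: fine_partition_def)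
  define i where "i = (LEAST i. s \<le> p (Suc i))"
  have i: "s \<le> p (Suc i)" unfolding i_def by (rule LeastI, rule ex)
  have im: "i < m" using Least_le[of "\<lambda>i. s \<le> p (Suc i)", OF ex] m0 by (simp add: i_def)
  have less: "p (Suc j) < s" if "j < i" for j
    using not_less_Least[of j "\<lambda>i. s \<le> p (Suc i)"] that by (simp add: i_def)
  have "p i < s"
  proof (cases i)
    case 0
    then show ?thesis using p s by (simp add: fine_partition_def)
  next
    case (Suc j)
    then show ?thesis using less[of j] by simp
  qed
  moreover have "j = i" if "j < m" "p j < s" "s \<le> p (Suc j)" for j
  proof (rule linorder_cases[of j i])
    assume "j < i" then show ?thesis using less[of j] that by simp
  next
    assume "j > i"
    then have "p (Suc i) \<le> p j" using that by (intro fine_partition_mono[OF p]) auto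
    then show ?thesis using i that by simp
  qed
  ultimately show ?thesis using i im by blast
qed

text \<open>
  After a summation by parts the Riemann sum is an integral of a right-endpoint discretisation of
  the path against \<open>f'\<close>. A cadlag path is bounded, so dominated convergence applies to each path
  separately.
\<close>

lemma riemann_sum_tendsto:
  fixes z f f' :: "real \<Rightarrow> real"
  assumes z: "cadlag z" and f: "\<And>s. (f has_real_derivative f' s) (at s)" "continuous_on UNIV f'"
    and p: "\<And>k. fine_partition t (d k) (m k) (p k)" and d: "d \<longlonglongrightarrow> 0"
  shows "(\<lambda>k. \<Sum>i<m k. f (p k i) * (z (p k (Suc i)) - z (p k i))) \<longlonglongrightarrow>
    f t * z t - f 0 * z 0 - (LINT s:{0<..t}|lborel. z s * f' s)"
proof -
  define w where "w k s = (\<Sum>i<m k. indicator {p k i<..p k (Suc i)} s * z (p k (Suc i)))" for k s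
  obtain B where B: "\<And>s. s \<in> {0..t} \<Longrightarrow> \<bar>z s\<bar> \<le> B" using cadlag_bounded[OF z] by blast
  have pin: "p k i \<in> {0..t}" if "i \<le> m k" for k i
    using fine_partition_mono[OF p[of k], of 0 i] fine_partition_mono[OF p[of k], of i "m k"] p[of k] that
    by (auto simp: fine_partition_def)
  have t: "t \<ge> 0" using pin[of 0 0] by simp
  have B0: "B \<ge> 0" using B[of 0] t by simp
  have f'int: "set_integrable lborel {a..b} f'" for a b
    by (rule borel_integrable_atLeastAtMost') (rule continuous_on_subset[OF f(2)], simp)
  have f'm: "f' \<in> borel_measurable borel"
    using f(2) by (rule borel_measurable_continuous_onI)
  have wval: "\<exists>i<m k. p k i < s \<and> s \<le> p k (Suc i) \<and> w k s = z (p k (Suc i))" if s: "0 < s" "s \<le> t" for k s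
  proof -
    obtain i where i: "i < m k" "p k i < s" "s \<le> p k (Suc i)"
      "\<And>j. j < m k \<Longrightarrow> p k j < s \<and> s \<le> p k (Suc j) \<Longrightarrow> j = i"
      using fine_partition_cell[OF p s, of k] by blast
    have "w k s = (\<Sum>j<m k. if j = i then z (p k (Suc i)) else 0)"
      unfolding w_def
    proof (intro sum.cong refl)
      fix j assume j: "j \<in> {..<m k}"
      show "indicator {p k j<..p k (Suc j)} s * z (p k (Suc j)) = (if j = i then z (p k (Suc i)) else 0)"
      proof (cases "j = i")
        case True
        then show ?thesis using i(2,3) by (simp add: indicator_def)
      next
        case False
        then have "\<not> (p k j < s \<and> s \<le> p k (Suc j))" using i(4)[of j] j by blast
        then have "s \<notin> {p k j<..p k (Suc j)}" by simp
        then show ?thesis using False by simp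
      qed
    qed
    then have "w k s = z (p k (Suc i))" using i(1) by simp
    then show ?thesis using i(1-3) by blast
  qed
  have wzero: "w k s = 0" if "\<not> (0 < s \<and> s \<le> t)" for k s
    unfolding w_def
  proof (intro sum.neutral ballI)
    fix i assume "i \<in> {..<m k}"
    then have "0 \<le> p k i" "p k (Suc i) \<le> t" using pin[of i k] pin[of "Suc i" k] by auto
    then show "indicator {p k i<..p k (Suc i)} s * z (p k (Suc i)) = 0"
      using that by (auto simp: indicator_def)
  qed
  have wint: "integrable lborel (\<lambda>s. w k s * f' s)" and
    wsum: "(\<integral>s. w k s * f' s \<partial>lborel) = (\<Sum>i<m k. z (p k (Suc i)) * (f (p k (Suc i)) - f (p k i)))" for k
  proof -
    have i1: "integrable lborel (\<lambda>s. indicator {a<..b} s * f' s)" for a b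
    proof -
      have "set_integrable lborel {a<..b} f'"
        by (rule set_integrable_subset[OF f'int[of a b]]) auto
      then show ?thesis by (simp add: set_integrable_def)
    qed
    have i2: "(\<integral>s. indicator {p k i<..p k (Suc i)} s * f' s \<partial>lborel) = f (p k (Suc i)) - f (p k i)" if "i < m k" for i
    proof -
      have le: "p k i \<le> p k (Suc i)" using p[of k] that by (simp add: fine_partition_def)
      have "(\<integral>s. indicator {p k i<..p k (Suc i)} s * f' s \<partial>lborel) = (LINT s:{p k i..p k (Suc i)}|lborel. f' s)"
        unfolding set_lebesgue_integral_def
      proof (rule integral_cong_AE)
        show "AE s in lborel. indicator {p k i<..p k (Suc i)} s * f' s = indicator {p k i..p k (Suc i)} s *\<^sub>R f' s"
          using AE_lborel_singleton[of "p k i"] by eventually_elim (simp add: indicator_def)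
      qed (use f'm in auto)
      also have "\<dots> = f (p k (Suc i)) - f (p k i)"
        unfolding set_lebesgue_integral_def
        using integral_FTC_Icc_real[OF le, of f f'] f(1) continuous_on_eq_continuous_at[OF open_UNIV, of f'] f(2)
        by (simp add: mult.commute)
      finally show ?thesis .
    qed
    have eq: "w k s * f' s = (\<Sum>i<m k. z (p k (Suc i)) * (indicator {p k i<..p k (Suc i)} s * f' s))" for s
      unfolding w_def sum_distrib_right by (intro sum.cong refl) (simp only: mult_ac)
    show "integrable lborel (\<lambda>s. w k s * f' s)"
      unfolding eq by (intro Bochner_Integration.integrable_sum integrable_mult_right i1)
    show "(\<integral>s. w k s * f' s \<partial>lborel) = (\<Sum>i<m k. z (p k (Suc i)) * (f (p k (Suc i)) - f (p k i)))"
      unfolding eq by (subst Bochner_Integration.integral_sum) (auto simp: i2 intro!: integrable_mult_right i1)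
  qed
  have wlim: "(\<lambda>k. w k s * f' s) \<longlonglongrightarrow> indicator {0<..t} s * (z s * f' s)" for s
  proof (cases "0 < s \<and> s \<le> t")
    case True
    have "\<forall>k. \<exists>i. i < m k \<and> p k i < s \<and> s \<le> p k (Suc i) \<and> w k s = z (p k (Suc i))"
      using wval[of s] True by simp
    from choice[OF this] obtain i where
      "\<forall>k. i k < m k \<and> p k (i k) < s \<and> s \<le> p k (Suc (i k)) \<and> w k s = z (p k (Suc (i k)))"
      by (elim exE)
    then have i: "\<And>k. i k < m k \<and> p k (i k) < s \<and> s \<le> p k (Suc (i k)) \<and> w k s = z (p k (Suc (i k)))"
      by (rule spec)
    \<comment> \<open>The right endpoint of the cell of s approaches s from above, where right
      continuity of the path suffices. Left endpoints would produce left limits instead.\<close>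
    have "(\<lambda>k. p k (Suc (i k))) \<longlonglongrightarrow> s"
    proof (rule tendsto_sandwich[OF _ _ tendsto_const])
      show "\<forall>\<^sub>F k in sequentially. s \<le> p k (Suc (i k))" using i by auto
      have "p k (Suc (i k)) \<le> s + d k" for k
        using i[of k] p[of k] by (auto simp: fine_partition_def dest!: spec[of _ "i k"])
      then show "\<forall>\<^sub>F k in sequentially. p k (Suc (i k)) \<le> s + d k" by auto
      show "(\<lambda>k. s + d k) \<longlonglongrightarrow> s" using tendsto_add[OF tendsto_const d, of s] by simp
    qed
    moreover have "(z \<longlongrightarrow> z s) (at s within {s..})"
    proof -
      have "(z \<longlongrightarrow> z s) (at_right s)"
        using z True by (auto simp: cadlag_def continuous_within)
      then show ?thesis by (simp only: at_within_Ici_at_right)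
    qed
    ultimately have "(\<lambda>k. z (p k (Suc (i k)))) \<longlonglongrightarrow> z s"
      using i by (intro continuous_within_tendsto_compose'[of s "{s..}" z]) (simp_all add: continuous_within)
    then have "(\<lambda>k. w k s) \<longlonglongrightarrow> z s" using i by simp
    then have "(\<lambda>k. w k s * f' s) \<longlonglongrightarrow> z s * f' s" by (intro tendsto_intros)
    then show ?thesis using True by simp
  next
    case False
    then show ?thesis using wzero[OF False] by (auto simp: indicator_def)
  qed
  have "(\<lambda>k. \<integral>s. w k s * f' s \<partial>lborel) \<longlonglongrightarrow>
      (\<integral>s. indicator {0<..t} s * (z s * f' s) \<partial>lborel)"
  proof (rule integral_dominated_convergence[where w="\<lambda>s. B * (indicator {0..t} s * \<bar>f' s\<bar>)"])
    show "(\<lambda>s. indicator {0<..t} s * (z s * f' s)) \<in> borel_measurable lborel"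
      by (rule borel_measurable_LIMSEQ_real[OF wlim]) (use wint in auto)
    show "integrable lborel (\<lambda>s. B * (indicator {0..t} s * \<bar>f' s\<bar>))"
      using f'int[of 0 t, THEN set_integrable_abs] by (simp add: set_integrable_def)
    show "AE s in lborel. norm (w k s * f' s) \<le> B * (indicator {0..t} s * \<bar>f' s\<bar>)" for k
    proof (rule AE_I2)
      fix s
      show "norm (w k s * f' s) \<le> B * (indicator {0..t} s * \<bar>f' s\<bar>)"
      proof (cases "0 < s \<and> s \<le> t")
        case True
        then obtain i where i: "i < m k" "w k s = z (p k (Suc i))" using wval by blast
        then have "\<bar>w k s\<bar> \<le> B" using B[OF pin[of "Suc i" k]] by simp
        then show ?thesis using True by (simp add: abs_mult mult_right_mono)
      next
        case False
        then show ?thesis using wzero[OF False] B0 by simp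
      qed
    qed
  qed (use wint wlim in auto)
  then have "(\<lambda>k. f t * z t - f 0 * z 0 - (\<integral>s. w k s * f' s \<partial>lborel)) \<longlonglongrightarrow>
     f t * z t - f 0 * z 0 - (\<integral>s. indicator {0<..t} s * (z s * f' s) \<partial>lborel)"
    by (intro tendsto_intros)
  then show ?thesis
    using p by (simp add: sum_by_parts_partition wsum set_lebesgue_integral_def fine_partition_def)
qed

definition uniform_partition :: "real \<Rightarrow> nat \<Rightarrow> nat \<Rightarrow> real" where
  "uniform_partition t k i = t * real i / real (Suc k)"

text \<open>All cells have length t / (k + 1); the numerator t + 1 meets the strict mesh
  condition.\<close>

lemma uniform_partition_fine:
  assumes "t \<ge> 0"
  shows "fine_partition t ((t + 1) / real (Suc k)) (Suc k) (uniform_partition t k)"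
proof -
  have "uniform_partition t k (Suc i) - uniform_partition t k i = t / real (Suc k)" for i
  proof -
    have "t * real (Suc i) - t * real i = t" by (simp add: algebra_simps)
    then show ?thesis by (simp only: uniform_partition_def diff_divide_distrib[symmetric])
  qed
  moreover have "t / real (Suc k) < (t + 1) / real (Suc k)" "0 \<le> t / real (Suc k)"
    using assms by (auto intro: divide_strict_right_mono)
  ultimately have "0 \<le> uniform_partition t k (Suc i) - uniform_partition t k i \<and>
     uniform_partition t k (Suc i) - uniform_partition t k i < (t + 1) / real (Suc k)" for i
    by (simp only: simp_thms)
  moreover have "uniform_partition t k (Suc k) = t"
    unfolding uniform_partition_def by (rule nonzero_mult_div_cancel_right) simp
  moreover have "uniform_partition t k 0 = 0"
    by (simp add: uniform_partition_def)
  ultimately show ?thesis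
    by (simp only: fine_partition_def diff_ge_0_iff_ge simp_thms)
qed

lemma uniform_partition_mesh: "(\<lambda>k. (t + 1) / real (Suc k)) \<longlonglongrightarrow> 0"
  using tendsto_mult_right_zero[OF LIMSEQ_inverse_real_of_nat, of "t + 1"] by (simp add: divide_inverse)

lemma AE_tendsto_imp_measure_tendsto:
  fixes X :: "nat \<Rightarrow> 'w \<Rightarrow> real"
  assumes M: "prob_space M" and X: "\<And>k. X k \<in> borel_measurable M" "Y \<in> borel_measurable M"
    and lim: "AE \<omega> in M. (\<lambda>k. X k \<omega>) \<longlonglongrightarrow> Y \<omega>" and e: "e > 0"
  shows "(\<lambda>k. measure M {\<omega>\<in>space M. \<bar>X k \<omega> - Y \<omega>\<bar> > e}) \<longlonglongrightarrow> 0"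
proof -
  interpret prob_space M by fact
  note [measurable] = X
  have "(\<lambda>k. \<integral>\<omega>. indicator {\<omega>\<in>space M. \<bar>X k \<omega> - Y \<omega>\<bar> > e} \<omega> \<partial>M) \<longlonglongrightarrow>
      (\<integral>\<omega>. (0 :: real) \<partial>M)"
  proof (rule integral_dominated_convergence[where w="\<lambda>_. 1 :: real"])
    show "AE \<omega> in M. (\<lambda>k. indicator {\<omega>\<in>space M. \<bar>X k \<omega> - Y \<omega>\<bar> > e} \<omega> :: real) \<longlonglongrightarrow>
        0"
      using lim
    proof eventually_elim
      case (elim \<omega>)
      then have "\<forall>\<^sub>F k in sequentially. dist (X k \<omega>) (Y \<omega>) < e"
        using e by (rule tendstoD)
      then have "\<forall>\<^sub>F k in sequentially. indicator {\<omega>\<in>space M. \<bar>X k \<omega> - Y \<omega>\<bar> > e} \<omega> =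
          (0 :: real)"
        by eventually_elim (auto simp: dist_real_def)
      then show ?case by (rule tendsto_eventually)
    qed
  qed (auto simp: indicator_def)
  then show ?thesis by simp
qed

text \<open>Riemann sums converge almost surely along every sequence of partitions with vanishing
  mesh, always to the same \<open>J\<close>. If convergence in probability failed, partitions of
  mesh below 1 / (k + 1) could be picked that violate it. The witness is a limit along uniform
  partitions and not \<open>J\<close> itself: a limit of measurable functions is measurable, whereas
  the time integral in \<open>J\<close> would call for joint measurability of the process.\<close>

lemma has_stoch_integral_limit:
  assumes M: "prob_space M" and Z: "\<And>s. s \<ge> 0 \<Longrightarrow> Z s \<in> borel_measurable M"
    and cad: "AE \<omega> in M. cadlag (\<lambda>s. Z s \<omega>)"
    and f: "\<And>s. (f has_real_derivative f' s) (at s)" "continuous_on UNIV f'" and t: "t \<ge> 0"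
  shows "has_stoch_integral M Z f t (\<lambda>\<omega>. lim (\<lambda>k. riemann_sum Z f (Suc k) (uniform_partition t k) \<omega>))"
    (is "has_stoch_integral M Z f t ?I")
    and "AE \<omega> in M. (\<lambda>k. riemann_sum Z f (Suc k) (uniform_partition t k) \<omega>) \<longlonglongrightarrow>
      lim (\<lambda>k. riemann_sum Z f (Suc k) (uniform_partition t k) \<omega>)"
proof -
  interpret prob_space M by fact
  have meas: "riemann_sum Z f m p \<in> borel_measurable M" if "fine_partition t d m p" for d m p
  proof -
    have "p i \<ge> 0" if "i \<le> m" for i
      using fine_partition_mono[OF \<open>fine_partition t d m p\<close>, of 0 i] \<open>fine_partition t d m p\<close> that
      by (simp add: fine_partition_def)
    then have "(\<lambda>\<omega>. \<Sum>i<m. f (p i) * (Z (p (Suc i)) \<omega> - Z (p i) \<omega>)) \<in> borel_measurable M"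
      by (intro borel_measurable_sum borel_measurable_times borel_measurable_diff Z) auto
    then show ?thesis by (simp add: riemann_sum_def[abs_def])
  qed
  define J where "J \<omega> = f t * Z t \<omega> - f 0 * Z 0 \<omega> - (LINT s:{0<..t}|lborel. Z s \<omega> * f' s)" for \<omega>
  have conv: "AE \<omega> in M. (\<lambda>k. riemann_sum Z f (m k) (p k) \<omega>) \<longlonglongrightarrow> J \<omega>"
    if "\<And>k. fine_partition t (d k) (m k) (p k)" "d \<longlonglongrightarrow> 0" for d m p
    using cad
  proof eventually_elim
    case (elim \<omega>)
    from riemann_sum_tendsto[OF elim f that] show ?case
      by (simp add: riemann_sum_def J_def)
  qed
  note uni = conv[of "\<lambda>k. (t + 1) / real (Suc k)" Suc "uniform_partition t", OF uniform_partition_fine[OF t] uniform_partition_mesh]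
  have IJ: "AE \<omega> in M. ?I \<omega> = J \<omega>"
    using uni by eventually_elim (rule limI)
  then show "AE \<omega> in M. (\<lambda>k. riemann_sum Z f (Suc k) (uniform_partition t k) \<omega>) \<longlonglongrightarrow>
      lim (\<lambda>k. riemann_sum Z f (Suc k) (uniform_partition t k) \<omega>)"
    using uni by eventually_elim simp
  have Imeas: "?I \<in> borel_measurable M"
    by (intro borel_measurable_lim_metric meas[OF uniform_partition_fine[OF t]])
  show "has_stoch_integral M Z f t ?I"
    unfolding has_stoch_integral_def
  proof (intro conjI allI impI Imeas, rule ccontr)
    fix e :: real assume e: "e > 0"
    assume "\<not> (\<exists>\<delta>>0. \<forall>m p. p 0 = 0 \<and> p m = t \<and> (\<forall>i<m. p i \<le> p (Suc i) \<and> p (Suc i)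
        - p i < \<delta>) \<longrightarrow>
        measure M {\<omega>\<in>space M. \<bar>riemann_sum Z f m p \<omega> - ?I \<omega>\<bar> > e} < e)"
    then have "\<forall>\<delta>>0. \<exists>m p. fine_partition t \<delta> m p \<and>
        \<not> measure M {\<omega>\<in>space M. \<bar>riemann_sum Z f m p \<omega> - ?I \<omega>\<bar> > e} < e"
      unfolding fine_partition_def by blast
    then have "\<forall>k. \<exists>m p. fine_partition t (inverse (real (Suc k))) m p \<and>
        \<not> measure M {\<omega>\<in>space M. \<bar>riemann_sum Z f m p \<omega> - ?I \<omega>\<bar> > e} < e"
      by simp
    then obtain m p where p: "\<And>k. fine_partition t (inverse (real (Suc k))) (m k) (p k)"
      and ge: "\<And>k. \<not> measure M {\<omega>\<in>space M. \<bar>riemann_sum Z f (m k) (p k) \<omega> - ?I \<omega>\<bar> > e} < e"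
      unfolding choice_iff by blast
    have "AE \<omega> in M. (\<lambda>k. riemann_sum Z f (m k) (p k) \<omega>) \<longlonglongrightarrow> ?I \<omega>"
      using conv[OF p LIMSEQ_inverse_real_of_nat] IJ by eventually_elim simp
    from AE_tendsto_imp_measure_tendsto[OF M meas[OF p] Imeas this e]
    have "\<forall>\<^sub>F k in sequentially. measure M {\<omega>\<in>space M. \<bar>riemann_sum Z f (m k) (p k) \<omega>
        - ?I \<omega>\<bar> > e} < e"
      using e by (rule order_tendstoD)
    then show False using ge by (simp add: eventually_sequentially)
  qed
qed

text \<open>Both versions are close in probability to one and the same Riemann sum over a
  sufficiently fine uniform partition.\<close>

lemma has_stoch_integral_unique:
  assumes M: "prob_space M" and t: "t \<ge> 0" and Z: "\<And>s. s \<ge> 0 \<Longrightarrow> Z s \<in> borel_measurable M"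
    and I: "has_stoch_integral M Z f t I" and J: "has_stoch_integral M Z f t J"
  shows "AE \<omega> in M. I \<omega> = J \<omega>"
proof -
  interpret prob_space M by fact
  have [measurable]: "I \<in> borel_measurable M" "J \<in> borel_measurable M"
    using I J by (auto simp: has_stoch_integral_def)
  have b: "prob {\<omega>\<in>space M. \<bar>I \<omega> - J \<omega>\<bar> > 2 * e} \<le> 2 * e" if e: "e > 0" for e
  proof -
    obtain d1 where d1: "d1 > 0" "\<And>m p. fine_partition t d1 m p \<Longrightarrow> prob {\<omega>\<in>space M. \<bar>riemann_sum Z f m p \<omega> - I \<omega>\<bar> > e} < e"
      using I e unfolding has_stoch_integral_def fine_partition_def by blast
    obtain d2 where d2: "d2 > 0" "\<And>m p. fine_partition t d2 m p \<Longrightarrow> prob {\<omega>\<in>space M. \<bar>riemann_sum Z f m p \<omega> - J \<omega>\<bar> > e} < e"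
      using J e unfolding has_stoch_integral_def fine_partition_def by blast
    have "\<forall>\<^sub>F k in sequentially. (t + 1) / real (Suc k) < min d1 d2"
      using uniform_partition_mesh[of t] d1(1) d2(1) by (intro order_tendstoD) auto
    then obtain k where k: "(t + 1) / real (Suc k) < min d1 d2"
      by (auto simp: eventually_sequentially)
    let ?R = "riemann_sum Z f (Suc k) (uniform_partition t k)"
    have fp: "fine_partition t d1 (Suc k) (uniform_partition t k)" "fine_partition t d2 (Suc k) (uniform_partition t k)"
      using uniform_partition_fine[OF t, of k] k by (auto simp: fine_partition_def)
    have "uniform_partition t k i \<ge> 0" for i using t by (simp add: uniform_partition_def)
    then have [measurable]: "?R \<in> borel_measurable M"
      unfolding riemann_sum_def[abs_def]
      by (intro borel_measurable_sum borel_measurable_times borel_measurable_diff Z) auto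
    have "prob {\<omega>\<in>space M. \<bar>I \<omega> - J \<omega>\<bar> > 2 * e} \<le>
      prob ({\<omega>\<in>space M. \<bar>?R \<omega> - I \<omega>\<bar> > e} \<union> {\<omega>\<in>space M. \<bar>?R \<omega>
          - J \<omega>\<bar> > e})"
      by (intro finite_measure_mono) auto
    also have "\<dots> \<le> prob {\<omega>\<in>space M. \<bar>?R \<omega> - I \<omega>\<bar> > e} +
        prob {\<omega>\<in>space M. \<bar>?R \<omega> - J \<omega>\<bar> > e}"
      by (intro measure_Un_le) measurable
    also have "\<dots> \<le> 2 * e" using d1(2)[OF fp(1)] d2(2)[OF fp(2)] by simp
    finally show ?thesis .
  qed
  have "prob {\<omega>\<in>space M. \<bar>I \<omega> - J \<omega>\<bar> > r} = 0" if r: "r > 0" for r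
  proof -
    have le: "prob {\<omega>\<in>space M. \<bar>I \<omega> - J \<omega>\<bar> > r} \<le> e" if e: "e > 0" for e
    proof -
      have "prob {\<omega>\<in>space M. \<bar>I \<omega> - J \<omega>\<bar> > r} \<le> prob {\<omega>\<in>space M. \<bar>I \<omega>
          - J \<omega>\<bar> > 2 * (min e r / 2)}"
        by (intro finite_measure_mono) auto
      also have "\<dots> \<le> 2 * (min e r / 2)" using e r by (intro b) auto
      finally show ?thesis by simp
    qed
    have "prob {\<omega>\<in>space M. \<bar>I \<omega> - J \<omega>\<bar> > r} \<le> 0"
      by (rule field_le_epsilon) (use le in simp)
    then show ?thesis using measure_nonneg[of M "{\<omega>\<in>space M. \<bar>I \<omega> - J \<omega>\<bar> > r}"] by simp
  qed
  then have "AE \<omega> in M. \<not> \<bar>I \<omega> - J \<omega>\<bar> > r" if "r > 0" for r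
    using that by (subst AE_iff_measurable[OF _ refl]) (auto simp: emeasure_eq_measure)
  then have "AE \<omega> in M. \<forall>n. \<not> \<bar>I \<omega> - J \<omega>\<bar> > inverse (real (Suc n))"
    by (subst AE_all_countable) auto
  then show ?thesis
  proof eventually_elim
    case (elim \<omega>)
    have "\<bar>I \<omega> - J \<omega>\<bar> \<le> 0"
      by (rule LIMSEQ_le_const[OF LIMSEQ_inverse_real_of_nat]) (use elim in \<open>auto simp: not_less\<close>)
    then show ?case by simp
  qed
qed

section \<open>The law of the stochastic convolution of one coordinate\<close>

lemma stochastic_basis_prob_space: "stochastic_basis M \<F> \<Longrightarrow> prob_space M"
  unfolding stochastic_basis_def by (erule conjunct1)

lemma stochastic_basis_subalgebra:
  assumes "stochastic_basis M \<F>" and "0 \<le> t"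
  shows "subalgebra M (\<F> t)"
  by (rule assms(1)[unfolded stochastic_basis_def, THEN conjunct2, THEN conjunct2, THEN conjunct1, rule_format, OF assms(2)])

lemma stochastic_basis_mono:
  assumes "stochastic_basis M \<F>" and "0 \<le> s" "s \<le> t"
  shows "sets (\<F> s) \<subseteq> sets (\<F> t)"
  by (rule assms(1)[unfolded stochastic_basis_def, THEN conjunct2, THEN conjunct2, THEN conjunct2, THEN conjunct1, rule_format, OF assms(2,3)])

lemma adapted_measurable:
  assumes B: "stochastic_basis M \<F>" and "0 \<le> s" "s \<le> t" "X \<in> borel_measurable (\<F> s)"
  shows "X \<in> borel_measurable (\<F> t)"
proof (rule measurable_from_subalg[OF _ assms(4)])
  show "subalgebra (\<F> t) (\<F> s)"
  proof -
    show ?thesis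
      using stochastic_basis_subalgebra[OF B assms(2)] stochastic_basis_subalgebra[OF B, of t]
        stochastic_basis_mono[OF B assms(2,3)] assms(2,3)
      by (simp add: subalgebra_def)
  qed
qed

lemma adapted_measurable_base:
  assumes B: "stochastic_basis M \<F>" and "0 \<le> s" "X \<in> borel_measurable (\<F> s)"
  shows "X \<in> borel_measurable M"
  by (rule measurable_from_subalg[OF _ assms(3)]) (use stochastic_basis_subalgebra[OF B assms(2)] in simp)

text \<open>Turns independence of the increment from the past sigma-algebra into independence of
  random variables, the form in which characteristic functions of sums multiply.\<close>

lemma indep_var_increment:
  fixes X :: "'w \<Rightarrow> real"
  assumes B: "stochastic_basis M \<F>" and L: "levy_process M \<F> Z" and st: "0 \<le> s" "s \<le> t"
    and X: "X \<in> borel_measurable (\<F> s)"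
  shows "prob_space.indep_var M borel X borel (\<lambda>\<omega>. c * (Z t \<omega> - Z s \<omega>))"
proof -
  interpret prob_space M using B by (rule stochastic_basis_prob_space)
  have Zm: "Z r \<in> borel_measurable M" if "r \<ge> 0" for r
    using L adapted_measurable_base[OF B that] that by (auto simp: levy_process_def)
  define Y where "Y \<omega> = Z t \<omega> - Z s \<omega>" for \<omega>
  have Ym [measurable]: "Y \<in> borel_measurable M" using Zm st by (auto simp: Y_def[abs_def])
  have Xm [measurable]: "X \<in> borel_measurable M" by (rule adapted_measurable_base[OF B st(1) X])
  have "indep_set (sets (\<F> s)) (sets (vimage_algebra (space M) Y borel))"
    using L st unfolding levy_process_def Y_def[abs_def] by auto
  then have i: "indep_sets (case_bool (sets (\<F> s)) (sets (vimage_algebra (space M) Y borel))) UNIV"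
    by (simp add: indep_set_def)
  have sp: "space (\<F> s) = space M" using stochastic_basis_subalgebra[OF B st(1)] by (simp add: subalgebra_def)
  have "indep_var borel X borel Y"
    unfolding indep_var_eq indep_set_def
  proof (intro conjI Xm Ym)
    show "indep_sets (case_bool (sigma_sets (space M) {X -` A \<inter> space M |A. A \<in> sets borel})
       (sigma_sets (space M) {Y -` A \<inter> space M |A. A \<in> sets borel})) UNIV"
    proof (rule indep_sets_mono_sets[OF i])
      fix b :: bool
      show "case_bool (sigma_sets (space M) {X -` A \<inter> space M |A. A \<in> sets borel})
         (sigma_sets (space M) {Y -` A \<inter> space M |A. A \<in> sets borel}) b
        \<subseteq> case_bool (sets (\<F> s)) (sets (vimage_algebra (space M) Y borel)) b"
      proof (cases b)
        case True
        have "sigma_sets (space (\<F> s)) {X -` A \<inter> space M |A. A \<in> sets borel} \<subseteq> sets (\<F> s)"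
          by (rule sets.sigma_sets_subset) (use measurable_sets[OF X] sp in auto)
        then show ?thesis using True sp by simp
      next
        case False
        then show ?thesis by (simp add: sets_vimage_algebra)
      qed
    qed
  qed
  then have "indep_var borel (id \<circ> X) borel ((\<lambda>y. c * y) \<circ> Y)"
    by (rule indep_var_compose) auto
  then show ?thesis by (simp add: o_def Y_def)
qed

lemma char_increment:
  assumes B: "stochastic_basis M \<F>" and L: "stable_levy_process M \<F> \<alpha> Z" and st: "0 \<le> s" "s \<le> t"
  shows "char (distr M borel (\<lambda>\<omega>. c * (Z t \<omega> - Z s \<omega>))) \<xi> =
    of_real (exp (- ((t - s) * \<bar>c * \<xi>\<bar> powr \<alpha>)))"
proof -
  interpret prob_space M using B by (rule stochastic_basis_prob_space)
  have Zm [measurable]: "Z r \<in> borel_measurable M" if "r \<ge> 0" for r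
    using L adapted_measurable_base[OF B that] that by (auto simp: levy_process_def stable_levy_process_def)
  have [measurable]: "Z t \<in> borel_measurable M" "Z s \<in> borel_measurable M" using st by (auto intro: Zm)
  have d: "distr M borel (\<lambda>\<omega>. Z t \<omega> - Z s \<omega>) = distr M borel (Z (t - s))"
    using L st by (auto simp: levy_process_def stable_levy_process_def)
  have "char (distr M borel (\<lambda>\<omega>. c * (Z t \<omega> - Z s \<omega>))) \<xi> =
      char (distr M borel (\<lambda>\<omega>. Z t \<omega> - Z s \<omega>)) (c * \<xi>)"
    unfolding char_def by (subst (1 2) integral_distr) (auto simp: mult_ac)
  also have "\<dots> = of_real (exp (- ((t - s) * \<bar>c * \<xi>\<bar> powr \<alpha>)))"
    unfolding d using L st by (auto simp: stable_levy_process_def)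
  finally show ?thesis .
qed

text \<open>Each new increment is independent of the past up to \<open>p m\<close>. The induction
  therefore carries along that the partial sum is adapted, which is why measurability is part of the
  claim.\<close>

lemma char_riemann_sum:
  assumes B: "stochastic_basis M \<F>" and L: "stable_levy_process M \<F> \<alpha> Z"
    and p: "p 0 = 0" "\<And>i. i < m \<Longrightarrow> p i \<le> p (Suc i)"
  shows "riemann_sum Z f m p \<in> borel_measurable (\<F> (p m)) \<and> 0 \<le> p m \<and>
    char (distr M borel (riemann_sum Z f m p)) \<xi> =
    of_real (exp (- (\<Sum>i<m. (p (Suc i) - p i) * \<bar>f (p i) * \<xi>\<bar> powr \<alpha>)))"
  using p(2)
proof (induction m)
  case 0
  interpret prob_space M using B by (rule stochastic_basis_prob_space)
  have "riemann_sum Z f 0 p = (\<lambda>\<omega>. 0)" by (simp add: riemann_sum_def[abs_def])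
  then show ?case using p(1) prob_space
    by (simp add: char_def integral_distr del: distr_const)
next
  case (Suc m)
  interpret prob_space M using B by (rule stochastic_basis_prob_space)
  have LL: "levy_process M \<F> Z" using L by (simp add: stable_levy_process_def)
  have IH: "riemann_sum Z f m p \<in> borel_measurable (\<F> (p m))" "0 \<le> p m"
    "char (distr M borel (riemann_sum Z f m p)) \<xi> =
    of_real (exp (- (\<Sum>i<m. (p (Suc i) - p i) * \<bar>f (p i) * \<xi>\<bar> powr \<alpha>)))"
    using Suc by auto
  have le: "p m \<le> p (Suc m)" using Suc.prems by simp
  have eq: "riemann_sum Z f (Suc m) p = (\<lambda>\<omega>. riemann_sum Z f m p \<omega> + f (p m) * (Z (p (Suc m)) \<omega> - Z (p m) \<omega>))"
    by (simp add: riemann_sum_def[abs_def])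
  have m1: "riemann_sum Z f m p \<in> borel_measurable (\<F> (p (Suc m)))"
    by (rule adapted_measurable[OF B IH(2) le IH(1)])
  have m2: "Z (p m) \<in> borel_measurable (\<F> (p (Suc m)))"
    using LL IH(2) le by (intro adapted_measurable[OF B IH(2) le]) (auto simp: levy_process_def)
  have m3: "Z (p (Suc m)) \<in> borel_measurable (\<F> (p (Suc m)))"
    using LL IH(2) le by (auto simp: levy_process_def)
  have "riemann_sum Z f (Suc m) p \<in> borel_measurable (\<F> (p (Suc m)))"
    unfolding eq using m1 m2 m3 by measurable
  moreover have "char (distr M borel (riemann_sum Z f (Suc m) p)) \<xi> =
    of_real (exp (- (\<Sum>i<Suc m. (p (Suc i) - p i) * \<bar>f (p i) * \<xi>\<bar> powr \<alpha>)))"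
    unfolding eq char_distr_add[OF indep_var_increment[OF B LL IH(2) le IH(1)]]
      char_increment[OF B L IH(2) le] IH(3)
    by (simp add: exp_add[symmetric] exp_diff[symmetric] flip: of_real_mult)
  ultimately show ?case using IH(2) le by simp
qed

lemma char_tendsto:
  fixes X :: "nat \<Rightarrow> 'w \<Rightarrow> real"
  assumes "prob_space M" and X [measurable]: "\<And>k. X k \<in> borel_measurable M" "Y \<in> borel_measurable M"
    and lim: "AE \<omega> in M. (\<lambda>k. X k \<omega>) \<longlonglongrightarrow> Y \<omega>"
  shows "(\<lambda>k. char (distr M borel (X k)) \<xi>) \<longlonglongrightarrow> char (distr M borel Y) \<xi>"
proof -
  interpret prob_space M by fact
  have "(\<lambda>k. \<integral>\<omega>. iexp (\<xi> * X k \<omega>) \<partial>M) \<longlonglongrightarrow>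
      (\<integral>\<omega>. iexp (\<xi> * Y \<omega>) \<partial>M)"
  proof (rule integral_dominated_convergence[where w="\<lambda>_. 1"])
    show "AE \<omega> in M. (\<lambda>k. iexp (\<xi> * X k \<omega>)) \<longlonglongrightarrow> iexp (\<xi> * Y \<omega>)"
      using lim by eventually_elim (intro tendsto_intros)
  qed auto
  then show ?thesis by (simp add: char_def integral_distr)
qed

text \<open>
  The pathwise convergence theorem for the path \<open>z s = s\<close> is the convergence of ordinary Riemann sums.
\<close>

lemma exp_riemann_sum_tendsto:
  fixes a t :: real
  assumes a: "a > 0" and t: "t \<ge> 0"
  shows "(\<lambda>k. \<Sum>i<Suc k. exp (- a * (t - uniform_partition t k i)) * (uniform_partition t k (Suc i) - uniform_partition t k i))
     \<longlonglongrightarrow> (1 - exp (- a * t)) / a"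
proof -
  have cad: "cadlag (\<lambda>s. s)"
    unfolding cadlag_def by (auto intro!: continuous_intros tendsto_ident_at)
  have der: "((\<lambda>s. exp (- a * (t - s))) has_real_derivative a * exp (- a * (t - s))) (at s)" for s
    by (auto intro!: derivative_eq_intros)
  have "(LINT s:{0<..t}|lborel. s * (a * exp (- a * (t - s)))) = (LINT s:{0..t}|lborel. s * (a * exp (- a * (t - s))))"
    unfolding set_lebesgue_integral_def
  proof (rule integral_cong_AE)
    show "AE s in lborel. indicator {0<..t} s *\<^sub>R (s * (a * exp (- a * (t - s)))) =
      indicator {0..t} s *\<^sub>R (s * (a * exp (- a * (t - s))))"
      using AE_lborel_singleton[of 0] by eventually_elim (simp add: indicator_def)
  qed auto
  also have "\<dots> = (t * exp (- a * (t - t)) - exp (- a * (t - t)) / a) - (0 * exp (- a * (t - 0)) - exp (- a * (t - 0)) / a)"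
  proof -
    have "(LBINT s. (s * (a * exp (- a * (t - s)))) * indicator {0..t} s) =
      (t * exp (- a * (t - t)) - exp (- a * (t - t)) / a) - (0 * exp (- a * (t - 0)) - exp (- a * (t - 0)) / a)"
    proof (rule integral_FTC_Icc_real[OF t])
      fix s
      show "((\<lambda>s. s * exp (- a * (t - s)) - exp (- a * (t - s)) / a) has_real_derivative s * (a * exp (- a * (t - s)))) (at s)"
        using a by (auto intro!: derivative_eq_intros)
      show "isCont (\<lambda>s. s * (a * exp (- a * (t - s)))) s" by (intro continuous_intros)
    qed
    then show ?thesis by (simp add: set_lebesgue_integral_def mult.commute)
  qed
  finally have I: "exp (- a * (t - t)) * t - exp (- a * (t - 0)) * 0 - (LINT s:{0<..t}|lborel. s * (a * exp (- a * (t - s)))) =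
     (1 - exp (- a * t)) / a"
    by (simp add: diff_divide_distrib)
  show ?thesis
    using riemann_sum_tendsto[OF cad der _ uniform_partition_fine[OF t] uniform_partition_mesh]
    unfolding I by (simp add: continuous_intros)
qed

text \<open>A version picked by choice carries no visible dependence structure. Almost surely it
  equals a fixed measurable functional \<Phi> of the whole path, so independence of the paths will
  pass to the integrals. The scale is the integral of exp (- \<alpha> c (t - s)), obtained as a
  limit of the exponents for Riemann sums.\<close>

lemma stoch_integral_law:
  fixes c t :: real
  assumes B: "stochastic_basis M \<F>" and L: "stable_levy_process M \<F> \<alpha> Z" and \<alpha>: "\<alpha> > 0"
    and c: "c > 0" and t: "t \<ge> 0"
  shows "\<exists>\<Phi>\<in>borel_measurable (Pi\<^sub>M {0..} (\<lambda>_. borel)).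
    stoch_integral M Z (\<lambda>s. exp (- c * (t - s))) t \<in> borel_measurable M \<and>
    (AE \<omega> in M. stoch_integral M Z (\<lambda>s. exp (- c * (t - s))) t \<omega> = \<Phi> (\<lambda>s\<in>{0..}. Z s \<omega>)) \<and>
    (\<forall>\<xi>. char (distr M borel (\<lambda>\<omega>. \<Phi> (\<lambda>s\<in>{0..}. Z s \<omega>))) \<xi> =
      of_real (exp (- ((1 - exp (- (\<alpha> * c) * t)) / (\<alpha> * c) * \<bar>\<xi>\<bar> powr \<alpha>))))"
proof -
  interpret prob_space M using B by (rule stochastic_basis_prob_space)
  define f where "f s = exp (- c * (t - s))" for s
  define p where "p = uniform_partition t"
  have p0: "p k i \<ge> 0" for k i using t by (simp add: p_def uniform_partition_def)
  have der: "(f has_real_derivative c * exp (- c * (t - s))) (at s)" for s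
    unfolding f_def by (auto intro!: derivative_eq_intros)
  have cont: "continuous_on UNIV (\<lambda>s. c * exp (- c * (t - s)))"
    by (intro continuous_intros)
  have Zm: "Z r \<in> borel_measurable M" if "r \<ge> 0" for r
    using L adapted_measurable_base[OF B that] that by (auto simp: levy_process_def stable_levy_process_def)
  have cad: "AE \<omega> in M. cadlag (\<lambda>s. Z s \<omega>)"
    using L by (auto simp: levy_process_def stable_levy_process_def)
  define R where "R k z = (\<Sum>i<Suc k. f (p k i) * (z (p k (Suc i)) - z (p k i)))" for k and z :: "real \<Rightarrow> real"
  have Rm: "R k \<in> borel_measurable (Pi\<^sub>M {0..} (\<lambda>_. borel))" for k
    unfolding R_def[abs_def]
    by (intro borel_measurable_sum borel_measurable_times borel_measurable_diff measurable_component_singleton) (use p0 in auto)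
  define \<Phi> where "\<Phi> z = lim (\<lambda>k. R k z)" for z
  have \<Phi>m: "\<Phi> \<in> borel_measurable (Pi\<^sub>M {0..} (\<lambda>_. borel))"
    unfolding \<Phi>_def[abs_def] by (intro borel_measurable_lim_metric Rm)
  have RR: "R k (\<lambda>s\<in>{0..}. Z s \<omega>) = riemann_sum Z f (Suc k) (p k) \<omega>" for k \<omega>
    unfolding R_def riemann_sum_def using p0 by simp
  have \<Phi>R: "\<Phi> (\<lambda>s\<in>{0..}. Z s \<omega>) = lim (\<lambda>k. riemann_sum Z f (Suc k) (p k) \<omega>)" for \<omega>
    by (simp add: \<Phi>_def RR)
  note S = has_stoch_integral_limit[OF prob_space_axioms Zm cad der cont t, folded p_def, folded \<Phi>R]
  have has: "has_stoch_integral M Z f t (stoch_integral M Z f t)"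
    unfolding stoch_integral_def by (rule someI[of "has_stoch_integral M Z f t"], rule S(1))
  from has_stoch_integral_unique[OF prob_space_axioms t Zm has S(1)]
  have 1: "AE \<omega> in M. stoch_integral M Z f t \<omega> = \<Phi> (\<lambda>s\<in>{0..}. Z s \<omega>)" .
  have "char (distr M borel (\<lambda>\<omega>. \<Phi> (\<lambda>s\<in>{0..}. Z s \<omega>))) \<xi> =
      of_real (exp (- ((1 - exp (- (\<alpha> * c) * t)) / (\<alpha> * c) * \<bar>\<xi>\<bar> powr \<alpha>)))" for \<xi>
  proof (rule LIMSEQ_unique)
    have fp: "fine_partition t ((t + 1) / real (Suc k)) (Suc k) (p k)" for k
      unfolding p_def by (rule uniform_partition_fine[OF t])
    have ch: "char (distr M borel (riemann_sum Z f (Suc k) (p k))) \<xi> =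
       of_real (exp (- (\<Sum>i<Suc k. (p k (Suc i) - p k i) * \<bar>f (p k i) * \<xi>\<bar> powr \<alpha>)))"
      and rm: "riemann_sum Z f (Suc k) (p k) \<in> borel_measurable (\<F> (p k (Suc k)))" for k
      using char_riemann_sum[OF B L, of "p k" "Suc k" f \<xi>] fp[of k] by (auto simp: fine_partition_def)
    show "(\<lambda>k. char (distr M borel (riemann_sum Z f (Suc k) (p k))) \<xi>) \<longlonglongrightarrow>
        char (distr M borel (\<lambda>\<omega>. \<Phi> (\<lambda>s\<in>{0..}. Z s \<omega>))) \<xi>"
    proof (rule char_tendsto[OF prob_space_axioms _ _ S(2)])
      show "riemann_sum Z f (Suc k) (p k) \<in> borel_measurable M" for k
        by (rule adapted_measurable_base[OF B p0 rm])
      show "(\<lambda>\<omega>. \<Phi> (\<lambda>s\<in>{0..}. Z s \<omega>)) \<in> borel_measurable M"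
        using S(1) by (simp add: has_stoch_integral_def)
    qed
    have fpow: "\<bar>f s * \<xi>\<bar> powr \<alpha> = exp (- (\<alpha> * c) * (t - s)) * \<bar>\<xi>\<bar> powr \<alpha>" for s
      by (simp add: f_def abs_mult powr_mult exp_powr_real mult_ac)
    have sum: "(\<Sum>i<Suc k. (p k (Suc i) - p k i) * \<bar>f (p k i) * \<xi>\<bar> powr \<alpha>) =
      (\<Sum>i<Suc k. exp (- (\<alpha> * c) * (t - p k i)) * (p k (Suc i) - p k i)) * \<bar>\<xi>\<bar> powr \<alpha>" for k
      unfolding fpow sum_distrib_right by (intro sum.cong refl) (simp only: mult_ac)
    have "\<alpha> * c > 0" using \<alpha> c by simp
    note E = exp_riemann_sum_tendsto[OF this t, folded p_def]
    show "(\<lambda>k. char (distr M borel (riemann_sum Z f (Suc k) (p k))) \<xi>) \<longlonglongrightarrow>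
      of_real (exp (- ((1 - exp (- (\<alpha> * c) * t)) / (\<alpha> * c) * \<bar>\<xi>\<bar> powr \<alpha>)))"
      unfolding ch sum by (intro tendsto_intros E)
  qed
  moreover have "stoch_integral M Z f t \<in> borel_measurable M"
    using has by (simp add: has_stoch_integral_def)
  ultimately show ?thesis using 1 \<Phi>m unfolding f_def by blast
qed

section \<open>Stable noise as a Gaussian mixture\<close>

locale stable_noise =
  fixes \<mu> :: "real measure" and \<alpha> :: real
  assumes \<alpha>: "1 < \<alpha>" "\<alpha> < 2"
    and \<mu>_dist: "real_distribution \<mu>" and \<mu>_pos: "AE x in \<mu>. 0 < x"
    and \<mu>_laplace: "\<And>l. l \<ge> 0 \<Longrightarrow> (\<integral>x. exp (- l * x) \<partial>\<mu>) = exp (- (l powr (\<alpha> / 2)))"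
    and \<mu>_inverse: "integrable \<mu> (\<lambda>x. 1 / x)"
begin

abbreviation "N \<equiv> std_normal_distribution"

definition \<kappa> :: "(real \<times> real) measure" where "\<kappa> = \<mu> \<Otimes>\<^sub>M N"

definition \<Omega> :: "(nat \<Rightarrow> real \<times> real) measure" where "\<Omega> = Pi\<^sub>M UNIV (\<lambda>_. \<kappa>)"

definition Y :: "real \<times> real \<Rightarrow> real" where "Y s = sqrt (2 * fst s) * snd s"

sublocale M: real_distribution \<mu> by (rule \<mu>_dist)
sublocale N: prob_space N by (rule prob_space_normal_density) simp
sublocale MN: pair_prob_space \<mu> N ..

lemma sets_\<mu> [measurable_cong]: "sets \<mu> = sets borel" by simp

lemma sets_\<kappa> [measurable_cong, simp]: "sets \<kappa> = sets (borel \<Otimes>\<^sub>M borel)"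
  unfolding \<kappa>_def by (intro sets_pair_measure_cong) simp_all

lemma space_\<kappa> [simp]: "space \<kappa> = UNIV"
  using sets_eq_imp_space_eq[OF sets_\<kappa>] by (simp add: space_pair_measure)

sublocale K: prob_space \<kappa>
  unfolding \<kappa>_def by (rule MN.prob_space_axioms)

sublocale O: prob_space \<Omega>
  unfolding \<Omega>_def by (rule prob_space_PiM) (rule K.prob_space_axioms)

lemma space_\<Omega> [simp]: "space \<Omega> = UNIV" by (simp add: \<Omega>_def space_PiM)

lemma sets_\<Omega> [measurable_cong]: "sets \<Omega> = sets (Pi\<^sub>M UNIV (\<lambda>_. borel \<Otimes>\<^sub>M borel))"
  unfolding \<Omega>_def by (intro sets_PiM_cong) simp_all

lemma Y_measurable [measurable]: "Y \<in> borel_measurable (borel \<Otimes>\<^sub>M borel)"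
  unfolding Y_def[abs_def] by measurable

lemma Y_coord_measurable [measurable]: "(\<lambda>\<omega>. Y (\<omega> n)) \<in> borel_measurable \<Omega>"
  by measurable

lemma N_char: "(\<integral>g. iexp (v * g) \<partial>N) = of_real (exp (- (v\<^sup>2) / 2))"
  using fun_cong[OF char_std_normal_distribution, of v] by (simp add: char_def)

text \<open>Given \<sigma> = x the variable is Gaussian with variance 2 x, so its conditional
  characteristic function is exp (- \<xi>^2 x). Averaging gives the Laplace transform of
  \<open>\<mu>\<close> at \<xi>^2, whose index \<alpha> / 2 restores the power \<alpha>.\<close>

lemma Y_char: "char (distr \<kappa> borel Y) \<xi> = of_real (exp (- (\<bar>\<xi>\<bar> powr \<alpha>)))"
proof -
  have "char (distr \<kappa> borel Y) \<xi> = (\<integral>s. iexp (\<xi> * Y s) \<partial>\<kappa>)"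
    unfolding char_def by (subst integral_distr) auto
  also have "\<dots> = (\<integral>x. (\<integral>g. iexp (\<xi> * Y (x, g)) \<partial>N) \<partial>\<mu>)"
    unfolding \<kappa>_def
  proof (rule MN.integral_fst'[symmetric])
    show "integrable (\<mu> \<Otimes>\<^sub>M N) (\<lambda>s. iexp (\<xi> * Y s))"
      by (rule MN.integrable_const_bound[where B=1]) auto
  qed
  also have "\<dots> = (\<integral>x. of_real (exp (- (\<xi>\<^sup>2) * x)) \<partial>\<mu>)"
  proof (rule integral_cong_AE)
    show "AE x in \<mu>. (\<integral>g. iexp (\<xi> * Y (x, g)) \<partial>N) = of_real (exp (- (\<xi>\<^sup>2) * x))"
      using \<mu>_pos
    proof eventually_elim
      case (elim x)
      have "(\<integral>g. iexp (\<xi> * Y (x, g)) \<partial>N) = (\<integral>g. iexp ((\<xi> * sqrt (2 * x)) * g) \<partial>N)"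
        by (simp add: Y_def mult.assoc)
      also have "\<dots> = of_real (exp (- ((\<xi> * sqrt (2 * x))\<^sup>2) / 2))" by (rule N_char)
      also have "- ((\<xi> * sqrt (2 * x))\<^sup>2) / 2 = - (\<xi>\<^sup>2) * x"
        using elim by (simp add: power_mult_distrib)
      finally show ?case .
    qed
  qed auto
  also have "\<dots> = of_real (\<integral>x. exp (- (\<xi>\<^sup>2) * x) \<partial>\<mu>)"
    by (rule integral_complex_of_real)
  also have "(\<integral>x. exp (- (\<xi>\<^sup>2) * x) \<partial>\<mu>) = exp (- ((\<xi>\<^sup>2) powr (\<alpha> / 2)))"
    by (rule \<mu>_laplace) simp
  also have "(\<xi>\<^sup>2) powr (\<alpha> / 2) = \<bar>\<xi>\<bar> powr \<alpha>"
  proof (cases "\<xi> = 0")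
    case False
    have "(\<xi>\<^sup>2) powr (\<alpha> / 2) = (\<bar>\<xi>\<bar> powr 2) powr (\<alpha> / 2)" using False by simp
    also have "\<dots> = \<bar>\<xi>\<bar> powr \<alpha>" by (simp only: powr_powr) simp
    finally show ?thesis .
  qed (use \<alpha> in simp)
  finally show ?thesis .
qed

text \<open>
  \<open>exp (- (v\<^sup>2) / 2)\<close> is the characteristic function of a Gaussian \<open>h\<close> at \<open>v\<close>; exchanging the
  expectations turns it into the characteristic function of \<open>Y\<close> at \<open>d * h\<close>.
\<close>

lemma Y_truncated_moment: "(\<integral>s. 1 - exp (- ((d * Y s)\<^sup>2) / 2) \<partial>\<kappa>) \<le> 2 * \<bar>d\<bar> powr \<alpha>"
proof -
  interpret KN: pair_prob_space \<kappa> N ..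
  \<comment> \<open>Since \<alpha> < 2, a Gaussian has a finite moment of order \<alpha>, here at
    most 1 + 1; this is the constant 2 of the claim.\<close>
  have powr_le: "\<bar>h\<bar> powr \<alpha> \<le> 1 + h\<^sup>2" for h :: real
  proof (cases "\<bar>h\<bar> \<le> 1")
    case True
    then have "\<bar>h\<bar> powr \<alpha> \<le> 1" using \<alpha> by (intro powr_le1) auto
    then show ?thesis by (simp add: add_increasing2)
  next
    case False
    then have "\<bar>h\<bar> powr \<alpha> \<le> \<bar>h\<bar> powr 2" using \<alpha> by (intro powr_mono) auto
    then show ?thesis using False by simp
  qed
  have N2: "integrable N (\<lambda>h. h\<^sup>2)" "(\<integral>h. h\<^sup>2 \<partial>N) = 1"
    using std_normal_distribution_even_moments[of 1] by (simp_all add: has_bochner_integral_iff)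
  have Npow: "integrable N (\<lambda>h. \<bar>h\<bar> powr \<alpha>)"
    by (rule Bochner_Integration.integrable_bound[of N "\<lambda>h. 1 + h\<^sup>2"]) (use N2(1) powr_le in auto)
  have i: "integrable (\<kappa> \<Otimes>\<^sub>M N) (\<lambda>z. iexp (d * Y (fst z) * snd z))"
    by (rule KN.integrable_const_bound[where B=1]) auto
  have "complex_of_real (\<integral>s. exp (- ((d * Y s)\<^sup>2) / 2) \<partial>\<kappa>) =
      (\<integral>s. (\<integral>h. iexp (d * Y s * h) \<partial>N) \<partial>\<kappa>)"
    by (simp only: N_char integral_complex_of_real)
  also have "\<dots> = (\<integral>h. (\<integral>s. iexp (d * Y s * h) \<partial>\<kappa>) \<partial>N)"
    using KN.Fubini_integral[of "\<lambda>s h. iexp (d * Y s * h)"] i by (simp add: case_prod_beta')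
  also have "\<dots> = (\<integral>h. of_real (exp (- (\<bar>d * h\<bar> powr \<alpha>))) \<partial>N)"
  proof (intro Bochner_Integration.integral_cong refl)
    fix h
    have "(\<integral>s. iexp (d * Y s * h) \<partial>\<kappa>) = char (distr \<kappa> borel Y) (d * h)"
      unfolding char_def by (subst integral_distr) (auto simp: mult_ac)
    then show "(\<integral>s. iexp (d * Y s * h) \<partial>\<kappa>) = of_real (exp (- (\<bar>d * h\<bar> powr \<alpha>)))"
      by (simp only: Y_char)
  qed
  also have "\<dots> = complex_of_real (\<integral>h. exp (- (\<bar>d * h\<bar> powr \<alpha>)) \<partial>N)"
    by (rule integral_complex_of_real)
  finally have eq: "(\<integral>s. exp (- ((d * Y s)\<^sup>2) / 2) \<partial>\<kappa>) =
      (\<integral>h. exp (- (\<bar>d * h\<bar> powr \<alpha>)) \<partial>N)"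
    by (simp only: of_real_eq_iff)
  have i1: "integrable \<kappa> (\<lambda>s. exp (- ((d * Y s)\<^sup>2) / 2))"
    by (rule K.integrable_const_bound[where B=1]) auto
  have i2: "integrable N (\<lambda>h. exp (- (\<bar>d * h\<bar> powr \<alpha>)))"
    by (rule N.integrable_const_bound[where B=1]) auto
  have "(\<integral>s. 1 - exp (- ((d * Y s)\<^sup>2) / 2) \<partial>\<kappa>) = 1
      - (\<integral>s. exp (- ((d * Y s)\<^sup>2) / 2) \<partial>\<kappa>)"
    using i1 K.prob_space by (subst Bochner_Integration.integral_diff) auto
  also have "\<dots> = (\<integral>h. 1 - exp (- (\<bar>d * h\<bar> powr \<alpha>)) \<partial>N)"
    unfolding eq using i2 N.prob_space by (subst Bochner_Integration.integral_diff) auto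
  also have "\<dots> \<le> (\<integral>h. \<bar>d\<bar> powr \<alpha> * (1 + h\<^sup>2) \<partial>N)"
  proof (rule integral_mono)
    fix h
    have "1 - exp (- (\<bar>d * h\<bar> powr \<alpha>)) \<le> \<bar>d * h\<bar> powr \<alpha>"
      using exp_ge_add_one_self[of "- (\<bar>d * h\<bar> powr \<alpha>)"] by simp
    also have "\<dots> = \<bar>d\<bar> powr \<alpha> * \<bar>h\<bar> powr \<alpha>" by (simp add: abs_mult powr_mult)
    also have "\<dots> \<le> \<bar>d\<bar> powr \<alpha> * (1 + h\<^sup>2)" by (intro mult_left_mono powr_le) auto
    finally show "1 - exp (- (\<bar>d * h\<bar> powr \<alpha>)) \<le> \<bar>d\<bar> powr \<alpha> * (1 + h\<^sup>2)" .
  qed (use i2 N2(1) in auto)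
  also have "\<dots> = \<bar>d\<bar> powr \<alpha> * 2"
    using N2 N.prob_space by simp
  finally show ?thesis by simp
qed

lemma integral_\<Omega>_coord:
  fixes f :: "real \<times> real \<Rightarrow> 'b::{banach, second_countable_topology}"
  assumes "f \<in> borel_measurable (borel \<Otimes>\<^sub>M borel)"
  shows "(\<integral>\<omega>. f (\<omega> n) \<partial>\<Omega>) = (\<integral>s. f s \<partial>\<kappa>)"
proof -
  have "(\<integral>s. f s \<partial>\<kappa>) = (\<integral>s. f s \<partial>distr \<Omega> \<kappa> (\<lambda>\<omega>. \<omega> n))"
    unfolding \<Omega>_def by (subst distr_PiM_component) (auto intro: K.prob_space_axioms)
  also have "\<dots> = (\<integral>\<omega>. f (\<omega> n) \<partial>\<Omega>)"
    by (rule integral_distr) (use assms in \<open>auto simp: \<Omega>_def\<close>)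
  finally show ?thesis by simp
qed

lemma AE_\<Omega>_coord: "(AE s in \<kappa>. Q s) \<Longrightarrow> AE \<omega> in \<Omega>. Q (\<omega> n)"
  unfolding \<Omega>_def by (rule AE_PiM_component) (auto intro: K.prob_space_axioms)

lemma AE_\<kappa>_pos: "AE s in \<kappa>. 0 < fst s"
  unfolding \<kappa>_def
proof (rule MN.AE_pair_measure)
  show "{s \<in> space (\<mu> \<Otimes>\<^sub>M N). 0 < fst s} \<in> sets (\<mu> \<Otimes>\<^sub>M N)" by measurable
qed (use \<mu>_pos in \<open>auto elim!: eventually_mono\<close>)

text \<open>Y has infinite variance, so the expected sum of squares is useless. The bounded
  functions \<open>f n\<close> have means at most \<open>2 * \<bar>d n\<bar> powr \<alpha>\<close>,
  hence are almost surely summable, and for small values they are comparable with the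
  squares.\<close>

lemma AE_noise_square_summable:
  assumes d: "summable (\<lambda>n. \<bar>d n\<bar> powr \<alpha>)"
  shows "AE \<omega> in \<Omega>. summable (\<lambda>n. (d n * Y (\<omega> n))\<^sup>2)"
proof -
  define f where "f n \<omega> = 1 - exp (- ((d n * Y (\<omega> n))\<^sup>2) / 2)" for n and \<omega> :: "nat \<Rightarrow> real \<times> real"
  have f0: "0 \<le> f n \<omega>" for n \<omega> by (simp add: f_def)
  have fm [measurable]: "f n \<in> borel_measurable \<Omega>" for n unfolding f_def[abs_def] by measurable
  have fi: "integrable \<Omega> (f n)" for n
    by (rule O.integrable_const_bound[where B=1]) (auto simp: f_def)
  have "(\<integral>\<omega>. f n \<omega> \<partial>\<Omega>) \<le> 2 * \<bar>d n\<bar> powr \<alpha>" for n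
    using Y_truncated_moment[of "d n"] integral_\<Omega>_coord[of "\<lambda>s. 1 - exp (- ((d n * Y s)\<^sup>2) / 2)" n]
    by (simp add: f_def)
  then have le: "(\<integral>\<^sup>+\<omega>. ennreal (f n \<omega>) \<partial>\<Omega>) \<le> ennreal (2 * \<bar>d n\<bar> powr \<alpha>)" for n
    using nn_integral_eq_integral[OF fi, of n] f0 by (simp add: ennreal_leI)
  have "(\<integral>\<^sup>+\<omega>. (\<Sum>n. ennreal (f n \<omega>)) \<partial>\<Omega>) =
      (\<Sum>n. \<integral>\<^sup>+\<omega>. ennreal (f n \<omega>) \<partial>\<Omega>)"
    by (rule nn_integral_suminf) simp
  also have "\<dots> \<le> (\<Sum>n. ennreal (2 * \<bar>d n\<bar> powr \<alpha>))"
    by (intro suminf_le le) auto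
  also have "\<dots> = ennreal (\<Sum>n. 2 * \<bar>d n\<bar> powr \<alpha>)"
    by (rule suminf_ennreal2) (use d in \<open>auto intro: summable_mult\<close>)
  finally have "(\<integral>\<^sup>+\<omega>. (\<Sum>n. ennreal (f n \<omega>)) \<partial>\<Omega>) < \<infinity>" by (simp add: order_le_less_trans)
  then have "AE \<omega> in \<Omega>. (\<Sum>n. ennreal (f n \<omega>)) \<noteq> \<infinity>"
    by (intro nn_integral_PInf_AE) (auto simp: less_top)
  then show ?thesis
  proof eventually_elim
    case (elim \<omega>)
    then have sf: "summable (\<lambda>n. f n \<omega>)"
      using f0 by (intro summable_suminf_not_top) auto
    then have "(\<lambda>n. f n \<omega>) \<longlonglongrightarrow> 0" by (rule summable_LIMSEQ_zero)
    \<comment> \<open>Below this threshold half the square, called v next, is at most 1, where 1 -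
      exp (- v) >= v / 2.\<close>
    then have "\<forall>\<^sub>F n in sequentially. f n \<omega> < 1 - exp (-1)"
      by (rule order_tendstoD) simp
    then have ev: "\<forall>\<^sub>F n in sequentially. norm ((d n * Y (\<omega> n))\<^sup>2) \<le> 4 * f n \<omega>"
    proof eventually_elim
      case (elim n)
      define v where "v = (d n * Y (\<omega> n))\<^sup>2 / 2"
      have v: "0 \<le> v" "exp (-1) < exp (- v)" using elim by (simp_all add: v_def f_def)
      then have "v \<le> 1" by simp
      have "1 / exp v \<le> 1 / (1 + v)"
        using v(1) exp_ge_add_one_self[of v] by (intro divide_left_mono) auto
      then have "1 - exp (- v) \<ge> v / (1 + v)"
        using v(1) by (simp add: exp_minus field_simps)
      moreover have "v / (1 + v) \<ge> v / 2" using v(1) \<open>v \<le> 1\<close> by (intro divide_left_mono) auto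
      moreover have "f n \<omega> = 1 - exp (- v)" by (simp add: v_def f_def)
      ultimately have "v \<le> 2 * f n \<omega>" by linarith
      then show ?case by (simp add: v_def)
    qed
    show ?case
      by (rule summable_comparison_test_ev[OF ev]) (use sf in \<open>auto intro: summable_mult\<close>)
  qed
qed

text \<open>
  Isolates the Gaussian part of the \<open>n\<close>-th coordinate from all other randomness.
\<close>

lemma integral_\<Omega>_resample:
  fixes f :: "(nat \<Rightarrow> real \<times> real) \<Rightarrow> real"
  assumes [measurable]: "f \<in> borel_measurable \<Omega>" and i: "integrable \<Omega> f"
  shows "(\<integral>\<omega>. f \<omega> \<partial>\<Omega>) =
      (\<integral>z. (\<integral>g. f ((fst z)(n := (snd z, g))) \<partial>N) \<partial>(\<Omega> \<Otimes>\<^sub>M \<mu>))"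
proof -
  interpret KO: pair_prob_space \<kappa> \<Omega> ..
  interpret OM: pair_prob_space \<Omega> \<mu> ..
  interpret OMN: pair_prob_space "\<Omega> \<Otimes>\<^sub>M \<mu>" N ..
  have upd: "(\<lambda>(x, X). X(n := x)) \<in> measurable (\<kappa> \<Otimes>\<^sub>M \<Omega>) \<Omega>"
    unfolding \<Omega>_def case_prod_beta' by (rule measurable_fun_upd[of _ UNIV]) auto
  have D1: "distr (\<kappa> \<Otimes>\<^sub>M \<Omega>) \<Omega> (\<lambda>(x, X). X(n := x)) = \<Omega>"
    using distr_pair_PiM_eq_PiM[of UNIV "\<lambda>_. \<kappa>" n] K.prob_space_axioms unfolding \<Omega>_def by simp
  \<comment> \<open>Replacing one coordinate by an independent copy preserves \<Omega>;
    \<open>h\<close> only reorders the factors so that the Gaussian of that copy becomes the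
    innermost variable.\<close>
  define h where "h = (\<lambda>(z :: (nat \<Rightarrow> real \<times> real) \<times> real, g :: real). ((snd z, g), fst z))"
  have hm [measurable]: "h \<in> measurable ((\<Omega> \<Otimes>\<^sub>M \<mu>) \<Otimes>\<^sub>M N) (\<kappa> \<Otimes>\<^sub>M \<Omega>)"
    unfolding h_def \<kappa>_def by measurable
  have D2: "distr ((\<Omega> \<Otimes>\<^sub>M \<mu>) \<Otimes>\<^sub>M N) (\<kappa> \<Otimes>\<^sub>M \<Omega>) h =
      \<kappa> \<Otimes>\<^sub>M \<Omega>"
  proof (rule measure_eqI)
    fix A assume "A \<in> sets (distr ((\<Omega> \<Otimes>\<^sub>M \<mu>) \<Otimes>\<^sub>M N) (\<kappa> \<Otimes>\<^sub>M \<Omega>) h)"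
    then have A [measurable]: "A \<in> sets (\<kappa> \<Otimes>\<^sub>M \<Omega>)" by simp
    have A' [measurable]: "A \<in> sets ((\<mu> \<Otimes>\<^sub>M N) \<Otimes>\<^sub>M \<Omega>)" using A unfolding \<kappa>_def .
    have "emeasure (distr ((\<Omega> \<Otimes>\<^sub>M \<mu>) \<Otimes>\<^sub>M N) (\<kappa> \<Otimes>\<^sub>M \<Omega>) h) A =
        (\<integral>\<^sup>+y. indicator A (h y) \<partial>((\<Omega> \<Otimes>\<^sub>M \<mu>) \<Otimes>\<^sub>M N))"
      (is "?e = _")
    proof -
      have "?e = (\<integral>\<^sup>+y. indicator A y \<partial>distr ((\<Omega> \<Otimes>\<^sub>M \<mu>) \<Otimes>\<^sub>M N) (\<kappa>
          \<Otimes>\<^sub>M \<Omega>) h)"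
        by (rule nn_integral_indicator[symmetric]) (simp only: sets_distr A)
      also have "\<dots> = (\<integral>\<^sup>+y. indicator A (h y) \<partial>((\<Omega> \<Otimes>\<^sub>M \<mu>) \<Otimes>\<^sub>M N))"
        by (rule nn_integral_distr[OF hm]) (simp only: borel_measurable_indicator A measurable_distr_eq1)
      finally show ?thesis .
    qed
    also have "\<dots> = (\<integral>\<^sup>+z. (\<integral>\<^sup>+g. indicator A (h (z, g)) \<partial>N) \<partial>(\<Omega>
        \<Otimes>\<^sub>M \<mu>))"
      by (rule N.nn_integral_fst[symmetric]) measurable
    also have "\<dots> = (\<integral>\<^sup>+\<omega>. (\<integral>\<^sup>+x. (\<integral>\<^sup>+g. indicator A ((x, g), \<omega>)
        \<partial>N) \<partial>\<mu>) \<partial>\<Omega>)"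
      by (subst M.nn_integral_fst[symmetric]) (simp_all add: h_def)
    also have "\<dots> = (\<integral>\<^sup>+\<omega>. (\<integral>\<^sup>+s. indicator A (s, \<omega>) \<partial>\<kappa>) \<partial>\<Omega>)"
      unfolding \<kappa>_def by (intro nn_integral_cong N.nn_integral_fst) measurable
    also have "\<dots> = emeasure (\<kappa> \<Otimes>\<^sub>M \<Omega>) A"
      by (subst KO.nn_integral_snd) (simp_all only: nn_integral_indicator[OF A] borel_measurable_indicator[OF A] case_prod_eta)
    finally show "emeasure (distr ((\<Omega> \<Otimes>\<^sub>M \<mu>) \<Otimes>\<^sub>M N) (\<kappa> \<Otimes>\<^sub>M \<Omega>) h) A =
        emeasure (\<kappa> \<Otimes>\<^sub>M \<Omega>) A" .
  qed simp
  define k where "k = (\<lambda>(x, X). X(n := x)) \<circ> h"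
  have km [measurable]: "k \<in> measurable ((\<Omega> \<Otimes>\<^sub>M \<mu>) \<Otimes>\<^sub>M N) \<Omega>"
    unfolding k_def by (rule measurable_comp[OF hm upd])
  have D: "distr ((\<Omega> \<Otimes>\<^sub>M \<mu>) \<Otimes>\<^sub>M N) \<Omega> k = \<Omega>"
    using distr_distr[OF upd hm] D1 D2 by (simp add: k_def)
  have "integrable ((\<Omega> \<Otimes>\<^sub>M \<mu>) \<Otimes>\<^sub>M N) (\<lambda>y. f (k y))"
    using integrable_distr[OF km, of f] i D by simp
  then have int: "integrable ((\<Omega> \<Otimes>\<^sub>M \<mu>) \<Otimes>\<^sub>M N) (\<lambda>(z, g). f ((fst z)(n := (snd z, g))))"
    by (simp add: k_def h_def case_prod_beta' o_def)
  have "(\<integral>\<omega>. f \<omega> \<partial>\<Omega>) =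
      (\<integral>y. f (k y) \<partial>((\<Omega> \<Otimes>\<^sub>M \<mu>) \<Otimes>\<^sub>M N))"
    by (subst D[symmetric], rule integral_distr) auto
  also have "\<dots> = (\<integral>z. (\<integral>g. f ((fst z)(n := (snd z, g))) \<partial>N) \<partial>(\<Omega> \<Otimes>\<^sub>M \<mu>))"
    using OMN.integral_fst[OF int] by (simp add: k_def h_def case_prod_beta' o_def)
  finally show ?thesis .
qed

end

section \<open>The Ornstein--Uhlenbeck variable\<close>

text \<open>Here \<open>l\<close> stands for the eigenvalues of -A. The locale describes only the
  law of the process at a given time; the operator, its semigroup and the driving processes return
  in \<open>ou_semigroup_eq\<close>.\<close>

locale ou_model = stable_noise \<mu> \<alpha> for \<mu> \<alpha> +
  fixes e :: "nat \<Rightarrow> 'h::{real_inner, banach, polish_space}" and l \<beta> :: "nat \<Rightarrow> real" and \<gamma> C :: real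
  assumes basis: "orthonormal_basis e" and l_pos: "\<And>n. 0 < l n" and \<beta>_pos: "\<And>n. 0 < \<beta> n"
    and \<gamma>: "1 / \<alpha> \<le> \<gamma>" "\<gamma> < 1" and C: "0 < C" and \<beta>_ge: "\<And>n. \<beta> n \<ge> C * l n powr
        (1 / \<alpha> - \<gamma>)"
    and \<beta>_summable: "summable (\<lambda>n. \<beta> n powr \<alpha> / l n)"
begin

lemmas e_inner = orthonormal_basis_inner[OF basis]

text \<open>
  \<open>c n t powr \<alpha>\<close> is the integral of \<open>exp (- \<alpha> * l n * (t - s))\<close> over \<open>0 \<le> s \<le>
      t\<close>, so \<open>c n t\<close> is the
  scale of the \<open>n\<close>-th stochastic convolution;
      \<open>d n\<close> is the limit of \<open>\<beta> n * c n t\<close> as \<open>t\<close> grows.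
\<close>

definition c :: "nat \<Rightarrow> real \<Rightarrow> real" where
  "c n t = ((1 - exp (- (\<alpha> * l n) * t)) / (\<alpha> * l n)) powr (1 / \<alpha>)"

definition d :: "nat \<Rightarrow> real" where "d n = \<beta> n * (1 / (\<alpha> * l n)) powr (1 / \<alpha>)"

definition X :: "real \<Rightarrow> 'h \<Rightarrow> (nat \<Rightarrow> real \<times> real) \<Rightarrow> 'h" where
  "X t x \<omega> = (\<Sum>n. (exp (- l n * t) * (x \<bullet> e n) + \<beta> n * c n t * Y (\<omega> n)) *\<^sub>R e n)"

text \<open>Because \<open>d n\<close> dominates \<open>\<beta> n * c n t\<close> for every t >= 0,
  one exceptional null set serves all times and all starting points.\<close>

definition good :: "(nat \<Rightarrow> real \<times> real) \<Rightarrow> bool" where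
  "good \<omega> \<longleftrightarrow> summable (\<lambda>n. (d n * Y (\<omega> n))\<^sup>2)"

lemma \<alpha>l_pos: "0 < \<alpha> * l n" using \<alpha> l_pos[of n] by simp

lemma c_nonneg: "0 \<le> c n t" by (simp add: c_def)

lemma c_pos: "0 < t \<Longrightarrow> 0 < c n t"
  using \<alpha>l_pos[of n] l_pos[of n] \<alpha> by (auto simp: c_def)

lemma c_le: "0 \<le> t \<Longrightarrow> c n t \<le> (1 / (\<alpha> * l n)) powr (1 / \<alpha>)"
  unfolding c_def using \<alpha>l_pos[of n] \<alpha> by (intro powr_mono2 divide_right_mono) auto

lemma c_tendsto:
  assumes "(\<tau> \<longlongrightarrow> t) F" "\<forall>\<^sub>F k in F. 0 \<le> \<tau> k" "0 \<le> t"
  shows "((\<lambda>k. c n (\<tau> k)) \<longlongrightarrow> c n t) F"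
  unfolding c_def
proof (rule tendsto_powr')
  show "((\<lambda>k. (1 - exp (- (\<alpha> * l n) * \<tau> k)) / (\<alpha> * l n)) \<longlongrightarrow> (1
      - exp (- (\<alpha> * l n) * t)) / (\<alpha> * l n)) F"
    using \<alpha>l_pos[of n] by (intro tendsto_intros assms(1)) auto
  show "(1 - exp (- (\<alpha> * l n) * t)) / (\<alpha> * l n) \<noteq> 0 \<or>
    0 < 1 / \<alpha> \<and> (\<forall>\<^sub>F k in F. 0 \<le> (1 - exp (- (\<alpha> * l n) * \<tau> k)) / (\<alpha> * l n))"
    using assms(2) \<alpha>l_pos[of n] \<alpha> by (intro disjI2 conjI) (auto elim!: eventually_mono)
qed (rule tendsto_const)

lemma d_nonneg: "0 \<le> d n" using \<beta>_pos[of n] by (simp add: d_def)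

lemma noise_le:
  assumes "0 \<le> t"
  shows "\<bar>\<beta> n * c n t * Y s\<bar> \<le> \<bar>d n * Y s\<bar>"
  unfolding abs_mult d_def using c_le[OF assms, of n] c_nonneg[of n t] \<beta>_pos[of n]
  by (intro mult_right_mono) auto

lemma d_summable: "summable (\<lambda>n. \<bar>d n\<bar> powr \<alpha>)"
proof -
  have "\<bar>d n\<bar> powr \<alpha> = (1 / \<alpha>) * (\<beta> n powr \<alpha> / l n)" for n
  proof -
    have "\<bar>d n\<bar> powr \<alpha> = \<beta> n powr \<alpha> * ((1 / (\<alpha> * l n)) powr (1 / \<alpha>)) powr \<alpha>"
      using \<beta>_pos[of n] d_nonneg[of n] by (simp add: d_def powr_mult)
    also have "((1 / (\<alpha> * l n)) powr (1 / \<alpha>)) powr \<alpha> = 1 / (\<alpha> * l n)"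
      using \<alpha> \<alpha>l_pos[of n] by (simp only: powr_powr) (simp add: less_imp_le)
    finally show ?thesis by simp
  qed
  then show ?thesis using summable_mult[OF \<beta>_summable, of "1 / \<alpha>"] by simp
qed

lemma AE_good: "AE \<omega> in \<Omega>. good \<omega>"
  unfolding good_def by (rule AE_noise_square_summable[OF d_summable])

lemma noise_summable:
  assumes "good \<omega>" "0 \<le> t"
  shows "summable (\<lambda>n. (\<beta> n * c n t * Y (\<omega> n))\<^sup>2)"
  by (rule summable_comparison_test[OF _ assms(1)[unfolded good_def]])
    (use noise_le[OF assms(2)] in \<open>auto simp: abs_le_square_iff[symmetric]\<close>)

lemma drift_summable:
  assumes "0 \<le> t"
  shows "summable (\<lambda>n. (exp (- l n * t) * (x \<bullet> e n))\<^sup>2)"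
proof (rule summable_comparison_test[OF _ summable_coefficients[OF e_inner, of x]], intro exI[of _ 0] allI impI)
  fix n
  have "\<bar>exp (- l n * t) * (x \<bullet> e n)\<bar> \<le> 1 * \<bar>x \<bullet> e n\<bar>"
    unfolding abs_mult using l_pos[of n] assms by (intro mult_right_mono) auto
  then show "norm ((exp (- l n * t) * (x \<bullet> e n))\<^sup>2) \<le> (x \<bullet> e n)\<^sup>2"
    by (simp add: abs_le_square_iff[symmetric])
qed

definition E :: "real \<Rightarrow> 'h \<Rightarrow> 'h" where "E t x = (\<Sum>n. (exp (- l n * t) * (x \<bullet> e n)) *\<^sub>R e n)"

definition Z :: "real \<Rightarrow> (nat \<Rightarrow> real \<times> real) \<Rightarrow> 'h" where
  "Z t \<omega> = (\<Sum>n. (\<beta> n * c n t * Y (\<omega> n)) *\<^sub>R e n)"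

lemma X_eq:
  assumes "good \<omega>" "0 \<le> t"
  shows "X t x \<omega> = E t x + Z t \<omega>"
  unfolding X_def E_def Z_def scaleR_add_left
  by (rule suminf_add[symmetric]) (intro summable_orthonormal e_inner drift_summable noise_summable assms)+

lemma E_inner: "0 \<le> t \<Longrightarrow> E t x \<bullet> e n = exp (- l n * t) * (x \<bullet> e n)"
  unfolding E_def by (intro inner_suminf_orthonormal e_inner drift_summable)

lemma E_add_basis:
  assumes "0 \<le> t"
  shows "E t (x + r *\<^sub>R e n) = E t x + (exp (- l n * t) * r) *\<^sub>R e n"
  by (rule orthonormal_basis_eqI[OF basis]) (auto simp: E_inner[OF assms] inner_add_left e_inner algebra_simps)

lemma E_diff: "0 \<le> t \<Longrightarrow> E t (x - y) = E t x - E t y"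
  by (rule orthonormal_basis_eqI[OF basis]) (auto simp: E_inner inner_diff_left algebra_simps)

lemma E_norm:
  assumes "0 \<le> t"
  shows "norm (E t x) \<le> norm x"
proof (rule power2_le_imp_le)
  have "(norm (E t x))\<^sup>2 = (\<Sum>n. (exp (- l n * t) * (x \<bullet> e n))\<^sup>2)"
    unfolding E_def by (intro norm_suminf_orthonormal e_inner drift_summable assms)
  also have "\<dots> \<le> (\<Sum>n. (x \<bullet> e n)\<^sup>2)"
  proof (intro suminf_le drift_summable summable_coefficients e_inner assms)
    fix n
    have "\<bar>exp (- l n * t) * (x \<bullet> e n)\<bar> \<le> 1 * \<bar>x \<bullet> e n\<bar>"
      unfolding abs_mult using l_pos[of n] assms by (intro mult_right_mono) auto
    then show "(exp (- l n * t) * (x \<bullet> e n))\<^sup>2 \<le> (x \<bullet> e n)\<^sup>2"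
      by (simp add: abs_le_square_iff[symmetric])
  qed
  finally show "(norm (E t x))\<^sup>2 \<le> (norm x)\<^sup>2" by (simp add: orthonormal_basis_parseval[OF basis])
qed simp

lemma Z_inner: "good \<omega> \<Longrightarrow> 0 \<le> t \<Longrightarrow> Z t \<omega> \<bullet> e n = \<beta> n * c n t * Y (\<omega> n)"
  unfolding Z_def by (intro inner_suminf_orthonormal e_inner noise_summable)

text \<open>The noise coefficients are dominated by \<open>d n * Y (\<omega> n)\<close> uniformly in
  time. In the drift both arguments move: \<open>E (\<tau> k) (\<xi> k - x)\<close> vanishes by
  contractivity, and \<open>E (\<tau> k) x\<close> converges with the coefficients of x as
  dominating sequence.\<close>

lemma X_tendsto:
  assumes \<omega>: "good \<omega>" and \<tau>: "(\<tau> \<longlongrightarrow> t) F" "\<forall>\<^sub>F k in F. 0 \<le> \<tau> k" "0 \<le> t"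
    and x: "(\<xi> \<longlongrightarrow> x) F" and F: "F \<noteq> bot"
  shows "((\<lambda>k. X (\<tau> k) (\<xi> k) \<omega>) \<longlongrightarrow> X t x \<omega>) F"
proof -
  have Z: "((\<lambda>k. Z (\<tau> k) \<omega>) \<longlongrightarrow> Z t \<omega>) F"
    unfolding Z_def
  proof (rule tendsto_suminf_orthonormal[OF e_inner])
    show "summable (\<lambda>n. (\<bar>d n * Y (\<omega> n)\<bar>)\<^sup>2)" using \<omega> by (simp add: good_def)
    show "((\<lambda>k. \<beta> n * c n (\<tau> k) * Y (\<omega> n)) \<longlongrightarrow> \<beta> n * c n t * Y (\<omega> n)) F" for n
      by (intro tendsto_intros c_tendsto \<tau>)
    show "\<forall>\<^sub>F k in F. \<forall>n. \<bar>\<beta> n * c n (\<tau> k) * Y (\<omega> n)\<bar> \<le> \<bar>d n * Y (\<omega> n)\<bar>"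
      using \<tau>(2) by eventually_elim (intro allI noise_le)
  qed (rule F)
  have E1: "((\<lambda>k. E (\<tau> k) x) \<longlongrightarrow> E t x) F"
    unfolding E_def
  proof (rule tendsto_suminf_orthonormal[OF e_inner])
    show "summable (\<lambda>n. (\<bar>x \<bullet> e n\<bar>)\<^sup>2)" using summable_coefficients[OF e_inner, of x] by simp
    show "((\<lambda>k. exp (- l n * \<tau> k) * (x \<bullet> e n)) \<longlongrightarrow> exp (- l n * t) * (x \<bullet> e n)) F" for n
      by (intro tendsto_intros \<tau>)
    show "\<forall>\<^sub>F k in F. \<forall>n. \<bar>exp (- l n * \<tau> k) * (x \<bullet> e n)\<bar> \<le> \<bar>x \<bullet> e n\<bar>"
      using \<tau>(2)
    proof (eventually_elim, intro allI)
      fix k n assume "0 \<le> \<tau> k"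
      then have "\<bar>exp (- l n * \<tau> k) * (x \<bullet> e n)\<bar> \<le> 1 * \<bar>x \<bullet> e n\<bar>"
        unfolding abs_mult using l_pos[of n] by (intro mult_right_mono) auto
      then show "\<bar>exp (- l n * \<tau> k) * (x \<bullet> e n)\<bar> \<le> \<bar>x \<bullet> e n\<bar>" by simp
    qed
  qed (rule F)
  have "((\<lambda>k. norm (\<xi> k - x)) \<longlongrightarrow> 0) F"
    using x by (simp add: LIM_zero_iff tendsto_norm_zero_iff)
  then have E2: "((\<lambda>k. E (\<tau> k) (\<xi> k - x)) \<longlongrightarrow> 0) F"
    by (rule Lim_null_comparison[rotated]) (use \<tau>(2) in eventually_elim, intro E_norm)
  have "((\<lambda>k. (E (\<tau> k) (\<xi> k - x) + E (\<tau> k) x) + Z (\<tau> k) \<omega>) \<longlongrightarrow> (0 + E t x) + Z t \<omega>) F"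
    by (intro tendsto_add E1 E2 Z)
  moreover have "\<forall>\<^sub>F k in F. (E (\<tau> k) (\<xi> k - x) + E (\<tau> k) x) + Z (\<tau> k) \<omega> = X (\<tau> k) (\<xi> k) \<omega>"
    using \<tau>(2) by eventually_elim (simp add: X_eq[OF \<omega>] E_diff)
  ultimately show ?thesis
    using X_eq[OF \<omega> \<tau>(3)] by (simp add: filterlim_cong)
qed

lemma X_measurable [measurable (raw)]:
  assumes [measurable]: "f \<in> borel_measurable M" "g \<in> borel_measurable M" and h: "h \<in> measurable M \<Omega>"
  shows "(\<lambda>z. X (f z) (g z) (h z)) \<in> borel_measurable M"
proof -
  have [measurable]: "(\<lambda>z. Y (h z n)) \<in> borel_measurable M" for n
    by (rule measurable_compose[OF h Y_coord_measurable])
  show ?thesis unfolding X_def c_def by measurable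
qed

definition P :: "real \<Rightarrow> ('h \<Rightarrow> real) \<Rightarrow> 'h \<Rightarrow> real" where
  "P t \<phi> x = (\<integral>\<omega>. \<phi> (X t x \<omega>) \<partial>\<Omega>)"

lemma P_bound:
  assumes "\<phi> \<in> borel_measurable borel" and B: "\<And>x. \<bar>\<phi> x\<bar> \<le> B"
  shows "\<bar>P t \<phi> x\<bar> \<le> B"
proof -
  note [measurable] = assms(1)
  have i: "integrable \<Omega> (\<lambda>\<omega>. \<phi> (X t x \<omega>))"
    by (rule O.integrable_const_bound[where B=B]) (use B in auto)
  have "\<bar>P t \<phi> x\<bar> \<le> (\<integral>\<omega>. \<bar>\<phi> (X t x \<omega>)\<bar> \<partial>\<Omega>)"
    unfolding P_def by (rule integral_abs_bound)
  also have "\<dots> \<le> (\<integral>\<omega>. B \<partial>\<Omega>)"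
    by (rule integral_mono) (use i B in auto)
  finally show ?thesis using O.prob_space by simp
qed

lemma P_continuous:
  assumes \<phi>: "continuous_on UNIV \<phi>" and B: "\<And>x. \<bar>\<phi> x\<bar> \<le> B"
  shows "continuous_on ({0..} \<times> UNIV) (\<lambda>(t, x). P t \<phi> x)"
  unfolding continuous_on_sequentially
proof (intro ballI allI impI)
  fix z and a :: "real \<times> 'h" assume a: "a \<in> {0..} \<times> UNIV" and z: "(\<forall>n. z n \<in> {0..} \<times> UNIV) \<and> z \<longlonglongrightarrow>
      a"
  have [measurable]: "\<phi> \<in> borel_measurable borel" using \<phi> by (rule borel_measurable_continuous_onI)
  have "(\<lambda>n. \<integral>\<omega>. \<phi> (X (fst (z n)) (snd (z n)) \<omega>) \<partial>\<Omega>) \<longlonglongrightarrow>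
      (\<integral>\<omega>. \<phi> (X (fst a) (snd a) \<omega>) \<partial>\<Omega>)"
  proof (rule integral_dominated_convergence[where w="\<lambda>_. B"])
    show "AE \<omega> in \<Omega>. (\<lambda>n. \<phi> (X (fst (z n)) (snd (z n)) \<omega>)) \<longlonglongrightarrow>
        \<phi> (X (fst a) (snd a) \<omega>)"
      using AE_good
    proof eventually_elim
      case (elim \<omega>)
      have "(\<lambda>n. X (fst (z n)) (snd (z n)) \<omega>) \<longlonglongrightarrow> X (fst a) (snd a) \<omega>"
      proof (rule X_tendsto[OF elim])
        have "0 \<le> fst (z n)" for n using z mem_Times_iff[of "z n" "{0..}" UNIV] by simp
        then show "\<forall>\<^sub>F n in sequentially. 0 \<le> fst (z n)" by simp
      qed (use a z in \<open>auto intro!: tendsto_fst tendsto_snd simp: mem_Times_iff\<close>)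
      moreover have "isCont \<phi> (X (fst a) (snd a) \<omega>)" using \<phi> by (simp add: continuous_on_eq_continuous_at)
      ultimately show ?case by (rule isCont_tendsto_compose[rotated])
    qed
  qed (use B in auto)
  then show "((\<lambda>(t, x). P t \<phi> x) \<circ> z) \<longlonglongrightarrow> (case a of (t, x) \<Rightarrow> P t \<phi> x)"
    by (simp add: P_def o_def case_prod_beta')
qed

text \<open>
  Moving the initial point by \<open>r *\<^sub>R e n\<close> has the same effect as adding \<open>r * b n t\<close> to \<open>Y
      (\<omega> n)\<close>, that is,
  \<open>r * b n t / sqrt (2 * fst (\<omega> n))\<close> to its Gaussian factor; \<open>w n t\<close> is the corresponding score.
\<close>

definition b :: "nat \<Rightarrow> real \<Rightarrow> real" where "b n t = exp (- l n * t) / (\<beta> n * c n t)"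

definition w :: "nat \<Rightarrow> real \<Rightarrow> real \<times> real \<Rightarrow> real" where
  "w n t s = b n t * (snd s / sqrt (2 * fst s))"

lemma b_nonneg: "0 \<le> b n t" using c_nonneg[of n t] \<beta>_pos[of n] by (simp add: b_def)

text \<open>For u <= 1, \<gamma> >= 1 / \<alpha> gives u powr \<gamma> <= u powr (1 / \<alpha>), and
  1 - exp (- \<alpha> u) >= u / 2. For u > 1, \<gamma> < 1 gives u powr \<gamma> <= u <= exp u, so
  the left side is at most 1, while the right side is at least 2 (1/2) powr (1 / \<alpha>) >=
  1.\<close>

lemma decay_estimate:
  fixes u :: real
  assumes u: "u > 0"
  shows "u powr \<gamma> * exp (- u) \<le> 2 * (1 - exp (- (\<alpha> * u))) powr (1 / \<alpha>)"
proof -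
  have a: "0 < 1 / \<alpha>" "1 / \<alpha> \<le> 1" using \<alpha> by auto
  have half: "(1 / 2 :: real) \<le> (1 / 2) powr (1 / \<alpha>)"
    using powr_mono'[of "1 / \<alpha>" 1 "1 / 2"] a by simp
  have mono: "1 - exp (- u) \<le> 1 - exp (- (\<alpha> * u))" using \<alpha> u by simp
  show ?thesis
  proof (cases "u \<le> 1")
    case True
    have "1 / exp u \<le> 1 / (1 + u)"
      using u exp_ge_add_one_self[of u] by (intro divide_left_mono) auto
    then have "1 - exp (- u) \<ge> u / (1 + u)" using u by (simp add: exp_minus field_simps)
    moreover have "u / (1 + u) \<ge> u / 2" using u True by (intro divide_left_mono) auto
    ultimately have ge: "u / 2 \<le> 1 - exp (- (\<alpha> * u))" using mono by linarith
    have "u powr \<gamma> * exp (- u) \<le> u powr \<gamma> * 1" using u by (intro mult_left_mono) auto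
    also have "u powr \<gamma> * 1 \<le> u powr (1 / \<alpha>)" using powr_mono'[OF \<gamma>(1), of u] u True by simp
    also have "\<dots> = (1 / 2) * (2 * u powr (1 / \<alpha>))" by simp
    also have "\<dots> \<le> (1 / 2) powr (1 / \<alpha>) * (2 * u powr (1 / \<alpha>))" by (intro mult_right_mono half) simp
    also have "\<dots> = 2 * (u / 2) powr (1 / \<alpha>)" using u powr_mult[of "1/2" u "1 / \<alpha>"] by simp
    also have "\<dots> \<le> 2 * (1 - exp (- (\<alpha> * u))) powr (1 / \<alpha>)"
      using u a ge by (intro mult_left_mono powr_mono2) auto
    finally show ?thesis .
  next
    case False
    have "u powr \<gamma> \<le> u powr 1" using False \<gamma> by (intro powr_mono) auto
    moreover have "u powr 1 = u" using u by simp
    ultimately have "u powr \<gamma> \<le> exp u" using exp_ge_add_one_self[of u] by linarith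
    then have 1: "u powr \<gamma> * exp (- u) \<le> 1" by (simp add: exp_minus field_simps)
    have "exp (- u) \<le> 1 / (1 + u)"
      using exp_ge_add_one_self[of u] u by (simp add: exp_minus field_simps)
    also have "1 / (1 + u) \<le> 1 / 2" using False by (intro divide_left_mono) auto
    finally have "1 / 2 \<le> 1 - exp (- (\<alpha> * u))" using mono by linarith
    then have "(1 / 2) powr (1 / \<alpha>) \<le> (1 - exp (- (\<alpha> * u))) powr (1 / \<alpha>)"
      using a by (intro powr_mono2) auto
    then show ?thesis using 1 half by linarith
  qed
qed

text \<open>The lower bound on \<beta> is made for this: the factor l n powr (1 / \<alpha>) hidden
  in \<open>c n t\<close> cancels, and the remaining l n powr \<gamma> equals u powr \<gamma> times
  t powr (- \<gamma>) with u = l n t. The result no longer depends on n.\<close>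

lemma b_le:
  assumes t: "0 < t"
  shows "b n t \<le> 2 * \<alpha> powr (1 / \<alpha>) / C * t powr (- \<gamma>)"
proof -
  define u where "u = l n * t"
  define q where "q = (1 - exp (- (\<alpha> * u))) powr (1 / \<alpha>)"
  have u: "u > 0" using l_pos[of n] t by (simp add: u_def)
  have q: "q > 0" using u \<alpha> by (simp add: q_def)
  have cq: "c n t = q / (\<alpha> powr (1 / \<alpha>) * l n powr (1 / \<alpha>))"
    using \<alpha>l_pos[of n] u \<alpha> l_pos[of n] t
    by (simp add: c_def q_def u_def powr_divide powr_mult mult.assoc)
  have "b n t \<le> exp (- u) / (C * l n powr (1 / \<alpha> - \<gamma>) * c n t)"
    unfolding b_def u_def using \<beta>_ge[of n] c_pos[OF t, of n] C \<beta>_pos[of n] l_pos[of n]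
    by (simp, intro divide_left_mono mult_right_mono mult_pos_pos) auto
  also have "\<dots> = \<alpha> powr (1 / \<alpha>) / C * (l n powr \<gamma> * exp (- u) / q)"
  proof -
    have pd: "l n powr (1 / \<alpha> - \<gamma>) = l n powr (1 / \<alpha>) / l n powr \<gamma>" by (rule powr_diff)
    have pos: "l n powr (1 / \<alpha>) > 0" "l n powr \<gamma> > 0" "\<alpha> powr (1 / \<alpha>) > 0"
      using l_pos[of n] \<alpha> by simp_all
    show ?thesis unfolding cq pd using pos C q by (simp add: divide_simps)
  qed
  also have "l n powr \<gamma> = u powr \<gamma> * t powr (- \<gamma>)"
    using l_pos[of n] t by (simp add: u_def powr_mult powr_minus field_simps)
  also have "\<alpha> powr (1 / \<alpha>) / C * (u powr \<gamma> * t powr (- \<gamma>) * exp (- u) / q) =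
     \<alpha> powr (1 / \<alpha>) / C * t powr (- \<gamma>) * (u powr \<gamma> * exp (- u) / q)" by simp
  also have "\<dots> \<le> \<alpha> powr (1 / \<alpha>) / C * t powr (- \<gamma>) * 2"
    using decay_estimate[OF u] q C by (intro mult_left_mono) (auto simp: q_def field_simps)
  finally show ?thesis by (simp add: ac_simps)
qed

end

section \<open>The gradient of the transition semigroup\<close>

context ou_model
begin

lemma w_measurable [measurable]: "w n t \<in> borel_measurable (borel \<Otimes>\<^sub>M borel)"
  unfolding w_def[abs_def] by measurable

lemma w_coord_measurable [measurable]: "(\<lambda>\<omega>. w n t (\<omega> i)) \<in> borel_measurable \<Omega>"
  by measurable

text \<open>A bound, uniform in n, for the L2 norm of the score \<open>w n t\<close>: the estimate
  of \<open>b n t\<close> times the root of the mean of 1 / (2 \<sigma>), the Gaussian contributing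
  variance 1.\<close>

definition B :: "real \<Rightarrow> real" where
  "B t = 2 * \<alpha> powr (1 / \<alpha>) / C * t powr (- \<gamma>) * sqrt (\<integral>x. 1 / \<bar>2 * x\<bar> \<partial>\<mu>)"

lemma inverse_moment: "integrable \<mu> (\<lambda>x. 1 / \<bar>2 * x\<bar>)" "0 < (\<integral>x. 1 / \<bar>2 * x\<bar> \<partial>\<mu>)"
proof -
  have "integrable \<mu> (\<lambda>x. norm ((1 / 2) * (1 / x)))"
    by (intro integrable_norm integrable_mult_right \<mu>_inverse)
  then show i: "integrable \<mu> (\<lambda>x. 1 / \<bar>2 * x\<bar>)" by (simp add: abs_mult)
  have "(\<integral>x. 1 / \<bar>2 * x\<bar> \<partial>\<mu>) \<noteq> 0"
  proof
    assume "(\<integral>x. 1 / \<bar>2 * x\<bar> \<partial>\<mu>) = 0"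
    then have "AE x in \<mu>. 1 / \<bar>2 * x\<bar> = 0"
      using integral_nonneg_eq_0_iff_AE[OF i] by simp
    then have "AE x in \<mu>. False" using \<mu>_pos by eventually_elim simp
    then show False using M.AE_False by simp
  qed
  moreover have "0 \<le> (\<integral>x. 1 / \<bar>2 * x\<bar> \<partial>\<mu>)" by (rule Bochner_Integration.integral_nonneg) simp
  ultimately show "0 < (\<integral>x. 1 / \<bar>2 * x\<bar> \<partial>\<mu>)" by linarith
qed

lemma B_pos: "0 < t \<Longrightarrow> 0 < B t"
  using inverse_moment(2) C \<alpha> by (simp add: B_def)

lemma N_moments: "integrable N (\<lambda>g. g)" "(\<integral>g. g \<partial>N) =
    0" "integrable N (\<lambda>g. g\<^sup>2)" "(\<integral>g. g\<^sup>2 \<partial>N) = 1"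
  using integrable_std_normal_distribution_moment[of 1] integral_std_normal_distribution_moment_odd[of 1]
    std_normal_distribution_even_moments[of 1]
  by (simp_all add: has_bochner_integral_iff)

lemma w_square:
  "integrable \<kappa> (\<lambda>s. (w n t s)\<^sup>2)"
  "0 < t \<Longrightarrow> (\<integral>s. (w n t s)\<^sup>2 \<partial>\<kappa>) \<le> (B t)\<^sup>2"
proof -
  have eq: "(w n t (x, g))\<^sup>2 = ((b n t)\<^sup>2 * (1 / \<bar>2 * x\<bar>)) * g\<^sup>2" for x g
  proof -
    \<comment> \<open>The root of a negative number is minus the root of its modulus, so the square
      is the modulus for every real x; hence the absolute value in the moment.\<close>
    have "(sqrt (2 * x))\<^sup>2 = \<bar>2 * x\<bar>" by (simp only: real_sqrt_power[symmetric] real_sqrt_abs)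
    then show ?thesis by (simp add: w_def power_mult_distrib power_divide)
  qed
  have fst: "(\<integral>g. (w n t (x, g))\<^sup>2 \<partial>N) = (b n t)\<^sup>2 * (1 / \<bar>2 * x\<bar>)" for x
    unfolding eq using N_moments(4) by (subst integral_mult_right_zero) simp
  show i: "integrable \<kappa> (\<lambda>s. (w n t s)\<^sup>2)"
    unfolding \<kappa>_def
  proof (rule MN.Fubini_integrable)
    show "AE x in \<mu>. integrable N (\<lambda>y. (w n t (x, y))\<^sup>2)"
      unfolding eq by (intro AE_I2 integrable_mult_right N_moments)
    show "integrable \<mu> (\<lambda>x. \<integral>y. norm ((w n t (x, y))\<^sup>2) \<partial>N)"
      using integrable_mult_right[OF inverse_moment(1), of "(b n t)\<^sup>2"] by (simp add: fst)
  qed measurable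
  assume t: "0 < t"
  have "(\<integral>s. (w n t s)\<^sup>2 \<partial>\<kappa>) = (\<integral>x. (\<integral>g. (w n t (x, g))\<^sup>2 \<partial>N) \<partial>\<mu>)"
    using i unfolding \<kappa>_def by (rule MN.integral_fst'[symmetric])
  also have "\<dots> = (b n t)\<^sup>2 * (\<integral>x. 1 / \<bar>2 * x\<bar> \<partial>\<mu>)"
    unfolding fst by (rule integral_mult_right_zero)
  also have "\<dots> \<le> (2 * \<alpha> powr (1 / \<alpha>) / C * t powr (- \<gamma>))\<^sup>2 * (\<integral>x. 1 / \<bar>2 * x\<bar>
      \<partial>\<mu>)"
    using inverse_moment(2) b_nonneg b_le[OF t] by (intro mult_right_mono power_mono) auto
  also have "\<dots> = (B t)\<^sup>2"
    using inverse_moment(2) unfolding B_def by (subst (2) power_mult_distrib) (simp add: real_sqrt_pow2)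
  finally show "(\<integral>s. (w n t s)\<^sup>2 \<partial>\<kappa>) \<le> (B t)\<^sup>2" .
qed

lemma w_coord_square_integrable: "integrable \<Omega> (\<lambda>\<omega>. (w n t (\<omega> i))\<^sup>2)"
proof -
  have "integrable (distr \<Omega> \<kappa> (\<lambda>\<omega>. \<omega> i)) (\<lambda>s. (w n t s)\<^sup>2)"
    unfolding \<Omega>_def using w_square(1) K.prob_space_axioms by (subst distr_PiM_component) auto
  then show ?thesis
    by (subst (asm) integrable_distr_eq) (auto simp: \<Omega>_def)
qed

lemma w_coord_integrable: "integrable \<Omega> (\<lambda>\<omega>. w n t (\<omega> i))"
proof (rule Bochner_Integration.integrable_bound[of \<Omega> "\<lambda>\<omega>. 1 + (w n t (\<omega> i))\<^sup>2"])
  have "\<bar>y\<bar> \<le> 1 + y\<^sup>2" for y :: real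
    using sum_squares_bound[of 1 "\<bar>y\<bar>"] by simp
  then show "AE \<omega> in \<Omega>. norm (w n t (\<omega> i)) \<le> norm (1 + (w n t (\<omega> i))\<^sup>2)" by simp
qed (auto intro: w_coord_square_integrable)

lemma w_product_integrable: "integrable \<Omega> (\<lambda>\<omega>. w n t (\<omega> n) * w m t (\<omega> m))"
proof (rule Bochner_Integration.integrable_bound[of \<Omega> "\<lambda>\<omega>. (w n t (\<omega> n))\<^sup>2 + (w m t (\<omega> m))\<^sup>2"])
  have "\<bar>x * y\<bar> \<le> x\<^sup>2 + y\<^sup>2" for x y :: real
    using sum_squares_bound[of "\<bar>x\<bar>" "\<bar>y\<bar>"] mult_nonneg_nonneg[of "\<bar>x\<bar>" "\<bar>y\<bar>"]
    unfolding abs_mult power2_abs by linarith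
  then show "AE \<omega> in \<Omega>. norm (w n t (\<omega> n) * w m t (\<omega> m)) \<le> norm ((w n t (\<omega> n))\<^sup>2 +
      (w m t (\<omega> m))\<^sup>2)" by simp
qed (auto intro: w_coord_square_integrable)

text \<open>Given everything except the n-th Gaussian, the product is a multiple of that Gaussian,
  which has mean 0.\<close>

lemma w_orthogonal:
  assumes "n \<noteq> m"
  shows "(\<integral>\<omega>. w n t (\<omega> n) * w m t (\<omega> m) \<partial>\<Omega>) = 0"
proof -
  have "(\<integral>\<omega>. w n t (\<omega> n) * w m t (\<omega> m) \<partial>\<Omega>) =
    (\<integral>z. (\<integral>g. w n t (snd z, g) * w m t (fst z m) \<partial>N) \<partial>(\<Omega> \<Otimes>\<^sub>M \<mu>))"
    using integral_\<Omega>_resample[OF _ w_product_integrable, where n=n] assms by simp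
  also have "(\<lambda>z. \<integral>g. w n t (snd z, g) * w m t (fst z m) \<partial>N) = (\<lambda>z. 0)"
  proof
    fix z :: "(nat \<Rightarrow> real \<times> real) \<times> real"
    have "w n t (snd z, g) * w m t (fst z m) = (b n t / sqrt (2 * snd z) * w m t (fst z m)) * g" for g
      by (simp add: w_def)
    then show "(\<integral>g. w n t (snd z, g) * w m t (fst z m) \<partial>N) = 0"
      using N_moments(2) by (simp only: integral_mult_right_zero)
  qed
  finally show ?thesis by simp
qed

text \<open>A Bismut-type weight formula: for \<Psi> = \<phi> (X t x) the coefficients are the
  partial derivatives of \<open>P t \<phi>\<close> at x, as \<open>P_GDERIV\<close>
  confirms.\<close>

definition W :: "real \<Rightarrow> ((nat \<Rightarrow> real \<times> real) \<Rightarrow> real) \<Rightarrow> 'h" where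
  "W t \<Psi> = (\<Sum>n. (\<integral>\<omega>. \<Psi> \<omega> * w n t (\<omega> n) \<partial>\<Omega>) *\<^sub>R e n)"

lemma weighted_integrable:
  assumes [measurable]: "\<Psi> \<in> borel_measurable \<Omega>" and "\<And>\<omega>. \<bar>\<Psi> \<omega>\<bar> \<le> A"
  shows "integrable \<Omega> (\<lambda>\<omega>. \<Psi> \<omega> * w n t (\<omega> n))"
proof (rule Bochner_Integration.integrable_bound[of \<Omega> "\<lambda>\<omega>. A * \<bar>w n t (\<omega> n)\<bar>"])
  have "norm (\<Psi> \<omega> * w n t (\<omega> n)) \<le> norm (A * \<bar>w n t (\<omega> n)\<bar>)" for \<omega>
  proof -
    have "\<bar>\<Psi> \<omega>\<bar> \<le> \<bar>A\<bar>" using assms(2)[of \<omega>] by linarith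
    then show ?thesis by (simp add: abs_mult mult_right_mono)
  qed
  then show "AE \<omega> in \<Omega>. norm (\<Psi> \<omega> * w n t (\<omega> n)) \<le> norm (A * \<bar>w n t (\<omega> n)\<bar>)" by simp
qed (use w_coord_integrable in auto)

text \<open>The scores are orthogonal but not normalised, each of norm at most B t. With S the sum
  of \<open>a n * w n t (\<omega> n)\<close>, the mean of (B \<Psi> - S / B)^2 is nonnegative; its
  cross term is minus twice the sum of the squares of \<open>a n\<close>, and its last term is at
  most that sum.\<close>

lemma weighted_bessel:
  assumes [measurable]: "\<Psi> \<in> borel_measurable \<Omega>" and A: "\<And>\<omega>. \<bar>\<Psi> \<omega>\<bar> \<le> A" and t: "0 < t"
  shows "(\<Sum>n<k. (\<integral>\<omega>. \<Psi> \<omega> * w n t (\<omega> n) \<partial>\<Omega>)\<^sup>2) \<le>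
      (B t)\<^sup>2 * (\<integral>\<omega>. (\<Psi> \<omega>)\<^sup>2 \<partial>\<Omega>)"
proof -
  define a where "a n = (\<integral>\<omega>. \<Psi> \<omega> * w n t (\<omega> n) \<partial>\<Omega>)" for n
  define S where "S \<omega> = (\<Sum>n<k. a n * w n t (\<omega> n))" for \<omega> :: "nat \<Rightarrow> real \<times> real"
  note wi = weighted_integrable[OF assms(1) A, where t=t]
  have \<Psi>2: "integrable \<Omega> (\<lambda>\<omega>. (\<Psi> \<omega>)\<^sup>2)"
  proof (rule O.integrable_const_bound[where B="A\<^sup>2"])
    show "AE \<omega> in \<Omega>. norm ((\<Psi> \<omega>)\<^sup>2) \<le> A\<^sup>2"
      using power_mono[OF A, of _ 2] by simp
  qed simp
  have S2: "(S \<omega>)\<^sup>2 = (\<Sum>n<k. \<Sum>m<k. (a n * a m) * (w n t (\<omega> n) * w m t (\<omega> m)))" for \<omega>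
    unfolding S_def power2_eq_square sum_product by (intro sum.cong refl) (simp only: mult_ac)
  have S2i: "integrable \<Omega> (\<lambda>\<omega>. (S \<omega>)\<^sup>2)"
    unfolding S2 by (intro Bochner_Integration.integrable_sum integrable_mult_right w_product_integrable)
  have "(\<integral>\<omega>. (S \<omega>)\<^sup>2 \<partial>\<Omega>) =
      (\<Sum>n<k. \<Sum>m<k. (a n * a m) * (\<integral>\<omega>. w n t (\<omega> n) * w m t (\<omega> m) \<partial>\<Omega>))"
    unfolding S2 by (simp add: w_product_integrable Bochner_Integration.integral_sum)
  also have "\<dots> = (\<Sum>n<k. \<Sum>m<k. if m =
      n then (a n)\<^sup>2 * (\<integral>\<omega>. (w n t (\<omega> n))\<^sup>2 \<partial>\<Omega>) else 0)"
    by (intro sum.cong refl) (auto simp: w_orthogonal power2_eq_square)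
  also have "\<dots> = (\<Sum>n<k. (a n)\<^sup>2 * (\<integral>\<omega>. (w n t (\<omega> n))\<^sup>2 \<partial>\<Omega>))"
    by simp
  also have "\<dots> \<le> (\<Sum>n<k. (a n)\<^sup>2 * (B t)\<^sup>2)"
  proof (intro sum_mono mult_left_mono)
    fix n
    show "(\<integral>\<omega>. (w n t (\<omega> n))\<^sup>2 \<partial>\<Omega>) \<le> (B t)\<^sup>2"
      using w_square(2)[OF t, of n] integral_\<Omega>_coord[of "\<lambda>s. (w n t s)\<^sup>2" n] by simp
  qed simp
  finally have SS: "(\<integral>\<omega>. (S \<omega>)\<^sup>2 \<partial>\<Omega>) \<le> (B t)\<^sup>2 * (\<Sum>n<k. (a n)\<^sup>2)"
    by (simp add: sum_distrib_right[symmetric] mult.commute)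
  have \<Psi>S: "\<Psi> \<omega> * S \<omega> = (\<Sum>n<k. a n * (\<Psi> \<omega> * w n t (\<omega> n)))" for \<omega>
    unfolding S_def sum_distrib_left by (intro sum.cong refl) (simp only: mult_ac)
  have \<Psi>Si: "integrable \<Omega> (\<lambda>\<omega>. \<Psi> \<omega> * S \<omega>)"
    unfolding \<Psi>S by (intro Bochner_Integration.integrable_sum integrable_mult_right wi)
  have \<Psi>SI: "(\<integral>\<omega>. \<Psi> \<omega> * S \<omega> \<partial>\<Omega>) = (\<Sum>n<k. (a n)\<^sup>2)"
    unfolding \<Psi>S by (simp add: wi a_def[symmetric] power2_eq_square Bochner_Integration.integral_sum)
  have Bp: "B t > 0" by (rule B_pos[OF t])
  have "0 \<le> (\<integral>\<omega>. (B t * \<Psi> \<omega>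
      - S \<omega> / B t)\<^sup>2 \<partial>\<Omega>)" by (rule Bochner_Integration.integral_nonneg) simp
  also have "(\<lambda>\<omega>. (B t * \<Psi> \<omega> - S \<omega> / B t)\<^sup>2) =
      (\<lambda>\<omega>. (B t)\<^sup>2 * (\<Psi> \<omega>)\<^sup>2 - 2 * (\<Psi> \<omega> * S \<omega>) +
          (1 / (B t)\<^sup>2) * (S \<omega>)\<^sup>2)"
    using Bp by (intro ext) (simp add: power2_eq_square field_simps)
  also have "(\<integral>\<omega>. (B t)\<^sup>2 * (\<Psi> \<omega>)\<^sup>2 - 2 * (\<Psi> \<omega> * S \<omega>) +
      (1 / (B t)\<^sup>2) * (S \<omega>)\<^sup>2 \<partial>\<Omega>) =
     (B t)\<^sup>2 * (\<integral>\<omega>. (\<Psi> \<omega>)\<^sup>2 \<partial>\<Omega>) - 2 * (\<Sum>n<k. (a n)\<^sup>2) +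
         (1 / (B t)\<^sup>2) * (\<integral>\<omega>. (S \<omega>)\<^sup>2 \<partial>\<Omega>)"
    using \<Psi>2 S2i \<Psi>Si by (simp add: \<Psi>SI)
  also have "(1 / (B t)\<^sup>2) * (\<integral>\<omega>. (S \<omega>)\<^sup>2 \<partial>\<Omega>) \<le> (\<Sum>n<k. (a n)\<^sup>2)"
    using SS Bp by (simp add: field_simps)
  finally show ?thesis by (simp add: a_def)
qed

lemma W_coeff_summable:
  assumes "\<Psi> \<in> borel_measurable \<Omega>" and "\<And>\<omega>. \<bar>\<Psi> \<omega>\<bar> \<le> A" and "0 < t"
  shows "summable (\<lambda>n. (\<integral>\<omega>. \<Psi> \<omega> * w n t (\<omega> n) \<partial>\<Omega>)\<^sup>2)"
  by (rule summableI_nonneg_bounded[OF _ weighted_bessel[OF assms]]) simp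

lemma W_inner:
  assumes "\<Psi> \<in> borel_measurable \<Omega>" and "\<And>\<omega>. \<bar>\<Psi> \<omega>\<bar> \<le> A" and "0 < t"
  shows "W t \<Psi> \<bullet> e n = (\<integral>\<omega>. \<Psi> \<omega> * w n t (\<omega> n) \<partial>\<Omega>)"
  unfolding W_def by (intro inner_suminf_orthonormal e_inner W_coeff_summable[OF assms])

lemma W_norm:
  assumes "\<Psi> \<in> borel_measurable \<Omega>" and "\<And>\<omega>. \<bar>\<Psi> \<omega>\<bar> \<le> A" and "0 < t"
  shows "(norm (W t \<Psi>))\<^sup>2 \<le> (B t)\<^sup>2 * (\<integral>\<omega>. (\<Psi> \<omega>)\<^sup>2 \<partial>\<Omega>)"
proof -
  have "(norm (W t \<Psi>))\<^sup>2 = (\<Sum>n. (\<integral>\<omega>. \<Psi> \<omega> * w n t (\<omega> n) \<partial>\<Omega>)\<^sup>2)"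
    unfolding W_def by (intro norm_suminf_orthonormal e_inner W_coeff_summable[OF assms])
  also have "\<dots> \<le> (B t)\<^sup>2 * (\<integral>\<omega>. (\<Psi> \<omega>)\<^sup>2 \<partial>\<Omega>)"
    by (rule suminf_le_const[OF W_coeff_summable[OF assms] weighted_bessel[OF assms]])
  finally show ?thesis .
qed

lemma W_diff:
  assumes "\<Psi> \<in> borel_measurable \<Omega>" "\<And>\<omega>. \<bar>\<Psi> \<omega>\<bar> \<le> A" "\<Psi>' \<in>
      borel_measurable \<Omega>" "\<And>\<omega>. \<bar>\<Psi>' \<omega>\<bar> \<le> A'" and t: "0 < t"
  shows "W t \<Psi> - W t \<Psi>' = W t (\<lambda>\<omega>. \<Psi> \<omega> - \<Psi>' \<omega>)"
proof (rule orthonormal_basis_eqI[OF basis])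
  fix n
  have b: "\<bar>\<Psi> \<omega> - \<Psi>' \<omega>\<bar> \<le> A + A'" for \<omega>
    using assms(2)[of \<omega>] assms(4)[of \<omega>] by linarith
  have m: "(\<lambda>\<omega>. \<Psi> \<omega> - \<Psi>' \<omega>) \<in> borel_measurable \<Omega>" using assms by simp
  show "(W t \<Psi> - W t \<Psi>') \<bullet> e n = W t (\<lambda>\<omega>. \<Psi> \<omega> - \<Psi>' \<omega>) \<bullet> e n"
    unfolding inner_diff_left W_inner[OF assms(1,2) t] W_inner[OF assms(3,4) t] W_inner[OF m b t]
    by (simp add: left_diff_distrib weighted_integrable[OF assms(1,2)] weighted_integrable[OF assms(3,4)])
qed

definition V :: "real \<Rightarrow> ('h \<Rightarrow> real) \<Rightarrow> 'h \<Rightarrow> 'h" where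
  "V t \<phi> x = W t (\<lambda>\<omega>. \<phi> (X t x \<omega>))"

lemma V_diff_le:
  assumes [measurable]: "\<phi> \<in> borel_measurable borel" "\<psi> \<in> borel_measurable borel"
    and bd: "\<And>x. \<bar>\<phi> x\<bar> \<le> A" "\<And>x. \<bar>\<psi> x\<bar> \<le> A'" and diff: "\<And>x. \<bar>\<phi> x
        - \<psi> x\<bar> \<le> D" and t: "0 < t"
  shows "norm (V t \<phi> x - V t \<psi> x) \<le> B t * D"
proof (rule power2_le_imp_le)
  have D: "0 \<le> D" using diff[of x] by linarith
  have m: "(\<lambda>\<omega>. \<phi> (X t x \<omega>) - \<psi> (X t x \<omega>)) \<in> borel_measurable \<Omega>" by simp
  have "(norm (V t \<phi> x - V t \<psi> x))\<^sup>2 = (norm (W t (\<lambda>\<omega>. \<phi> (X t x \<omega>) - \<psi> (X t x \<omega>))))\<^sup>2"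
    unfolding V_def by (subst W_diff[where A=A and A'=A']) (use bd t in auto)
  also have "\<dots> \<le> (B t)\<^sup>2 * (\<integral>\<omega>. (\<phi> (X t x \<omega>) - \<psi> (X t x \<omega>))\<^sup>2 \<partial>\<Omega>)"
    by (rule W_norm[OF m _ t]) (rule diff)
  also have "\<dots> \<le> (B t)\<^sup>2 * (\<integral>\<omega>. D\<^sup>2 \<partial>\<Omega>)"
  proof (intro mult_left_mono integral_mono)
    have le: "(\<phi> y - \<psi> y)\<^sup>2 \<le> D\<^sup>2" for y using power_mono[OF diff[of y], of 2] by simp
    show "integrable \<Omega> (\<lambda>\<omega>. (\<phi> (X t x \<omega>) - \<psi> (X t x \<omega>))\<^sup>2)"
      by (rule O.integrable_const_bound[where B="D\<^sup>2"]) (use le in auto)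
    show "(\<phi> (X t x \<omega>) - \<psi> (X t x \<omega>))\<^sup>2 \<le> D\<^sup>2" for \<omega> by (rule le)
  qed auto
  also have "\<dots> = (B t * D)\<^sup>2" using O.prob_space by (simp add: power_mult_distrib)
  finally show "(norm (V t \<phi> x - V t \<psi> x))\<^sup>2 \<le> (B t * D)\<^sup>2" .
  show "0 \<le> B t * D" using B_pos[OF t] D by simp
qed

lemma V_zero: "V t (\<lambda>_. 0) x = 0"
  by (simp add: V_def W_def)

text \<open>\<open>W_norm\<close> bounds the difference of two values of V by the L2 distance of
  \<phi> (X t z) and \<phi> (X t a). Plain continuity of \<phi> and dominated convergence then
  suffice.\<close>

lemma V_continuous:
  assumes \<phi>: "continuous_on UNIV \<phi>" and A: "\<And>x. \<bar>\<phi> x\<bar> \<le> A" and t: "0 < t"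
  shows "continuous_on UNIV (V t \<phi>)"
  unfolding continuous_on_sequentially
proof (intro ballI allI impI)
  fix z and a :: 'h assume z: "(\<forall>n. z n \<in> UNIV) \<and> z \<longlonglongrightarrow> a"
  have [measurable]: "\<phi> \<in> borel_measurable borel" using \<phi> by (rule borel_measurable_continuous_onI)
  have "(\<lambda>k. \<integral>\<omega>. (\<phi> (X t (z k) \<omega>) - \<phi> (X t a \<omega>))\<^sup>2 \<partial>\<Omega>) \<longlonglongrightarrow>
      (\<integral>\<omega>. 0 \<partial>\<Omega>)"
  proof (rule integral_dominated_convergence[where w="\<lambda>_. (2 * A)\<^sup>2"])
    show "AE \<omega> in \<Omega>. (\<lambda>k. (\<phi> (X t (z k) \<omega>) - \<phi> (X t a \<omega>))\<^sup>2) \<longlonglongrightarrow> 0"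
      using AE_good
    proof eventually_elim
      case (elim \<omega>)
      have "(\<lambda>k. X t (z k) \<omega>) \<longlonglongrightarrow> X t a \<omega>"
        by (rule X_tendsto[OF elim]) (use t z in auto)
      moreover have "isCont \<phi> (X t a \<omega>)" using \<phi> by (simp add: continuous_on_eq_continuous_at)
      ultimately have "(\<lambda>k. \<phi> (X t (z k) \<omega>)) \<longlonglongrightarrow>
          \<phi> (X t a \<omega>)" by (rule isCont_tendsto_compose[rotated])
      then show ?case by (auto intro!: tendsto_eq_intros)
    qed
    show "AE \<omega> in \<Omega>. norm ((\<phi> (X t (z k) \<omega>) - \<phi> (X t a \<omega>))\<^sup>2) \<le> (2 * A)\<^sup>2" for k
    proof (rule AE_I2)
      fix \<omega>
      have "\<bar>\<phi> (X t (z k) \<omega>) - \<phi> (X t a \<omega>)\<bar> \<le> 2 * A"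
        using A[of "X t (z k) \<omega>"] A[of "X t a \<omega>"] by linarith
      then show "norm ((\<phi> (X t (z k) \<omega>) - \<phi> (X t a \<omega>))\<^sup>2) \<le> (2 * A)\<^sup>2"
        using power_mono[of "\<bar>\<phi> (X t (z k) \<omega>) - \<phi> (X t a \<omega>)\<bar>" "2 * A" 2] by simp
    qed
  qed auto
  then have lim: "(\<lambda>k. sqrt ((B t)\<^sup>2 * (\<integral>\<omega>. (\<phi> (X t (z k) \<omega>)
      - \<phi> (X t a \<omega>))\<^sup>2 \<partial>\<Omega>))) \<longlonglongrightarrow> sqrt ((B t)\<^sup>2 * 0)"
    by (intro tendsto_intros) simp
  have "(\<lambda>k. V t \<phi> (z k) - V t \<phi> a) \<longlonglongrightarrow> 0"
  proof (rule Lim_null_comparison[OF _ lim[simplified]])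
    have "norm (V t \<phi> (z k) - V t \<phi> a) \<le> sqrt ((B t)\<^sup>2 * (\<integral>\<omega>. (\<phi> (X t (z k) \<omega>)
        - \<phi> (X t a \<omega>))\<^sup>2 \<partial>\<Omega>))" for k
    proof (rule real_le_rsqrt)
      have "V t \<phi> (z k) - V t \<phi> a = W t (\<lambda>\<omega>. \<phi> (X t (z k) \<omega>) - \<phi> (X t a \<omega>))"
        unfolding V_def by (rule W_diff[where A=A and A'=A]) (use A t in auto)
      then show "(norm (V t \<phi> (z k) - V t \<phi> a))\<^sup>2 \<le> (B t)\<^sup>2 * (\<integral>\<omega>. (\<phi> (X t (z k) \<omega>)
          - \<phi> (X t a \<omega>))\<^sup>2 \<partial>\<Omega>)"
      proof (simp only:, intro W_norm[where A="2 * A"])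
        show "\<bar>\<phi> (X t (z k) \<omega>) - \<phi> (X t a \<omega>)\<bar> \<le> 2 * A" for \<omega>
          using A[of "X t (z k) \<omega>"] A[of "X t a \<omega>"] by linarith
      qed (use t in auto)
    qed
    then show "\<forall>\<^sub>F k in sequentially. norm (V t \<phi> (z k) - V t \<phi> a) \<le>
        sqrt ((B t)\<^sup>2 * (\<integral>\<omega>. (\<phi> (X t (z k) \<omega>) - \<phi> (X t a \<omega>))\<^sup>2 \<partial>\<Omega>))" by simp
  qed
  then show "(V t \<phi> \<circ> z) \<longlonglongrightarrow> V t \<phi> a" by (simp add: LIM_zero_iff o_def)
qed

end

section \<open>From derivatives along basis vectors to Frechet derivatives\<close>

text \<open>The mean value inequality on the segment from x to x + k, applied to f minus the linear
  function with gradient v. Only derivatives in the one direction k are used.\<close>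

lemma increment_bound:
  fixes f :: "'h::real_inner \<Rightarrow> real"
  assumes der: "\<And>x. ((\<lambda>r. f (x + r *\<^sub>R k)) has_real_derivative V x \<bullet> k) (at 0)"
    and C: "convex U" "x \<in> U" "x + k \<in> U" and bound: "\<And>y. y \<in> U \<Longrightarrow> norm (V y - v) \<le> \<eta>"
  shows "\<bar>f (x + k) - f x - v \<bullet> k\<bar> \<le> \<eta> * norm k"
proof -
  define F where "F r = f (x + r *\<^sub>R k) - r * (v \<bullet> k)" for r
  have seg: "x + r *\<^sub>R k \<in> U" if "r \<in> {0..1}" for r
  proof -
    have "x + r *\<^sub>R k = (1 - r) *\<^sub>R x + r *\<^sub>R (x + k)" by (simp add: algebra_simps)
    then show ?thesis using C that by (auto intro: convexD)
  qed
  have "((\<lambda>s. f (x + r *\<^sub>R k + s *\<^sub>R k)) has_real_derivative V (x + r *\<^sub>R k) \<bullet> k) (at (r - r))" for r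
    using der[of "x + r *\<^sub>R k"] by simp
  then have "((\<lambda>s. f (x + r *\<^sub>R k + (s - r) *\<^sub>R k)) has_real_derivative V (x + r *\<^sub>R k) \<bullet> k) (at r)" for r
    using DERIV_shift[of "\<lambda>s. f (x + r *\<^sub>R k + s *\<^sub>R k)" "V (x + r *\<^sub>R k) \<bullet> k" r "- r"] by simp
  then have "((\<lambda>s. f (x + s *\<^sub>R k)) has_real_derivative V (x + r *\<^sub>R k) \<bullet> k) (at r)" for r
    by (simp add: algebra_simps)
  then have D: "((\<lambda>s. f (x + s *\<^sub>R k)) has_real_derivative V (x + r *\<^sub>R k) \<bullet> k) (at r within {0..1})" for r
    by (rule has_field_derivative_at_within)
  have dF: "(F has_real_derivative (V (x + r *\<^sub>R k) - v) \<bullet> k) (at r within {0..1})" for r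
    unfolding F_def inner_diff_left
    using DERIV_diff[OF D[of r] DERIV_cmult_right[OF DERIV_ident, where c="v \<bullet> k"]] by simp
  have "norm (F 1 - F 0) \<le> (\<eta> * norm k) * norm (1 - 0 :: real)"
  proof (rule field_differentiable_bound[of "{0..1}" F "\<lambda>r. (V (x + r *\<^sub>R k) - v) \<bullet> k"])
    fix r :: real assume r: "r \<in> {0..1}"
    have "norm ((V (x + r *\<^sub>R k) - v) \<bullet> k) \<le> norm (V (x + r *\<^sub>R k) - v) * norm k"
      by (simp add: Cauchy_Schwarz_ineq2)
    also have "\<dots> \<le> \<eta> * norm k" by (intro mult_right_mono bound seg r) simp
    finally show "norm ((V (x + r *\<^sub>R k) - v) \<bullet> k) \<le> \<eta> * norm k" .
  qed (use dF in auto)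
  then show ?thesis by (simp add: F_def algebra_simps)
qed

lemma has_real_derivative_alt:
  "(f has_real_derivative D) (at 0) \<longleftrightarrow>
    (\<forall>\<epsilon>>0. \<exists>\<delta>>0. \<forall>r. \<bar>r\<bar> < \<delta> \<longrightarrow> \<bar>f r - f 0 - r * D\<bar> \<le>
        \<epsilon> * \<bar>r\<bar>)"
  unfolding has_field_derivative_def has_derivative_at_alt
  by (simp add: bounded_linear_mult_right mult.commute)

text \<open>Directions along which V gives the derivative at every point form a subspace: for a sum
  the increment is taken along h and then along k from the displaced point, with V nearly constant
  nearby. On the span of the basis \<open>increment_bound\<close> gives the Frechet estimate with
  constants independent of the direction, so density of the span and continuity of f extend it to
  all directions.\<close>

lemma GDERIV_from_directional:
  fixes f :: "'h::{real_inner, banach, polish_space} \<Rightarrow> real"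
  assumes basis: "orthonormal_basis e" and f: "continuous_on UNIV f" and V: "continuous_on UNIV V"
    and der: "\<And>x n. ((\<lambda>r. f (x + r *\<^sub>R e n)) has_real_derivative V x \<bullet> e n) (at 0)"
  shows "GDERIV f x :> V x"
proof -
  define G where "G = {k. \<forall>x. ((\<lambda>r. f (x + r *\<^sub>R k)) has_real_derivative V x \<bullet> k) (at 0)}"
  have near: "\<exists>\<delta>>0. \<forall>y\<in>ball x \<delta>. norm (V y - V x) \<le> \<epsilon>" if "\<epsilon> > 0" for x \<epsilon>
  proof -
    have "\<exists>\<delta>>0. \<forall>y\<in>UNIV. dist y x < \<delta> \<longrightarrow> dist (V y) (V x) < \<epsilon>"
      using V that unfolding continuous_on_iff by blast
    then obtain \<delta> where "\<delta> > 0" "\<forall>y\<in>UNIV. dist y x < \<delta> \<longrightarrow> dist (V y) (V x) < \<epsilon>" by blast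
    then show ?thesis by (intro exI[of _ \<delta>]) (auto simp: dist_norm norm_minus_commute less_imp_le)
  qed
  have scale: "c *\<^sub>R k \<in> G" if k: "k \<in> G" for c k
    unfolding G_def
  proof (intro CollectI allI)
    fix x
    have "((\<lambda>r. f (x + r *\<^sub>R k)) has_real_derivative V x \<bullet> k) (at (c * 0))" using k by (simp add: G_def)
    moreover have "((\<lambda>r. c * r) has_real_derivative c) (at 0)"
      by (auto intro!: derivative_eq_intros)
    ultimately have "((\<lambda>r. f (x + (c * r) *\<^sub>R k)) has_real_derivative V x \<bullet> k * c) (at 0)"
      using DERIV_chain'[where f="\<lambda>r. c * r" and x=0 and s=UNIV and g="\<lambda>r. f (x + r *\<^sub>R k)" and D=c] by blast
    then show "((\<lambda>r. f (x + r *\<^sub>R (c *\<^sub>R k))) has_real_derivative V x \<bullet> (c *\<^sub>R k)) (at 0)"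
      by (simp add: mult.commute)
  qed
  have "subspace G"
    unfolding subspace_def
  proof (intro conjI ballI allI scale)
    show "0 \<in> G" by (simp add: G_def)
    fix h k assume hk: "h \<in> G" "k \<in> G"
    show "h + k \<in> G"
      unfolding G_def has_real_derivative_alt
    proof (intro CollectI allI impI)
      fix x and \<epsilon> :: real assume \<epsilon>: "\<epsilon> > 0"
      define \<eta> where "\<eta> = \<epsilon> / (norm h + norm k + 1)"
      have nn: "0 < norm h + norm k + 1" by (intro add_nonneg_pos add_nonneg_nonneg) auto
      have \<eta>: "\<eta> > 0" using \<epsilon> nn by (simp add: \<eta>_def)
      obtain \<delta> where \<delta>: "\<delta> > 0" "\<And>y. y \<in> ball x \<delta> \<Longrightarrow> norm (V y - V x) \<le> \<eta>"
        using near[OF \<eta>, of x] by blast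
      define \<delta>' where "\<delta>' = \<delta> / (norm h + norm k + 1)"
      have "\<bar>f (x + r *\<^sub>R (h + k)) - f (x + 0 *\<^sub>R (h + k)) - r * (V x \<bullet> (h + k))\<bar> \<le>
          \<epsilon> * \<bar>r\<bar>" if r: "\<bar>r\<bar> < \<delta>'" for r
      proof -
        have rd: "\<bar>r\<bar> * (norm h + norm k + 1) < \<delta>" using r nn by (simp add: \<delta>'_def field_simps)
        have b1: "norm (r *\<^sub>R h) < \<delta>"
        proof -
          have "norm (r *\<^sub>R h) \<le> \<bar>r\<bar> * (norm h + norm k + 1)" by (simp add: mult_left_mono)
          then show ?thesis using rd by simp
        qed
        have b2: "norm (r *\<^sub>R h + r *\<^sub>R k) < \<delta>"
        proof -
          have "norm (r *\<^sub>R h + r *\<^sub>R k) \<le> \<bar>r\<bar> * norm h + \<bar>r\<bar> * norm k"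
            using norm_triangle_ineq[of "r *\<^sub>R h" "r *\<^sub>R k"] by simp
          also have "\<dots> \<le> \<bar>r\<bar> * (norm h + norm k + 1)" by (simp add: distrib_left)
          finally show ?thesis using rd by simp
        qed
        have d1: "((\<lambda>s. f (y + s *\<^sub>R (r *\<^sub>R h))) has_real_derivative V y \<bullet> (r *\<^sub>R h)) (at 0)"
          and d2: "((\<lambda>s. f (y + s *\<^sub>R (r *\<^sub>R k))) has_real_derivative V y \<bullet> (r *\<^sub>R k)) (at 0)" for y
          using scale[OF hk(1), of r] scale[OF hk(2), of r] by (simp_all add: G_def)
        have 1: "\<bar>f (x + r *\<^sub>R h) - f x - V x \<bullet> (r *\<^sub>R h)\<bar> \<le> \<eta> * norm (r *\<^sub>R h)"
          using b1 \<delta> by (intro increment_bound[where U="ball x \<delta>" and V=V] d1) (auto simp: dist_norm)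
        have 2: "\<bar>f ((x + r *\<^sub>R h) + r *\<^sub>R k) - f (x + r *\<^sub>R h) - V x \<bullet> (r *\<^sub>R k)\<bar> \<le>
            \<eta> * norm (r *\<^sub>R k)"
          using b1 b2 \<delta> by (intro increment_bound[where U="ball x \<delta>" and V=V] d2)
            (auto simp: dist_norm add.assoc norm_minus_commute add.commute[of "r *\<^sub>R k"])
        have "\<bar>f (x + r *\<^sub>R (h + k)) - f (x + 0 *\<^sub>R (h + k)) - r * (V x \<bullet> (h + k))\<bar> \<le>
          \<eta> * norm (r *\<^sub>R h) + \<eta> * norm (r *\<^sub>R k)"
          using 1 2 by (simp add: scaleR_add_right inner_add_right distrib_left add.assoc)
        also have "\<dots> = \<bar>r\<bar> * (\<eta> * (norm h + norm k))" by (simp add: algebra_simps)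
        also have "\<dots> \<le> \<bar>r\<bar> * \<epsilon>"
          using \<epsilon> nn by (intro mult_left_mono) (simp_all add: \<eta>_def field_simps)
        finally show ?thesis by (simp add: mult.commute)
      qed
      moreover have "\<delta>' > 0" using \<delta> nn by (simp add: \<delta>'_def)
      ultimately show "\<exists>\<delta>>0. \<forall>r. \<bar>r\<bar> < \<delta> \<longrightarrow>
        \<bar>f (x + r *\<^sub>R (h + k)) - f (x + 0 *\<^sub>R (h + k)) - r * (V x \<bullet> (h + k))\<bar> \<le> \<epsilon> * \<bar>r\<bar>"
        by blast
    qed
  qed
  moreover have "range e \<subseteq> G" using der by (auto simp: G_def)
  ultimately have span: "span (range e) \<subseteq> G" by (simp add: span_minimal)
  show ?thesis
    unfolding gderiv_def has_derivative_at_alt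
  proof (intro conjI allI impI)
    fix \<epsilon> :: real assume "\<epsilon> > 0"
    then obtain \<delta> where \<delta>: "\<delta> > 0" "\<And>y. y \<in> ball x \<delta> \<Longrightarrow> norm (V y - V x) \<le> \<epsilon>"
      using near[of \<epsilon> x] by blast
    have "norm (f y - f x - (y - x) \<bullet> V x) \<le> \<epsilon> * norm (y - x)" if y: "norm (y - x) < \<delta>" for y
    proof -
      have "y - x \<in> closure (span (range e))" using basis by (simp add: orthonormal_basis_def)
      then obtain h where h: "\<And>j. h j \<in> span (range e)" "h \<longlonglongrightarrow> y - x"
        by (auto simp: closure_sequential)
      have hG: "\<And>j. h j \<in> G" using span h(1) by blast
      have "\<forall>\<^sub>F j in sequentially. norm (h j) < \<delta>"
        using tendsto_norm[OF h(2)] y by (rule order_tendstoD)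
      then have ev: "\<forall>\<^sub>F j in sequentially. \<bar>f (x + h j) - f x - V x \<bullet> h j\<bar> \<le> \<epsilon> * norm (h j)"
      proof eventually_elim
        case (elim j)
        then show ?case
          using hG[of j] \<delta> by (intro increment_bound[where U="ball x \<delta>" and V=V]) (auto simp: dist_norm G_def)
      qed
      have fc: "isCont f (x + (y - x))" using f by (simp add: continuous_on_eq_continuous_at)
      have l1: "(\<lambda>j. \<bar>f (x + h j) - f x - V x \<bullet> h j\<bar>) \<longlonglongrightarrow> \<bar>f (x + (y - x)) - f x
          - V x \<bullet> (y - x)\<bar>"
        by (intro tendsto_intros isCont_tendsto_compose[OF fc] h(2))
      have l2: "(\<lambda>j. \<epsilon> * norm (h j)) \<longlonglongrightarrow> \<epsilon> * norm (y - x)"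
        by (intro tendsto_intros h(2))
      from tendsto_le[OF _ l2 l1 ev] show ?thesis by (simp add: inner_commute)
    qed
    then show "\<exists>d>0. \<forall>y. norm (y - x) < d \<longrightarrow> norm (f y - f x - (y - x) \<bullet> V x) \<le> \<epsilon> * norm (y - x)"
      using \<delta>(1) by blast
  qed (rule bounded_linear_inner_left)
qed

text \<open>The formula is available only for r >= 0. Moving the base point back to x - v turns the
  point of interest into the interior value r = 1, so the fundamental theorem yields a two-sided
  derivative.\<close>

lemma directional_derivative_from_increments:
  fixes f :: "'h::{real_inner, banach, polish_space} \<Rightarrow> real"
  assumes V: "continuous_on UNIV V"
    and inc: "\<And>x r. r \<ge> 0 \<Longrightarrow> f (x + r *\<^sub>R v) - f x = (\<integral>\<rho>. indicator {0..r} \<rho> * (V (x +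
        \<rho> *\<^sub>R v) \<bullet> v) \<partial>lborel)"
  shows "((\<lambda>r. f (x + r *\<^sub>R v)) has_real_derivative V x \<bullet> v) (at 0)"
proof -
  define z where "z = x - v"
  define k where "k \<rho> = V (z + \<rho> *\<^sub>R v) \<bullet> v" for \<rho>
  have k: "continuous_on A k" for A
    unfolding k_def by (intro continuous_intros continuous_on_compose2[OF V]) auto
  have F: "f (z + r *\<^sub>R v) = f z + integral {0..r} k" if "r \<ge> 0" for r
  proof -
    have "set_integrable lborel {0..r} k" by (rule borel_integrable_atLeastAtMost'[OF k])
    then have "(LINT \<rho>:{0..r}|lborel. k \<rho>) = integral {0..r} k"
      by (rule set_borel_integral_eq_integral(2))
    then show ?thesis using inc[OF that, of z] by (simp add: set_lebesgue_integral_def k_def)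
  qed
  have "((\<lambda>r. integral {0..r} k) has_real_derivative k 1) (at 1 within {0..2})"
    by (rule integral_has_real_derivative[OF k]) simp
  then have "((\<lambda>r. integral {0..r} k) has_real_derivative k 1) (at 1)"
    by (subst (asm) at_within_interior) auto
  then have "((\<lambda>r. f z + integral {0..r} k) has_real_derivative k 1) (at 1)"
    by (auto intro!: derivative_eq_intros)
  then have "((\<lambda>r. f (z + r *\<^sub>R v)) has_real_derivative k 1) (at 1)"
    by (rule has_field_derivative_transform_within[where d=1]) (use F in \<open>auto simp: dist_real_def\<close>)
  then have "((\<lambda>r. f (z + (r + 1) *\<^sub>R v)) has_real_derivative k 1) (at 0)"
    using DERIV_shift[of "\<lambda>r. f (z + r *\<^sub>R v)" "k 1" 0 1] by simp
  then show ?thesis by (simp add: k_def z_def algebra_simps)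
qed

section \<open>Gaussian integration by parts\<close>

context stable_noise
begin

text \<open>The function h is merely bounded and measurable, so the shift is moved to the Gaussian
  density, which is smooth. Integrating over \<rho> in [0,r] replaces differentiation under the
  integral by the fundamental theorem and Fubini.\<close>

lemma gaussian_shift:
  fixes h :: "real \<Rightarrow> real"
  assumes h [measurable]: "h \<in> borel_measurable borel" and A: "\<And>g. \<bar>h g\<bar> \<le> A" and r: "0 \<le> r"
  shows "(\<integral>g. h (g + r * s) \<partial>N) - (\<integral>g. h g \<partial>N) =
    (\<integral>\<rho>. indicator {0..r} \<rho> * (\<integral>g. h (g + \<rho> * s) * (s * g) \<partial>N) \<partial>lborel)"
proof -
  let ?n = std_normal_density
  have nm [measurable]: "?n \<in> borel_measurable borel" by measurable
  have dens: "(\<integral>g. f g \<partial>N) = (\<integral>g. ?n g * f g \<partial>lborel)" if "f \<in>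
      borel_measurable borel" for f :: "real \<Rightarrow> real"
    using that by (subst integral_density) auto
  have idens: "integrable lborel (\<lambda>g. ?n g * f g)" if "integrable N f" for f :: "real \<Rightarrow> real"
  proof -
    have "f \<in> borel_measurable borel" using borel_measurable_integrable[OF that] by simp
    then show ?thesis using that by (subst (asm) integrable_density) auto
  qed
  \<comment> \<open>The integrand after substituting y = g + \<rho> s; apart from the factor h y it
    is the derivative in \<rho> of the density at y - \<rho> s.\<close>
  define q where "q \<rho> y = indicator {0..r} \<rho> * (h y * (s * (y - \<rho> * s) * ?n (y - \<rho> * s)))" for \<rho> y
  have qm [measurable]: "(\<lambda>(\<rho>, y). q \<rho> y) \<in> borel_measurable (borel \<Otimes>\<^sub>M borel)"
    unfolding q_def by measurable
  have hb: "integrable N (\<lambda>g. h (g + a))" for a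
    by (rule N.integrable_const_bound[where B=A]) (use A in auto)
  have Nid: "integrable N (\<lambda>g. g)" using integrable_std_normal_distribution_moment[of 1] by simp
  have hgb: "integrable N (\<lambda>g. h (g + a) * (s * g))" for a
  proof (rule Bochner_Integration.integrable_bound[of N "\<lambda>g. A * (s * g)"])
    have "\<bar>h (g + a) * (s * g)\<bar> \<le> \<bar>A * (s * g)\<bar>" for g
      unfolding abs_mult[of "h (g + a)"] abs_mult[of A] using order_trans[OF A[of "g + a"] abs_ge_self[of A]]
      by (rule mult_right_mono) simp
    then show "AE g in N. norm (h (g + a) * (s * g)) \<le> norm (A * (s * g))" by simp
    show "integrable N (\<lambda>g. A * (s * g))" by (intro integrable_mult_right Nid)
  qed measurable
  have shift: "(\<integral>y. f (y - a) \<partial>lborel) = (\<integral>y. f y \<partial>lborel)" for f :: "real \<Rightarrow> real" and a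
    using lborel_integral_real_affine[of 1 f "- a"] by simp
  have shifti: "integrable lborel f \<Longrightarrow> integrable lborel (\<lambda>y. f (y - a))" for f :: "real \<Rightarrow> real" and a
    using lborel_integrable_real_affine[of f 1 "- a"] by simp
  have q_eq: "q \<rho> y = (indicator {0..r} \<rho> * ?n (y - \<rho> * s)) * (h (y - \<rho> * s + \<rho> * s) * (s * (y - \<rho> * s)))" for \<rho> y
    unfolding q_def diff_add_cancel by (simp only: mult_ac)
  have qy: "integrable lborel (\<lambda>y. q \<rho> y)" for \<rho>
  proof -
    have "integrable lborel (\<lambda>y. indicator {0..r} \<rho> * (?n (y - \<rho> * s) * (h (y - \<rho> * s + \<rho> * s) * (s * (y
        - \<rho> * s)))))"
      by (rule integrable_mult_right[OF shifti[OF idens[OF hgb[of "\<rho> * s"]], of "\<rho> * s"]])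
    then show ?thesis unfolding q_eq by (simp only: mult.assoc)
  qed
  have qabs: "(\<integral>y. norm (q \<rho> y) \<partial>lborel) = indicator {0..r} \<rho> * (\<integral>g. \<bar>h (g +
      \<rho> * s) * (s * g)\<bar> \<partial>N)" for \<rho>
  proof -
    have e1: "(\<integral>g. \<bar>h (g + \<rho> * s) * (s * g)\<bar> \<partial>N) = (\<integral>y. ?n (y - \<rho> * s) * \<bar>h (y
        - \<rho> * s + \<rho> * s) * (s * (y - \<rho> * s))\<bar> \<partial>lborel)"
      unfolding shift[of "\<lambda>y. ?n y * \<bar>h (y + \<rho> * s) * (s * y)\<bar>" "\<rho> * s"] by (rule dens) simp
    have "indicator {0..r} \<rho> * ((\<integral>y. ?n (y - \<rho> * s) * \<bar>h (y - \<rho> * s + \<rho> * s) * (s * (y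
        - \<rho> * s))\<bar> \<partial>lborel)) = (\<integral>y. indicator {0..r} \<rho> * (?n (y - \<rho> * s) * \<bar>h (y - \<rho> * s +
            \<rho> * s) * (s * (y - \<rho> * s))\<bar>) \<partial>lborel)"
      by (rule integral_mult_right_zero[symmetric])
    also have "\<dots> = (\<integral>y. norm (q \<rho> y) \<partial>lborel)"
    proof (rule Bochner_Integration.integral_cong[OF refl])
      fix y
      have "norm (q \<rho> y) = (indicator {0..r} \<rho> * ?n (y - \<rho> * s)) * \<bar>h (y - \<rho> * s + \<rho> * s) * (s * (y
          - \<rho> * s))\<bar>"
        unfolding q_eq real_norm_def abs_mult[of "indicator {0..r} \<rho> * ?n (y - \<rho> * s)"]
        by (subst abs_of_nonneg) auto
      then show "indicator {0..r} \<rho> * (?n (y - \<rho> * s) * \<bar>h (y - \<rho> * s + \<rho> * s) * (s * (y - \<rho> * s))\<bar>) =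
          norm (q \<rho> y)"
        by (simp only: mult.assoc)
    qed
    finally show ?thesis unfolding e1 by (rule sym)
  qed
  have q\<rho>: "(\<integral>y. q \<rho> y \<partial>lborel) = indicator {0..r} \<rho> * (\<integral>g. h (g +
      \<rho> * s) * (s * g) \<partial>N)" for \<rho>
  proof -
    have e1: "(\<integral>g. h (g + \<rho> * s) * (s * g) \<partial>N) = (\<integral>y. ?n (y - \<rho> * s) * (h (y - \<rho> * s +
        \<rho> * s) * (s * (y - \<rho> * s))) \<partial>lborel)"
      unfolding shift[of "\<lambda>y. ?n y * (h (y + \<rho> * s) * (s * y))" "\<rho> * s"] by (rule dens) simp
    have "indicator {0..r} \<rho> * ((\<integral>y. ?n (y - \<rho> * s) * (h (y - \<rho> * s + \<rho> * s) * (s * (y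
        - \<rho> * s))) \<partial>lborel)) = (\<integral>y. indicator {0..r} \<rho> * (?n (y - \<rho> * s) * (h (y - \<rho> * s +
            \<rho> * s) * (s * (y - \<rho> * s)))) \<partial>lborel)"
      by (rule integral_mult_right_zero[symmetric])
    also have "\<dots> = (\<integral>y. q \<rho> y \<partial>lborel)"
      unfolding q_eq by (simp only: mult.assoc)
    finally show ?thesis unfolding e1 by (rule sym)
  qed
  have int: "integrable (lborel \<Otimes>\<^sub>M lborel) (\<lambda>(\<rho>, y). q \<rho> y)"
  proof (rule lborel_pair.Fubini_integrable)
    show "integrable lborel (\<lambda>\<rho>. \<integral>y. norm (case (\<rho>, y) of (\<rho>, y) \<Rightarrow> q \<rho> y) \<partial>lborel)"
    proof (rule Bochner_Integration.integrable_bound[of lborel "\<lambda>\<rho>. indicator {0..r} \<rho> * (\<integral>g. \<bar>A *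
        (s * g)\<bar> \<partial>N)"])
      show "integrable lborel (\<lambda>\<rho>. indicator {0..r} \<rho> * (\<integral>g. \<bar>A * (s * g)\<bar> \<partial>N))"
        using r by (intro integrable_mult_left integrable_real_indicator) auto
      have "(\<integral>g. \<bar>h (g + \<rho> * s) * (s * g)\<bar> \<partial>N) \<le> (\<integral>g. \<bar>A * (s * g)\<bar> \<partial>N)" for \<rho>
      proof (rule integral_mono)
        show "integrable N (\<lambda>g. \<bar>A * (s * g)\<bar>)" using Nid by (intro integrable_abs integrable_mult_right)
        show "integrable N (\<lambda>g. \<bar>h (g + \<rho> * s) * (s * g)\<bar>)" by (intro integrable_abs hgb)
        show "\<bar>h (g + \<rho> * s) * (s * g)\<bar> \<le> \<bar>A * (s * g)\<bar>" for g
          unfolding abs_mult[of "h (g + \<rho> * s)"] abs_mult[of A]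
          using order_trans[OF A[of "g + \<rho> * s"] abs_ge_self[of A]] by (rule mult_right_mono) simp
      qed
      then show "AE \<rho> in lborel. norm (\<integral>y. norm (case (\<rho>, y) of (\<rho>, y) \<Rightarrow> q \<rho> y) \<partial>lborel)
        \<le> norm (indicator {0..r} \<rho> * (\<integral>g. \<bar>A * (s * g)\<bar> \<partial>N))"
        unfolding prod.case qabs by (auto simp: indicator_def abs_of_nonneg)
    qed (simp, measurable)
    show "AE \<rho> in lborel. integrable lborel (\<lambda>y. case (\<rho>, y) of (\<rho>, y) \<Rightarrow> q \<rho> y)"
      using qy by simp
  qed measurable
  have ftc: "(\<integral>\<rho>. q \<rho> y \<partial>lborel) = h y * (?n (y - r * s) - ?n y)" for y
  proof -
    have "(\<integral>\<rho>. (s * (y - \<rho> * s) * ?n (y - \<rho> * s)) * indicator {0..r} \<rho> \<partial>lborel) = ?n (y - r * s)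
        - ?n (y - 0 * s)"
    proof (rule integral_FTC_Icc_real[OF r])
      fix \<rho>
      show "((\<lambda>\<rho>. ?n (y - \<rho> * s)) has_real_derivative s * (y - \<rho> * s) * ?n (y - \<rho> * s)) (at \<rho>)"
      proof -
        have n': "(?n has_real_derivative - x * ?n x) (at x)" for x
        proof -
          define C where "C = 1 / sqrt (2 * pi)"
          have "?n = (\<lambda>x. C * exp (- x\<^sup>2 / 2))" by (simp add: C_def std_normal_density_def fun_eq_iff)
          then show ?thesis by (auto intro!: derivative_eq_intros)
        qed
        have "((\<lambda>\<rho>. y - \<rho> * s) has_real_derivative - s) (at \<rho>)"
          by (auto intro!: derivative_eq_intros)
        from DERIV_chain'[OF this n'] show ?thesis
          by (rule DERIV_cong) (simp add: algebra_simps)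
      qed
      show "isCont (\<lambda>\<rho>. s * (y - \<rho> * s) * ?n (y - \<rho> * s)) \<rho>"
        unfolding std_normal_density_def by (intro continuous_intros) auto
    qed
    moreover have "q \<rho> y = h y * ((s * (y - \<rho> * s) * ?n (y - \<rho> * s)) * indicator {0..r} \<rho>)" for \<rho>
      by (simp add: q_def)
    ultimately show ?thesis by simp
  qed
  have i1: "integrable lborel (\<lambda>y. h y * ?n (y - r * s))"
    using shifti[OF idens[OF hb[of "r * s"]], of "r * s"] by (simp add: mult.commute)
  have i2: "integrable lborel (\<lambda>y. h y * ?n y)"
    using idens[OF hb[of 0]] by (simp add: mult.commute)
  have "(\<integral>g. h (g + r * s) \<partial>N) = (\<integral>y. h y * ?n (y - r * s) \<partial>lborel)"
    by (subst dens, simp, subst shift[symmetric, where a="r * s"]) (simp add: mult.commute)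
  moreover have "(\<integral>g. h g \<partial>N) = (\<integral>y. h y * ?n y \<partial>lborel)"
    by (subst dens) (simp_all add: mult.commute)
  ultimately have "(\<integral>g. h (g + r * s) \<partial>N) - (\<integral>g. h g \<partial>N) = (\<integral>y. h y * (?n (y - r * s)
      - ?n y) \<partial>lborel)"
    using i1 i2 by (simp add: right_diff_distrib)
  also have "\<dots> = (\<integral>y. (\<integral>\<rho>. q \<rho> y \<partial>lborel) \<partial>lborel)" by (simp only: ftc)
  also have "\<dots> = (\<integral>\<rho>. (\<integral>y. q \<rho> y \<partial>lborel) \<partial>lborel)"
    by (rule lborel_pair.Fubini_integral[OF int])
  also have "\<dots> = (\<integral>\<rho>. indicator {0..r} \<rho> * (\<integral>g. h (g + \<rho> * s) * (s * g) \<partial>N) \<partial>lborel)"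
    by (simp only: q\<rho>)
  finally show ?thesis .
qed

lemma update_measurable:
  assumes "f \<in> measurable M \<Omega>" "h \<in> measurable M (borel \<Otimes>\<^sub>M borel)"
  shows "(\<lambda>x. (f x)(n := h x)) \<in> measurable M \<Omega>"
proof -
  have "h \<in> measurable M \<kappa>" using assms(2) by (simp cong: measurable_cong_sets)
  then show ?thesis using assms(1) unfolding \<Omega>_def by (intro measurable_fun_upd[of _ UNIV]) auto
qed

end

section \<open>The gradient formula for the transition semigroup\<close>

context ou_model
begin

definition shift :: "nat \<Rightarrow> real \<Rightarrow> (nat \<Rightarrow> real \<times> real) \<Rightarrow>
    (nat \<Rightarrow> real \<times> real)" where
  "shift n a \<omega> = (\<omega>)(n := (fst (\<omega> n), snd (\<omega> n) + a / sqrt (2 * fst (\<omega> n))))"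

lemma shift_measurable [measurable (raw)]:
  assumes [measurable]: "a \<in> borel_measurable M" and h: "h \<in> measurable M \<Omega>"
  shows "(\<lambda>z. shift n (a z) (h z)) \<in> measurable M \<Omega>"
proof -
  have "(\<lambda>z. h z n) \<in> measurable M \<kappa>"
    using h unfolding \<Omega>_def by (rule measurable_compose[OF _ measurable_component_singleton]) simp
  then have [measurable]: "(\<lambda>z. h z n) \<in> measurable M (borel \<Otimes>\<^sub>M borel)" by (simp cong: measurable_cong_sets)
  show ?thesis unfolding shift_def by (rule update_measurable[OF h]) measurable
qed

text \<open>\<open>gaussian_shift\<close> is applied with all other coordinates and \<sigma> of the
  n-th one frozen in z, and Fubini then exchanges z and \<rho>. The shift length \<open>s z\<close>
  is of order 1 / sqrt \<sigma>, so it is integrable by the inverse moment.\<close>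

lemma shift_integral:
  assumes [measurable]: "\<Phi> \<in> borel_measurable \<Omega>" and A: "\<And>\<omega>. \<bar>\<Phi> \<omega>\<bar> \<le> A" and r: "0 \<le> r"
  shows "(\<integral>\<omega>. \<Phi> (shift n (r * b n t) \<omega>) \<partial>\<Omega>) - (\<integral>\<omega>. \<Phi> \<omega> \<partial>\<Omega>) =
    (\<integral>\<rho>. indicator {0..r} \<rho> * (\<integral>\<omega>. \<Phi> (shift n (\<rho> * b n t) \<omega>) * w n t (\<omega> n)
        \<partial>\<Omega>) \<partial>lborel)"
proof -
  interpret OM: pair_prob_space \<Omega> \<mu> ..
  interpret OML: pair_sigma_finite "\<Omega> \<Otimes>\<^sub>M \<mu>" lborel ..
  define Q where "Q = \<Omega> \<Otimes>\<^sub>M \<mu>"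
  define s where "s z = b n t / sqrt (2 * snd z)" for z :: "(nat \<Rightarrow> real \<times> real) \<times> real"
  define h where "h z g = \<Phi> ((fst z)(n := (snd z, g)))" for z g
  define G where "G z \<rho> = (\<integral>g. h z (g + \<rho> * s z) * (s z * g) \<partial>N)" for z \<rho>
  have [measurable]: "s \<in> borel_measurable Q" unfolding s_def[abs_def] Q_def by measurable
  have upd [measurable (raw)]: "(\<lambda>x. (fst (f x))(n := (snd (f x), k x))) \<in> measurable M \<Omega>"
    if f: "f \<in> measurable M (\<Omega> \<Otimes>\<^sub>M \<mu>)" and [measurable]: "k \<in> borel_measurable M" for f k and M :: "'z measure"
  proof -
    have "(\<lambda>x. snd (f x)) \<in> measurable M \<mu>" by (rule measurable_compose[OF f measurable_snd])
    then have [measurable]: "(\<lambda>x. snd (f x)) \<in> borel_measurable M" by (simp cong: measurable_cong_sets)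
    show ?thesis
      by (rule update_measurable[OF measurable_compose[OF f measurable_fst]]) measurable
  qed
  have hm [measurable (raw)]: "(\<lambda>x. h (f x) (k x)) \<in> borel_measurable M"
    if "f \<in> measurable M Q" "k \<in> borel_measurable M" for f k and M :: "'z measure"
    unfolding h_def by (rule measurable_compose[OF upd assms(1)]) (use that in \<open>simp_all add: Q_def\<close>)
  have h1: "h z \<in> borel_measurable borel" for z
  proof (cases "z \<in> space Q")
    case True
    then show ?thesis using hm[of "\<lambda>_. z" borel "\<lambda>g. g"] by simp
  next
    case False
    then show ?thesis by (simp add: Q_def space_pair_measure)
  qed
  have hA: "\<bar>h z g\<bar> \<le> A" for z g unfolding h_def by (rule A)
  have sh: "shift n (\<rho> * b n t) ((fst z)(n := (snd z, g))) = (fst z)(n := (snd z, g + \<rho> * s z))" for \<rho> z g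
    by (simp add: shift_def s_def)
  have bounded_int: "integrable \<Omega> f" if "f \<in> borel_measurable \<Omega>" "\<And>\<omega>. \<bar>f \<omega>\<bar> \<le> A" for f
    using that by (intro O.integrable_const_bound[where B=A]) auto
  have m1: "(\<lambda>\<omega>. \<Phi> (shift n a \<omega>)) \<in> borel_measurable \<Omega>" for a by measurable
  have I1: "(\<integral>\<omega>. \<Phi> (shift n (r * b n t) \<omega>) \<partial>\<Omega>) = (\<integral>z. (\<integral>g. h z (g +
      r * s z) \<partial>N) \<partial>Q)"
    using integral_\<Omega>_resample[OF m1 bounded_int[OF m1 A], where n=n] by (simp add: sh h_def Q_def)
  have I2: "(\<integral>\<omega>. \<Phi> \<omega> \<partial>\<Omega>) = (\<integral>z. (\<integral>g. h z g \<partial>N) \<partial>Q)"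
    using integral_\<Omega>_resample[OF assms(1) bounded_int[OF assms(1) A], where n=n] by (simp add: h_def Q_def)
  have I3: "(\<integral>\<omega>. \<Phi> (shift n (\<rho> * b n t) \<omega>) * w n t (\<omega> n) \<partial>\<Omega>) =
      (\<integral>z. G z \<rho> \<partial>Q)" for \<rho>
  proof -
    have "(\<lambda>\<omega>. \<Phi> (shift n (\<rho> * b n t) \<omega>) * w n t (\<omega> n)) \<in> borel_measurable \<Omega>" by measurable
    from integral_\<Omega>_resample[OF this weighted_integrable[OF m1 A], where n=n]
    show ?thesis by (simp add: sh h_def Q_def G_def w_def s_def)
  qed
  interpret Q: prob_space Q unfolding Q_def by (rule OM.prob_space_axioms)
  have int_h: "integrable Q (\<lambda>z. \<integral>g. h z (g + a z) \<partial>N)" if [measurable]: "a \<in> borel_measurable Q" for a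
  proof (rule Q.integrable_const_bound[where B=A])
    have "\<bar>\<integral>g. h z (g + a z) \<partial>N\<bar> \<le> A" for z
    proof -
      have i: "integrable N (\<lambda>g. h z (g + a z))"
        by (rule N.integrable_const_bound[where B=A]) (use h1[of z] hA in auto)
      have "\<bar>\<integral>g. h z (g + a z) \<partial>N\<bar> \<le> (\<integral>g. \<bar>h z (g +
          a z)\<bar> \<partial>N)" by (rule integral_abs_bound)
      also have "\<dots> \<le> (\<integral>g. A \<partial>N)" by (rule integral_mono) (use i hA in auto)
      finally show ?thesis using N.prob_space by simp
    qed
    then show "AE z in Q. norm (\<integral>g. h z (g + a z) \<partial>N) \<le> A" by simp
  qed measurable
  have Gb: "\<bar>G z \<rho>\<bar> \<le> \<bar>A\<bar> * \<bar>s z\<bar> * (\<integral>g. \<bar>g\<bar> \<partial>N)" for z \<rho>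
  proof -
    have Nabs: "integrable N (\<lambda>g. \<bar>g\<bar>)" using N_moments(1) by (rule integrable_abs)
    have le: "\<bar>h z (g + \<rho> * s z) * (s z * g)\<bar> \<le> (\<bar>A\<bar> * \<bar>s z\<bar>) * \<bar>g\<bar>" for g
      unfolding abs_mult mult.assoc using order_trans[OF hA[of z "g + \<rho> * s z"] abs_ge_self[of A]]
      by (rule mult_right_mono) simp
    have i: "integrable N (\<lambda>g. h z (g + \<rho> * s z) * (s z * g))"
    proof (rule Bochner_Integration.integrable_bound[of N "\<lambda>g. (\<bar>A\<bar> * \<bar>s z\<bar>) * \<bar>g\<bar>"])
      show "AE g in N. norm (h z (g + \<rho> * s z) * (s z * g)) \<le> norm ((\<bar>A\<bar> * \<bar>s z\<bar>) * \<bar>g\<bar>)"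
        using le by (intro AE_I2) (simp add: abs_mult)
      show "integrable N (\<lambda>g. (\<bar>A\<bar> * \<bar>s z\<bar>) * \<bar>g\<bar>)" by (intro integrable_mult_right Nabs)
      note [measurable] = h1[of z]
      show "(\<lambda>g. h z (g + \<rho> * s z) * (s z * g)) \<in> borel_measurable N" by measurable
    qed
    have "\<bar>G z \<rho>\<bar> \<le> (\<integral>g. \<bar>h z (g +
        \<rho> * s z) * (s z * g)\<bar> \<partial>N)" unfolding G_def by (rule integral_abs_bound)
    also have "\<dots> \<le> (\<integral>g. (\<bar>A\<bar> * \<bar>s z\<bar>) * \<bar>g\<bar> \<partial>N)"
      by (rule integral_mono) (use i Nabs le in \<open>auto intro: integrable_abs\<close>)
    finally show ?thesis by simp
  qed
  have s_int: "integrable Q (\<lambda>z. \<bar>s z\<bar>)"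
  proof (rule Bochner_Integration.integrable_bound[of Q "\<lambda>z. b n t * (1 + 1 / \<bar>2 * snd z\<bar>)"])
    have "integrable Q (\<lambda>z. 1 / \<bar>2 * snd z\<bar>)"
      unfolding Q_def
    proof (rule OM.Fubini_integrable)
      show "integrable \<Omega> (\<lambda>x. \<integral>y. norm (1 / \<bar>2 * snd (x, y)\<bar>) \<partial>\<mu>)" by simp
      show "AE x in \<Omega>. integrable \<mu> (\<lambda>y. 1 / \<bar>2 * snd (x, y)\<bar>)"
        using inverse_moment(1) by simp
    qed measurable
    then show "integrable Q (\<lambda>z. b n t * (1 + 1 / \<bar>2 * snd z\<bar>))" by simp
    \<comment> \<open>Passes from the mean of 1/\<sigma> to that of its square root.\<close>
    have le: "1 / sqrt y \<le> 1 + 1 / y" if "y \<ge> 0" for y :: real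
    proof (cases "y = 0")
      case False
      have "1 / sqrt y * 1 \<le> ((1 / sqrt y)\<^sup>2 + 1\<^sup>2) / 2"
        using sum_squares_bound[of "1 / sqrt y" 1] by simp
      also have "(1 / sqrt y)\<^sup>2 = 1 / y" using that by (simp add: power_divide)
      finally show ?thesis using that False by (simp add: field_simps)
    qed simp
    have s_le: "\<bar>s z\<bar> \<le> b n t * (1 + 1 / \<bar>2 * snd z\<bar>)" for z
    proof -
      have "\<bar>s z\<bar> = b n t * (1 / sqrt \<bar>2 * snd z\<bar>)"
      proof -
        have "\<bar>sqrt y\<bar> = sqrt \<bar>y\<bar>" for y
          by (cases "0 \<le> y") (simp_all add: real_sqrt_minus)
        then show ?thesis unfolding s_def abs_divide using b_nonneg[of n t] by simp
      qed
      also have "\<dots> \<le> b n t * (1 + 1 / \<bar>2 * snd z\<bar>)"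
        by (intro mult_left_mono le b_nonneg) simp
      finally show ?thesis .
    qed
    show "AE z in Q. norm \<bar>s z\<bar> \<le> norm (b n t * (1 + 1 / \<bar>2 * snd z\<bar>))"
      unfolding real_norm_def abs_idempotent by (intro AE_I2 order_trans[OF s_le abs_ge_self])
  qed measurable
  have Gm [measurable]: "(\<lambda>(z, \<rho>). G z \<rho>) \<in> borel_measurable (Q \<Otimes>\<^sub>M borel)"
    unfolding G_def by measurable
  have int: "integrable (Q \<Otimes>\<^sub>M lborel) (\<lambda>(z, \<rho>). indicator {0..r} \<rho> * G z \<rho>)"
  proof (rule Bochner_Integration.integrable_bound)
    show "integrable (Q \<Otimes>\<^sub>M lborel) (\<lambda>(z, \<rho>). (\<bar>A\<bar> * (\<integral>g. \<bar>g\<bar>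
        \<partial>N) * \<bar>s z\<bar>) * indicator {0..r} \<rho>)"
    proof (rule OML.Fubini_integrable[folded Q_def])
      show "integrable Q (\<lambda>z. \<integral>\<rho>. norm (case (z, \<rho>) of (z, \<rho>) \<Rightarrow> (\<bar>A\<bar> *
          (\<integral>g. \<bar>g\<bar> \<partial>N) * \<bar>s z\<bar>) * indicator {0..r} \<rho>) \<partial>lborel)"
        using s_int r by (simp add: abs_mult)
      show "AE z in Q. integrable lborel (\<lambda>\<rho>. case (z, \<rho>) of (z, \<rho>) \<Rightarrow> (\<bar>A\<bar> *
          (\<integral>g. \<bar>g\<bar> \<partial>N) * \<bar>s z\<bar>) * indicator {0..r} \<rho>)"
        using r by (simp add: integrable_real_indicator)
    qed measurable
    show "AE x in Q \<Otimes>\<^sub>M lborel. norm (case x of (z, \<rho>) \<Rightarrow> indicator {0..r} \<rho> * G z \<rho>)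
      \<le> norm (case x of (z, \<rho>) \<Rightarrow> (\<bar>A\<bar> * (\<integral>g. \<bar>g\<bar>
          \<partial>N) * \<bar>s z\<bar>) * indicator {0..r} \<rho>)"
    proof (intro AE_I2, clarify)
      fix z \<rho>
      have "\<bar>G z \<rho>\<bar> \<le> \<bar>\<bar>A\<bar> * (\<integral>g. \<bar>g\<bar> \<partial>N) * \<bar>s z\<bar>\<bar>"
        using order_trans[OF Gb[of z \<rho>] abs_ge_self] by (simp add: mult_ac)
      then show "norm (indicator {0..r} \<rho> * G z \<rho>) \<le>
          norm ((\<bar>A\<bar> * (\<integral>g. \<bar>g\<bar> \<partial>N) * \<bar>s z\<bar>) * indicator {0..r} \<rho>)"
        by (simp add: indicator_def)
    qed
  qed measurable
  have "(\<integral>\<omega>. \<Phi> (shift n (r * b n t) \<omega>) \<partial>\<Omega>) - (\<integral>\<omega>. \<Phi> \<omega> \<partial>\<Omega>) =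
    (\<integral>z. (\<integral>g. h z (g + r * s z) \<partial>N) - (\<integral>g. h z g \<partial>N) \<partial>Q)"
    unfolding I1 I2 using int_h[of "\<lambda>z. r * s z"] int_h[of "\<lambda>z. 0"] by simp
  also have "\<dots> = (\<integral>z. (\<integral>\<rho>. indicator {0..r} \<rho> * G z \<rho> \<partial>lborel) \<partial>Q)"
    unfolding gaussian_shift[OF h1 hA r] G_def ..
  also have "\<dots> = (\<integral>\<rho>. (\<integral>z. indicator {0..r} \<rho> * G z \<rho> \<partial>Q) \<partial>lborel)"
    by (rule OML.Fubini_integral[folded Q_def, OF int, symmetric])
  also have "\<dots> = (\<integral>\<rho>. indicator {0..r} \<rho> * (\<integral>\<omega>. \<Phi> (shift n
      (\<rho> * b n t) \<omega>) * w n t (\<omega> n) \<partial>\<Omega>) \<partial>lborel)"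
    by (simp only: integral_mult_right_zero I3)
  finally show ?thesis .
qed

lemma X_shift:
  assumes \<omega>: "good \<omega>" "0 < fst (\<omega> n)" and t: "0 < t"
  shows "X t x (shift n (\<rho> * b n t) \<omega>) = X t (x + \<rho> *\<^sub>R e n) \<omega>"
proof -
  let ?\<omega> = "shift n (\<rho> * b n t) \<omega>"
  have "\<forall>\<^sub>F m in sequentially. (d m * Y (?\<omega> m))\<^sup>2 = (d m * Y (\<omega> m))\<^sup>2"
    using eventually_gt_at_top[of n] by eventually_elim (simp add: shift_def)
  \<comment> \<open>Only the n-th term changes, so summability survives the shift.\<close>
  then have good': "good ?\<omega>" using \<omega>(1) unfolding good_def by (subst summable_cong)
  have Yn: "Y (?\<omega> n) = Y (\<omega> n) + \<rho> * b n t"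
    using \<omega>(2) by (simp add: Y_def shift_def distrib_left)
  have b: "\<beta> n * c n t * b n t = exp (- l n * t)"
    using c_pos[OF t, of n] \<beta>_pos[of n] by (simp add: b_def)
  have t0: "0 \<le> t" using t by simp
  have "Z t ?\<omega> = Z t \<omega> + (exp (- l n * t) * \<rho>) *\<^sub>R e n"
  proof (rule orthonormal_basis_eqI[OF basis])
    fix m
    show "Z t ?\<omega> \<bullet> e m = (Z t \<omega> + (exp (- l n * t) * \<rho>) *\<^sub>R e n) \<bullet> e m"
    proof (cases "m = n")
      case True
      have "Z t ?\<omega> \<bullet> e n = \<beta> n * c n t * Y (\<omega> n) + (\<beta> n * c n t * b n t) * \<rho>"
        unfolding Z_inner[OF good' t0] Yn by (simp add: algebra_simps)
      then show ?thesis unfolding b using True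
        by (simp add: inner_add_left Z_inner[OF \<omega>(1) t0] e_inner)
    next
      case False
      then have "?\<omega> m = \<omega> m" by (simp add: shift_def)
      then show ?thesis using False
        by (simp add: inner_add_left Z_inner[OF \<omega>(1) t0] Z_inner[OF good' t0] e_inner)
    qed
  qed
  then show ?thesis
    unfolding X_eq[OF \<omega>(1) t0] X_eq[OF good' t0] E_add_basis[OF t0] by (simp add: add_ac)
qed

lemma P_increment:
  assumes [measurable]: "\<phi> \<in> borel_measurable borel" and A: "\<And>x. \<bar>\<phi> x\<bar> \<le> A" and t: "0 < t" and r: "0 \<le> r"
  shows "P t \<phi> (x + r *\<^sub>R e n) - P t \<phi> x =
    (\<integral>\<rho>. indicator {0..r} \<rho> * (V t \<phi> (x + \<rho> *\<^sub>R e n) \<bullet> e n) \<partial>lborel)"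
proof -
  have ae: "AE \<omega> in \<Omega>. X t x (shift n (\<rho> * b n t) \<omega>) = X t (x + \<rho> *\<^sub>R e n) \<omega>" for \<rho>
    using AE_good AE_\<Omega>_coord[OF AE_\<kappa>_pos, of n] by eventually_elim (rule X_shift[OF _ _ t])
  have 1: "(\<integral>\<omega>. \<phi> (X t x (shift n (r * b n t) \<omega>)) \<partial>\<Omega>) = P t \<phi> (x + r *\<^sub>R e n)"
    unfolding P_def
  proof (rule integral_cong_AE)
    show "AE \<omega> in \<Omega>. \<phi> (X t x (shift n (r * b n t) \<omega>)) = \<phi> (X t (x + r *\<^sub>R e n) \<omega>)"
      using ae[of r] by eventually_elim simp
  qed measurable
  have 2: "(\<integral>\<omega>. \<phi> (X t x (shift n (\<rho> * b n t) \<omega>)) * w n t (\<omega> n) \<partial>\<Omega>) =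
      V t \<phi> (x + \<rho> *\<^sub>R e n) \<bullet> e n" for \<rho>
  proof -
    have m: "(\<lambda>\<omega>. \<phi> (X t (x + \<rho> *\<^sub>R e n) \<omega>)) \<in> borel_measurable \<Omega>" by measurable
    have "V t \<phi> (x + \<rho> *\<^sub>R e n) \<bullet> e n = (\<integral>\<omega>. \<phi> (X t (x +
        \<rho> *\<^sub>R e n) \<omega>) * w n t (\<omega> n) \<partial>\<Omega>)"
      unfolding V_def by (rule W_inner[OF m A t])
    also have "\<dots> = (\<integral>\<omega>. \<phi> (X t x (shift n (\<rho> * b n t) \<omega>)) * w n t (\<omega> n) \<partial>\<Omega>)"
    proof (rule integral_cong_AE)
      show "AE \<omega> in \<Omega>. \<phi> (X t (x + \<rho> *\<^sub>R e n) \<omega>) * w n t (\<omega> n) =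
          \<phi> (X t x (shift n (\<rho> * b n t) \<omega>)) * w n t (\<omega> n)"
        using ae[of \<rho>] by eventually_elim simp
    qed measurable
    finally show ?thesis by simp
  qed
  have m: "(\<lambda>\<omega>. \<phi> (X t x \<omega>)) \<in> borel_measurable \<Omega>" by measurable
  show ?thesis
    using shift_integral[OF m A r, of n t] unfolding 1 2 by (simp add: P_def)
qed

lemma P_GDERIV:
  assumes \<phi>: "continuous_on UNIV \<phi>" and A: "\<And>x. \<bar>\<phi> x\<bar> \<le> A" and t: "0 < t"
  shows "GDERIV (P t \<phi>) x :> V t \<phi> x"
proof (rule GDERIV_from_directional[OF basis])
  have m: "\<phi> \<in> borel_measurable borel" using \<phi> by (rule borel_measurable_continuous_onI)
  show "continuous_on UNIV (V t \<phi>)" by (rule V_continuous[OF \<phi> A t])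
  then show "((\<lambda>r. P t \<phi> (x + r *\<^sub>R e n)) has_real_derivative V t \<phi> x \<bullet> e n) (at 0)" for x n
    by (rule directional_derivative_from_increments) (rule P_increment[OF m A t])
  have "continuous_on UNIV (\<lambda>x. case (t, x) of (t, x) \<Rightarrow> P t \<phi> x)"
    by (rule continuous_on_compose2[OF P_continuous[OF \<phi> A]]) (use t in \<open>auto intro!: continuous_intros\<close>)
  then show "continuous_on UNIV (P t \<phi>)" by simp
qed

lemma P_measurable:
  assumes [measurable]: "(\<lambda>(s, y). \<phi> s y) \<in> borel_measurable (borel \<Otimes>\<^sub>M borel)"
    "f \<in> borel_measurable M" "g \<in> borel_measurable M" "k \<in> borel_measurable M"
  shows "(\<lambda>z. P (f z) (\<phi> (g z)) (k z)) \<in> borel_measurable M"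
  unfolding P_def by measurable

lemma V_measurable:
  assumes [measurable]: "(\<lambda>(s, y). \<phi> s y) \<in> borel_measurable (borel \<Otimes>\<^sub>M borel)"
    "f \<in> borel_measurable M" "g \<in> borel_measurable M" "k \<in> borel_measurable M"
  shows "(\<lambda>z. V (f z) (\<phi> (g z)) (k z)) \<in> borel_measurable M"
proof -
  have [measurable (raw)]: "(\<lambda>z. w n (f z) (h z)) \<in> borel_measurable N'"
    if [measurable]: "f \<in> borel_measurable N'" "h \<in> measurable N' (borel \<Otimes>\<^sub>M borel)" for f h n and N' :: "'z measure"
    unfolding w_def b_def c_def by measurable
  show ?thesis unfolding V_def W_def by measurable
qed

end

section \<open>The law of the Ornstein--Uhlenbeck process\<close>

context ou_model
begin

lemma c_powr: "0 \<le> t \<Longrightarrow> c n t powr \<alpha> = (1 - exp (- (\<alpha> * l n) * t)) / (\<alpha> * l n)"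
  using \<alpha> \<alpha>l_pos[of n] unfolding c_def by (simp only: powr_powr) simp

lemma coordinates_indep: "O.indep_vars (\<lambda>_. \<kappa>) (\<lambda>n \<omega>. \<omega> n) UNIV"
proof -
  have "distr \<Omega> (Pi\<^sub>M UNIV (\<lambda>_. \<kappa>)) (\<lambda>\<omega>. \<lambda>i\<in>UNIV. \<omega> i) =
      distr \<Omega> \<Omega> (\<lambda>\<omega>. \<omega>)"
    by (simp add: \<Omega>_def restrict_UNIV)
  also have "\<dots> = Pi\<^sub>M UNIV (\<lambda>n. distr \<Omega> \<kappa> (\<lambda>\<omega>. \<omega> n))"
  proof -
    have "distr \<Omega> \<kappa> (\<lambda>\<omega>. \<omega> n) = \<kappa>" for n
      unfolding \<Omega>_def by (rule distr_PiM_component) (auto intro: K.prob_space_axioms)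
    then show ?thesis unfolding distr_id2[OF refl] by (simp add: \<Omega>_def)
  qed
  finally show ?thesis
    by (subst O.indep_vars_iff_distr_eq_PiM') (auto simp: \<Omega>_def)
qed

lemma scaled_noise_law:
  "distr \<Omega> (Pi\<^sub>M UNIV (\<lambda>_. borel)) (\<lambda>\<omega> n. c n t * Y (\<omega> n)) =
      Pi\<^sub>M UNIV (\<lambda>n. distr \<kappa> borel (\<lambda>s. c n t * Y s))"
proof -
  have "O.indep_vars (\<lambda>_. borel) (\<lambda>n \<omega>. c n t * Y (\<omega> n)) UNIV"
    by (rule O.indep_vars_compose2[OF coordinates_indep, where Y="\<lambda>n s. c n t * Y s"]) measurable
  then have "distr \<Omega> (Pi\<^sub>M UNIV (\<lambda>_. borel)) (\<lambda>\<omega>. \<lambda>n\<in>UNIV. c n t * Y (\<omega> n)) =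
      Pi\<^sub>M UNIV (\<lambda>n. distr \<Omega> borel (\<lambda>\<omega>. c n t * Y (\<omega> n)))"
    by (subst (asm) O.indep_vars_iff_distr_eq_PiM') auto
  moreover have "distr \<Omega> borel (\<lambda>\<omega>. c n t * Y (\<omega> n)) = distr \<kappa> borel (\<lambda>s. c n t * Y s)" for n
  proof -
    have "distr \<kappa> borel (\<lambda>s. c n t * Y s) =
        distr (distr \<Omega> \<kappa> (\<lambda>\<omega>. \<omega> n)) borel (\<lambda>s. c n t * Y s)"
      unfolding \<Omega>_def using K.prob_space_axioms by (subst distr_PiM_component) auto
    also have "\<dots> = distr \<Omega> borel (\<lambda>\<omega>. c n t * Y (\<omega> n))"
      by (subst distr_distr) (auto simp: o_def \<Omega>_def)
    finally show ?thesis by simp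
  qed
  ultimately show ?thesis by (simp add: restrict_UNIV)
qed

text \<open>The stochastic integrals are almost surely functionals of independent paths, so their
  joint law is a product, and its factors are identified by characteristic functions. The map
  \<open>f\<close> is measurable on all real sequences, also where its series diverges, so equality
  of the laws of the coefficients transfers the expectation; convergence is used only on the model
  space.\<close>

theorem ou_semigroup_eq:
  assumes SB: "stochastic_basis M \<F>" and L: "\<And>n. stable_levy_process M \<F> \<alpha> (ZZ n)"
    and ind: "independent_processes M ZZ" and gen: "semigroup_generated_by D A S"
    and eig: "range e \<subseteq> D" "\<And>n. A (e n) = - l n *\<^sub>R e n"
    and t: "0 \<le> t" and [measurable]: "\<phi> \<in> borel_measurable borel"
  shows "ou_semigroup M ZZ S e l \<beta> t \<phi> x = P t \<phi> x"
proof -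
  interpret PM: prob_space M using SB by (rule stochastic_basis_prob_space)
  define I where "I n = stoch_integral M (ZZ n) (\<lambda>s. exp (- l n * (t - s))) t" for n
  define path where "path n \<omega> = (\<lambda>s\<in>{0..}. ZZ n s \<omega>)" for n \<omega>
  have "\<forall>n. \<exists>\<Phi>. \<Phi> \<in> borel_measurable (Pi\<^sub>M {0..} (\<lambda>_. borel)) \<and> I n \<in> borel_measurable M \<and>
    (AE \<omega> in M. I n \<omega> = \<Phi> (path n \<omega>)) \<and>
    (\<forall>\<xi>. char (distr M borel (\<lambda>\<omega>. \<Phi> (path n \<omega>))) \<xi> =
        of_real (exp (- (c n t powr \<alpha> * \<bar>\<xi>\<bar> powr \<alpha>))))"
    unfolding I_def path_def c_powr[OF t] using stoch_integral_law[OF SB L _ l_pos t] \<alpha> by force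
  from choice[OF this] obtain \<Phi> where \<Phi> [measurable]: "\<And>n. \<Phi> n \<in> borel_measurable (Pi\<^sub>M {0..} (\<lambda>_. borel))"
    and I [measurable]: "\<And>n. I n \<in> borel_measurable M" and ae: "\<And>n. AE \<omega> in M. I n \<omega> = \<Phi> n (path n \<omega>)"
    and ch: "\<And>n \<xi>. char (distr M borel (\<lambda>\<omega>. \<Phi> n (path n \<omega>))) \<xi> =
        of_real (exp (- (c n t powr \<alpha> * \<bar>\<xi>\<bar> powr \<alpha>)))"
    by blast
  have ip: "PM.indep_vars (\<lambda>_. Pi\<^sub>M {0..} (\<lambda>_. borel)) path UNIV"
    using ind by (simp add: independent_processes_def path_def[abs_def])
  then have [measurable]: "path n \<in> measurable M (Pi\<^sub>M {0..} (\<lambda>_. borel))" for n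
    by (simp add: PM.indep_vars_def)
  have law1: "distr M borel (\<lambda>\<omega>. \<Phi> n (path n \<omega>)) = distr \<kappa> borel (\<lambda>s. c n t * Y s)" for n
  proof (rule Levy_uniqueness)
    show "real_distribution (distr M borel (\<lambda>\<omega>. \<Phi> n (path n \<omega>)))"
      by (rule PM.real_distribution_distr) measurable
    show "real_distribution (distr \<kappa> borel (\<lambda>s. c n t * Y s))"
      by (rule K.real_distribution_distr) measurable
    show "char (distr M borel (\<lambda>\<omega>. \<Phi> n (path n \<omega>))) = char (distr \<kappa> borel (\<lambda>s. c n t * Y s))"
    proof
      fix \<xi>
      have "char (distr \<kappa> borel (\<lambda>s. c n t * Y s)) \<xi> = char (distr \<kappa> borel Y) (c n t * \<xi>)"
        unfolding char_def by (subst (1 2) integral_distr) (auto simp: mult_ac)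
      also have "\<dots> = of_real (exp (- (c n t powr \<alpha> * \<bar>\<xi>\<bar> powr \<alpha>)))"
        unfolding Y_char using c_nonneg[of n t] by (simp add: abs_mult powr_mult)
      finally show "char (distr M borel (\<lambda>\<omega>. \<Phi> n (path n \<omega>))) \<xi> =
          char (distr \<kappa> borel (\<lambda>s. c n t * Y s)) \<xi>"
        by (simp add: ch)
    qed
  qed
  have "PM.indep_vars (\<lambda>_. borel) (\<lambda>n \<omega>. \<Phi> n (path n \<omega>)) UNIV"
    by (rule PM.indep_vars_compose2[OF ip]) (rule \<Phi>)
  then have "distr M (Pi\<^sub>M UNIV (\<lambda>_. borel)) (\<lambda>\<omega>. \<lambda>n\<in>UNIV. \<Phi> n (path n \<omega>)) =
      Pi\<^sub>M UNIV (\<lambda>n. distr M borel (\<lambda>\<omega>. \<Phi> n (path n \<omega>)))"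
    by (subst (asm) PM.indep_vars_iff_distr_eq_PiM') auto
  then have law: "distr M (Pi\<^sub>M UNIV (\<lambda>_. borel)) (\<lambda>\<omega> n. \<Phi> n (path n \<omega>)) =
    distr \<Omega> (Pi\<^sub>M UNIV (\<lambda>_. borel)) (\<lambda>\<omega> n. c n t * Y (\<omega> n))"
    by (simp add: law1 scaled_noise_law restrict_UNIV)
  define f where "f y = \<phi> (E t x + (\<Sum>n. (\<beta> n * y n) *\<^sub>R e n))" for y :: "nat \<Rightarrow> real"
  have fm: "f \<in> borel_measurable (Pi\<^sub>M UNIV (\<lambda>_. borel))"
    unfolding f_def[abs_def] by measurable
  have St: "S t x = E t x"
    unfolding E_def by (rule semigroup_expansion[OF basis gen eig t])
  have "ou_semigroup M ZZ S e l \<beta> t \<phi> x = (\<integral>\<omega>. f (\<lambda>n. I n \<omega>) \<partial>M)"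
    unfolding ou_semigroup_def ou_process_def f_def I_def St ..
  also have "\<dots> = (\<integral>\<omega>. f (\<lambda>n. \<Phi> n (path n \<omega>)) \<partial>M)"
  proof (rule integral_cong_AE)
    have "AE \<omega> in M. \<forall>n. I n \<omega> = \<Phi> n (path n \<omega>)" using ae by (simp add: AE_all_countable)
    then show "AE \<omega> in M. f (\<lambda>n. I n \<omega>) = f (\<lambda>n. \<Phi> n (path n \<omega>))"
      by eventually_elim simp
    show "(\<lambda>\<omega>. f (\<lambda>n. I n \<omega>)) \<in>
        borel_measurable M" "(\<lambda>\<omega>. f (\<lambda>n. \<Phi> n (path n \<omega>))) \<in> borel_measurable M"
      unfolding f_def by measurable
  qed
  also have "\<dots> = (\<integral>y. f y \<partial>distr M (Pi\<^sub>M UNIV (\<lambda>_. borel)) (\<lambda>\<omega> n. \<Phi> n (path n \<omega>)))"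
    by (rule integral_distr[symmetric, OF _ fm]) (rule measurable_PiM_single', auto)
  also have "\<dots> = (\<integral>\<omega>. f (\<lambda>n. c n t * Y (\<omega> n)) \<partial>\<Omega>)"
    unfolding law by (rule integral_distr[OF _ fm]) (rule measurable_PiM_single', auto)
  also have "\<dots> = P t \<phi> x"
    unfolding P_def
  proof (rule integral_cong_AE)
    show "AE \<omega> in \<Omega>. f (\<lambda>n. c n t * Y (\<omega> n)) = \<phi> (X t x \<omega>)"
      using AE_good by eventually_elim (simp add: f_def X_eq[OF _ t] Z_def mult.assoc)
    show "(\<lambda>\<omega>. f (\<lambda>n. c n t * Y (\<omega> n))) \<in> borel_measurable \<Omega>"
      unfolding f_def by measurable
  qed measurable
  finally show ?thesis .
qed

end

section \<open>The fixed point of the gradient equation\<close>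

text \<open>The properties of the transition semigroup on which the fixed point argument rests.
  Linearity of V is replaced by the difference estimate \<open>V_diff\<close>, which with
  \<open>V_zero\<close> also bounds V. The constant L is uniform in x.\<close>

locale smoothing =
  fixes P :: "real \<Rightarrow> ('h::{real_inner, banach, polish_space} \<Rightarrow> real) \<Rightarrow> 'h \<Rightarrow> real"
    and V :: "real \<Rightarrow> ('h \<Rightarrow> real) \<Rightarrow> 'h \<Rightarrow> 'h"
    and H :: "'h \<Rightarrow> 'h \<Rightarrow> real" and h :: "'h \<Rightarrow> real" and K \<gamma> T L G A :: real
  assumes \<gamma>: "0 < \<gamma>" "\<gamma> < 1" and T: "0 < T" and K: "0 \<le> K"
    and P_bound: "\<And>t \<phi> B x. continuous_on UNIV \<phi> \<Longrightarrow> (\<And>x. \<bar>\<phi> x\<bar> \<le>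
        B) \<Longrightarrow> \<bar>P t \<phi> x\<bar> \<le> B"
    and P_cont: "\<And>\<phi> B. continuous_on UNIV \<phi> \<Longrightarrow> (\<And>x. \<bar>\<phi> x\<bar> \<le> B) \<Longrightarrow>
      continuous_on ({0..} \<times> UNIV) (\<lambda>(t, x). P t \<phi> x)"
    and P_GDERIV: "\<And>t \<phi> B x. continuous_on UNIV \<phi> \<Longrightarrow> (\<And>x. \<bar>\<phi> x\<bar> \<le>
        B) \<Longrightarrow> 0 < t \<Longrightarrow>
      GDERIV (P t \<phi>) x :> V t \<phi> x"
    and V_cont: "\<And>t \<phi> B. continuous_on UNIV \<phi> \<Longrightarrow> (\<And>x. \<bar>\<phi> x\<bar> \<le>
        B) \<Longrightarrow> 0 < t \<Longrightarrow> continuous_on UNIV (V t \<phi>)"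
    and V_diff: "\<And>t \<phi> \<psi> B B' b x. continuous_on UNIV \<phi> \<Longrightarrow> (\<And>x. \<bar>\<phi> x\<bar> \<le> B) \<Longrightarrow>
      continuous_on UNIV \<psi> \<Longrightarrow> (\<And>x. \<bar>\<psi> x\<bar> \<le> B') \<Longrightarrow> (\<And>x. \<bar>\<phi> x
          - \<psi> x\<bar> \<le> b) \<Longrightarrow> 0 < t \<Longrightarrow>
      norm (V t \<phi> x - V t \<psi> x) \<le> K * t powr (- \<gamma>) * b"
    and V_zero: "\<And>t x. V t (\<lambda>_. 0) x = 0"
    and P_meas: "\<And>\<phi> :: real \<Rightarrow> 'h \<Rightarrow> real. (\<lambda>(s, y). \<phi> s y) \<in>
        borel_measurable (borel \<Otimes>\<^sub>M borel) \<Longrightarrow>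
      (\<lambda>(t, s, x). P t (\<phi> s) x) \<in> borel_measurable (borel \<Otimes>\<^sub>M borel \<Otimes>\<^sub>M borel)"
    and V_meas: "\<And>\<phi> :: real \<Rightarrow> 'h \<Rightarrow> real. (\<lambda>(s, y). \<phi> s y) \<in>
        borel_measurable (borel \<Otimes>\<^sub>M borel) \<Longrightarrow>
      (\<lambda>(t, s, x). V t (\<phi> s) x) \<in> borel_measurable (borel \<Otimes>\<^sub>M borel \<Otimes>\<^sub>M borel)"
    and H_cont: "continuous_on UNIV (\<lambda>z. H (fst z) (snd z))"
    and H_lip: "\<And>x p q. \<bar>H x p - H x q\<bar> \<le> L * norm (p - q)" and L: "0 \<le> L"
    and H_bound: "\<And>x. \<bar>H x 0\<bar> \<le> G"
    and h: "continuous_on UNIV h" "\<And>x. \<bar>h x\<bar> \<le> A"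
begin

lemma G: "0 \<le> G" using H_bound[of 0] by linarith
lemma A: "0 \<le> A" using h(2)[of 0] by linarith

text \<open>
  The kernel \<open>k t\<close> below arises from two singularities: the smoothing estimate at time \<open>t - s\<close> and the
  bound on the gradient at time \<open>s\<close>. In the weighted norm its integral is controlled by \<open>g \<theta>\<close>,
  which becomes small for large \<open>\<theta>\<close>.
\<close>

definition p :: "real \<Rightarrow> real \<Rightarrow> real" where
  "p \<theta> r = indicator {0<..T} r * (r powr (- \<gamma>) * exp (- \<theta> * r))"

definition g :: "real \<Rightarrow> real" where "g \<theta> = (\<integral>r. p \<theta> r \<partial>lborel)"

lemma p_measurable [measurable]: "p \<theta> \<in> borel_measurable borel"
  unfolding p_def[abs_def] by measurable

lemma p_nonneg: "0 \<le> p \<theta> r" by (simp add: p_def)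

lemma p_zero_integrable: "integrable lborel (p 0)"
proof -
  have "(\<lambda>x. x powr (- \<gamma>)) integrable_on {0..T}"
    using \<gamma> T by (intro integrable_on_powr_from_0) auto
  then have "(\<lambda>x. x powr (- \<gamma>)) absolutely_integrable_on {0..T}"
    by (rule nonnegative_absolutely_integrable_1) simp
  then have "integrable (completion lborel) (\<lambda>x. indicator {0..T} x *\<^sub>R x powr (- \<gamma>))"
    by (simp add: set_integrable_def)
  then have "integrable lborel (\<lambda>x. indicator {0..T} x *\<^sub>R x powr (- \<gamma>))"
    by (subst (asm) integrable_completion) auto
  moreover have "indicator {0..T} x *\<^sub>R x powr (- \<gamma>) = p 0 x" for x
    by (cases "x = 0") (auto simp: p_def indicator_def)
  ultimately show ?thesis by simp
qed

lemma p_le: "0 \<le> \<theta> \<Longrightarrow> p \<theta> r \<le> p 0 r"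
  unfolding p_def by (auto simp: indicator_def intro!: mult_left_le)

lemma p_integrable: "0 \<le> \<theta> \<Longrightarrow> integrable lborel (p \<theta>)"
  by (rule Bochner_Integration.integrable_bound[OF p_zero_integrable]) (use p_nonneg p_le in auto)

lemma g_tendsto: "(\<lambda>n. g (real n)) \<longlonglongrightarrow> 0"
proof -
  have "(\<lambda>n. \<integral>r. p (real n) r \<partial>lborel) \<longlonglongrightarrow>
      (\<integral>r. (0 :: real) \<partial>(lborel :: real measure))"
  proof (rule integral_dominated_convergence[OF _ _ p_zero_integrable])
    show "AE r in lborel. (\<lambda>n. p (real n) r) \<longlonglongrightarrow> 0"
    proof (rule AE_I2)
      fix r :: real
      show "(\<lambda>n. p (real n) r) \<longlonglongrightarrow> 0"
      proof (cases "r \<in> {0<..T}")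
        case True
        have "filterlim (\<lambda>n. r * real n) at_top sequentially"
          using True by (intro filterlim_tendsto_pos_mult_at_top[OF tendsto_const _ filterlim_real_sequentially]) auto
        then have "(\<lambda>n. exp (- (r * real n))) \<longlonglongrightarrow> 0"
          by (intro filterlim_compose[OF exp_at_bot]) (simp add: filterlim_uminus_at_bot)
        then have "(\<lambda>n. r powr (- \<gamma>) * exp (- (r * real n))) \<longlonglongrightarrow> r powr (- \<gamma>) * 0"
          by (intro tendsto_intros)
        then show ?thesis using True by (simp add: p_def mult.commute)
      qed (simp add: p_def)
    qed
    show "AE r in lborel. norm (p (real n) r) \<le> p 0 r" for n
      using p_nonneg p_le by (intro AE_I2) simp
  qed auto
  then show ?thesis by (simp add: g_def)
qed

definition k :: "real \<Rightarrow> real \<Rightarrow> real" where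
  "k t s = indicator {0<..<t} s * ((t - s) powr (- \<gamma>) * s powr (- \<gamma>))"

lemma k_measurable [measurable]: "k t \<in> borel_measurable borel"
  unfolding k_def[abs_def] by measurable

lemma k_nonneg: "0 \<le> k t s" by (simp add: k_def)

text \<open>Put r = t - s. The larger of s and r is at least t / 2, so t powr \<gamma> cancels its
  singularity up to a factor 2. Since exp (\<theta> s) = exp (\<theta> t) exp (- \<theta> r), a
  decaying factor in r remains; it may be traded for one in s when s <= r.\<close>

lemma k_le:
  assumes "0 < t" "t \<le> T" and \<theta>: "0 \<le> \<theta>"
  shows "k t s * exp (\<theta> * s) \<le> 4 * t powr (- \<gamma>) * exp (\<theta> * t) * (p \<theta> s + p \<theta> (t - s))"
proof (cases "s \<in> {0<..<t}")
  case True
  define r where "r = t - s"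
  have s: "0 < s" "0 < r" "s \<le> T" "r \<le> T" and t: "t = s + r" using True assms by (auto simp: r_def)
  have main: "(s + r) powr \<gamma> * (r powr (- \<gamma>) * s powr (- \<gamma>)) * exp (- \<theta> * r) \<le>
      4 * (s powr (- \<gamma>) * exp (- \<theta> * s) + r powr (- \<gamma>) * exp (- \<theta> * r))"
  proof (cases "s \<le> r")
    case True
    have "(s + r) powr \<gamma> \<le> (2 * r) powr \<gamma>" using True s \<gamma> by (intro powr_mono2) auto
    also have "\<dots> = 2 powr \<gamma> * r powr \<gamma>" using s by (simp add: powr_mult)
    also have "\<dots> \<le> 2 * r powr \<gamma>" using powr_mono[of \<gamma> 1 2] \<gamma> by (intro mult_right_mono) auto
    finally have "(s + r) powr \<gamma> * (r powr (- \<gamma>) * s powr (- \<gamma>)) \<le>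
        2 * r powr \<gamma> * (r powr (- \<gamma>) * s powr (- \<gamma>))"
      by (rule mult_right_mono) simp
    also have "\<dots> = 2 * s powr (- \<gamma>)" using s by (simp add: powr_minus field_simps)
    finally have "(s + r) powr \<gamma> * (r powr (- \<gamma>) * s powr (- \<gamma>)) * exp (- \<theta> * r) \<le>
        2 * s powr (- \<gamma>) * exp (- \<theta> * r)"
      by (rule mult_right_mono) simp
    also have "\<dots> \<le> 2 * s powr (- \<gamma>) * exp (- \<theta> * s)"
      using True \<theta> by (intro mult_left_mono) (auto intro: mult_left_mono)
    also have "\<dots> \<le> 4 * (s powr (- \<gamma>) * exp (- \<theta> * s) + r powr (- \<gamma>) * exp (- \<theta> * r))" by simp
    finally show ?thesis .
  next
    case False
    have "(s + r) powr \<gamma> \<le> (2 * s) powr \<gamma>" using False s \<gamma> by (intro powr_mono2) auto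
    also have "\<dots> = 2 powr \<gamma> * s powr \<gamma>" using s by (simp add: powr_mult)
    also have "\<dots> \<le> 2 * s powr \<gamma>" using powr_mono[of \<gamma> 1 2] \<gamma> by (intro mult_right_mono) auto
    finally have "(s + r) powr \<gamma> * (r powr (- \<gamma>) * s powr (- \<gamma>)) \<le>
        2 * s powr \<gamma> * (r powr (- \<gamma>) * s powr (- \<gamma>))"
      by (rule mult_right_mono) simp
    also have "\<dots> = 2 * r powr (- \<gamma>)" using s by (simp add: powr_minus field_simps)
    finally have "(s + r) powr \<gamma> * (r powr (- \<gamma>) * s powr (- \<gamma>)) * exp (- \<theta> * r) \<le>
        2 * r powr (- \<gamma>) * exp (- \<theta> * r)"
      by (rule mult_right_mono) simp
    also have "\<dots> \<le> 4 * (s powr (- \<gamma>) * exp (- \<theta> * s) + r powr (- \<gamma>) * exp (- \<theta> * r))" by simp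
    finally show ?thesis .
  qed
  have "k t s * exp (\<theta> * s) = t powr (- \<gamma>) * exp (\<theta> * t) * (t powr \<gamma> * (r powr (- \<gamma>) * s powr
      (- \<gamma>)) * exp (- \<theta> * r))"
  proof -
    have "t powr (- \<gamma>) * t powr \<gamma> = 1" using s t by (simp add: powr_minus)
    moreover have "exp (\<theta> * t) * exp (- \<theta> * r) = exp (\<theta> * s)" by (simp add: exp_add[symmetric] r_def algebra_simps)
    moreover have "k t s = r powr (- \<gamma>) * s powr (- \<gamma>)" using True by (simp add: k_def r_def)
    moreover have "t powr (- \<gamma>) * exp (\<theta> * t) * (t powr \<gamma> * (r powr (- \<gamma>) * s powr (- \<gamma>)) * exp (- \<theta> * r)) =
      (t powr (- \<gamma>) * t powr \<gamma>) * ((r powr (- \<gamma>) * s powr (- \<gamma>)) * (exp (\<theta> * t) * exp (- \<theta> * r)))"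
      by (simp only: mult_ac)
    ultimately show ?thesis by (simp only: mult_1)
  qed
  also have "\<dots> \<le> t powr (- \<gamma>) * exp (\<theta> * t) * (4 * (s powr (- \<gamma>) * exp (- \<theta> * s) +
      r powr (- \<gamma>) * exp (- \<theta> * r)))"
    using main unfolding t[symmetric] by (intro mult_left_mono) auto
  also have "s powr (- \<gamma>) * exp (- \<theta> * s) = p \<theta> s" using s by (simp add: p_def)
  also have "r powr (- \<gamma>) * exp (- \<theta> * r) = p \<theta> (t - s)" using s by (simp add: p_def r_def)
  finally show ?thesis by (simp add: algebra_simps)
next
  case False
  then show ?thesis using p_nonneg[of \<theta> s] p_nonneg[of \<theta> "t - s"] by (simp add: k_def)
qed

lemma p_reflect: "integrable lborel (p \<theta>) \<Longrightarrow> integrable lborel (\<lambda>s. p \<theta> (t - s))"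
  "(\<integral>s. p \<theta> (t - s) \<partial>lborel) = g \<theta>"
  using lborel_integrable_real_affine[of "p \<theta>" "-1" t] lborel_integral_real_affine[of "-1" "p \<theta>" t]
  by (simp_all add: g_def)

lemma k_integrable:
  assumes "0 < t" "t \<le> T" "0 \<le> \<theta>"
  shows "integrable lborel (\<lambda>s. k t s * exp (\<theta> * s))"
proof (rule Bochner_Integration.integrable_bound)
  show "integrable lborel (\<lambda>s. 4 * t powr (- \<gamma>) * exp (\<theta> * t) * (p \<theta> s + p \<theta> (t - s)))"
    by (intro integrable_mult_right Bochner_Integration.integrable_add p_reflect p_integrable assms)
  show "AE s in lborel. norm (k t s * exp (\<theta> * s)) \<le> norm (4 * t powr (- \<gamma>) * exp (\<theta> * t) * (p \<theta> s +
      p \<theta> (t - s)))"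
  proof (rule AE_I2)
    fix s
    have "norm (k t s * exp (\<theta> * s)) = k t s * exp (\<theta> * s)" using k_nonneg[of t s] by simp
    also have "\<dots> \<le> 4 * t powr (- \<gamma>) * exp (\<theta> * t) * (p \<theta> s + p \<theta> (t - s))" by (rule k_le[OF assms])
    also have "\<dots> \<le> norm \<dots>" by simp
    finally show "norm (k t s * exp (\<theta> * s)) \<le> norm (4 * t powr (- \<gamma>) * exp (\<theta> * t) * (p \<theta> s + p \<theta> (t - s)))" .
  qed
qed measurable

text \<open>Both summands of \<open>k_le\<close>, one of them reflected, integrate to g \<theta>,
  whence 8 = 2 * 4.\<close>

lemma k_integral:
  assumes "0 < t" "t \<le> T" "0 \<le> \<theta>"
  shows "(\<integral>s. k t s * exp (\<theta> * s) \<partial>lborel) \<le> 8 * g \<theta> * (t powr (- \<gamma>) * exp (\<theta> * t))"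
proof -
  have "(\<integral>s. k t s * exp (\<theta> * s) \<partial>lborel) \<le>
      (\<integral>s. 4 * t powr (- \<gamma>) * exp (\<theta> * t) * (p \<theta> s + p \<theta> (t - s)) \<partial>lborel)"
    by (intro integral_mono k_integrable k_le integrable_mult_right Bochner_Integration.integrable_add p_reflect p_integrable assms)
  also have "\<dots> = 8 * g \<theta> * (t powr (- \<gamma>) * exp (\<theta> * t))"
    by (simp add: p_integrable[OF assms(3)] p_reflect g_def[symmetric])
  finally show ?thesis .
qed

lemma g_nonneg: "0 \<le> g \<theta>"
  unfolding g_def by (rule Bochner_Integration.integral_nonneg) (rule p_nonneg)

section \<open>Admissible gradients and the gradient map\<close>

text \<open>The candidate gradients. The bound B is a parameter because each iterate comes with its
  own. Joint measurability is required on all times so that the time integrals make sense.\<close>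

definition adm :: "real \<Rightarrow> (real \<Rightarrow> 'h \<Rightarrow> 'h) \<Rightarrow> bool" where
  "adm B w \<longleftrightarrow> 0 \<le> B \<and> (\<lambda>(s, y). w s y) \<in> borel_measurable (borel \<Otimes>\<^sub>M borel) \<and>
     (\<forall>s\<in>{0<..T}. continuous_on UNIV (w s)) \<and> (\<forall>s\<in>{0<..T}. \<forall>y. norm (w s y) \<le> B * s powr (- \<gamma>))"

text \<open>The Hamiltonian along a candidate gradient, not the drift of the equation.\<close>

definition F :: "(real \<Rightarrow> 'h \<Rightarrow> 'h) \<Rightarrow> real \<Rightarrow> 'h \<Rightarrow> real" where "F w s y = H y (w s y)"

lemma F_measurable [measurable]:
  assumes "adm B w"
  shows "(\<lambda>(s, y). F w s y) \<in> borel_measurable (borel \<Otimes>\<^sub>M borel)"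
proof -
  have [measurable]: "(\<lambda>z. w (fst z) (snd z)) \<in> borel_measurable (borel \<Otimes>\<^sub>M borel)"
    using assms by (simp add: adm_def case_prod_beta')
  have "(\<lambda>z. H (snd z) (w (fst z) (snd z))) \<in> borel_measurable (borel \<Otimes>\<^sub>M borel)"
    by (rule borel_measurable_continuous_Pair[OF _ _ H_cont]) measurable
  then show ?thesis by (simp add: F_def case_prod_beta')
qed

lemma F_continuous:
  assumes "adm B w" "0 < s" "s \<le> T"
  shows "continuous_on UNIV (F w s)"
proof -
  have "continuous_on UNIV (w s)" using assms by (simp add: adm_def)
  then have "continuous_on UNIV (\<lambda>y. (y, w s y))" by (intro continuous_intros)
  from continuous_on_compose2[OF H_cont this] show ?thesis by (simp add: F_def[abs_def])
qed

definition cB :: "real \<Rightarrow> real" where "cB B = G * T powr \<gamma> + L * B"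

lemma cB_nonneg: "0 \<le> B \<Longrightarrow> 0 \<le> cB B" using G L by (simp add: cB_def)

text \<open>The constant G is absorbed into the singular bound, since T powr \<gamma> * s powr (-
  \<gamma>) >= 1 for s <= T.\<close>

lemma F_bound:
  assumes "adm B w" "0 < s" "s \<le> T"
  shows "\<bar>F w s y\<bar> \<le> cB B * s powr (- \<gamma>)"
proof -
  have "\<bar>F w s y\<bar> \<le> G + L * norm (w s y)"
    using H_lip[of y "w s y" 0] H_bound[of y] unfolding F_def by simp
  also have "L * norm (w s y) \<le> L * (B * s powr (- \<gamma>))"
    using assms L by (intro mult_left_mono) (auto simp: adm_def)
  also have "G \<le> G * (T powr \<gamma> * s powr (- \<gamma>))"
  proof -
    have "1 = s powr \<gamma> * s powr (- \<gamma>)" using assms by (simp add: powr_minus)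
    also have "\<dots> \<le> T powr \<gamma> * s powr (- \<gamma>)"
      using assms \<gamma> by (intro mult_right_mono powr_mono2) auto
    finally show ?thesis using G by (simp add: mult_le_cancel_left1)
  qed
  finally show ?thesis by (simp add: cB_def algebra_simps)
qed

lemma F_diff:
  assumes "norm (w s y - w' s y) \<le> b"
  shows "\<bar>F w s y - F w' s y\<bar> \<le> L * b"
  unfolding F_def by (rule order_trans[OF H_lip mult_left_mono[OF assms L]])

lemma V_bound:
  assumes "continuous_on UNIV \<phi>" "\<And>x. \<bar>\<phi> x\<bar> \<le> b" "0 < t"
  shows "norm (V t \<phi> x) \<le> K * t powr (- \<gamma>) * b"
  using V_diff[of \<phi> b "\<lambda>_. 0" 0 b t x] assms by (simp add: V_zero)

abbreviation Vs :: "(real \<Rightarrow> 'h \<Rightarrow> 'h) \<Rightarrow> real \<Rightarrow> 'h \<Rightarrow> real \<Rightarrow> 'h" where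
  "Vs w t x s \<equiv> indicator {0<..<t} s *\<^sub>R V (t - s) (F w s) x"

abbreviation Ps :: "(real \<Rightarrow> 'h \<Rightarrow> 'h) \<Rightarrow> real \<Rightarrow> 'h \<Rightarrow> real \<Rightarrow> real" where
  "Ps w t x s \<equiv> indicator {0<..<t} s *\<^sub>R P (t - s) (F w s) x"

definition VI :: "(real \<Rightarrow> 'h \<Rightarrow> 'h) \<Rightarrow> real \<Rightarrow> 'h \<Rightarrow> 'h" where
  "VI w t x = (\<integral>s. Vs w t x s \<partial>lborel)"

definition PI :: "(real \<Rightarrow> 'h \<Rightarrow> 'h) \<Rightarrow> real \<Rightarrow> 'h \<Rightarrow> real" where
  "PI w t x = (\<integral>s. Ps w t x s \<partial>lborel)"

text \<open>
  The gradient of the right-hand side of the mild equation, as a function of the gradient \<open>w\<close> of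
  the unknown.
\<close>

definition \<Gamma> :: "(real \<Rightarrow> 'h \<Rightarrow> 'h) \<Rightarrow> real \<Rightarrow> 'h \<Rightarrow> 'h" where
  "\<Gamma> w t x = (if t \<in> {0<..T} then V t h x + VI w t x else 0)"

lemma VI_integrand_measurable:
  assumes "adm B w"
  shows "(\<lambda>((t, x), s). Vs w t x s) \<in> borel_measurable ((borel \<Otimes>\<^sub>M borel) \<Otimes>\<^sub>M borel)"
proof -
  have "(\<lambda>z. (fst (fst z) - snd z, snd z, snd (fst z))) \<in>
      measurable ((borel \<Otimes>\<^sub>M borel) \<Otimes>\<^sub>M borel) (borel \<Otimes>\<^sub>M (borel :: real measure)
          \<Otimes>\<^sub>M (borel :: 'h measure))"
    by measurable
  from measurable_compose[OF this V_meas[OF F_measurable[OF assms]]]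
  have [measurable]: "(\<lambda>z. V (fst (fst z) - snd z) (F w (snd z)) (snd (fst z))) \<in>
      borel_measurable ((borel \<Otimes>\<^sub>M borel) \<Otimes>\<^sub>M borel)"
    by simp
  have [measurable]: "Measurable.pred (((borel :: real measure) \<Otimes>\<^sub>M (borel :: 'h measure)) \<Otimes>\<^sub>M borel)
      (\<lambda>z. snd z \<in> {0<..<fst (fst z)})"
    unfolding greaterThanLessThan_iff by measurable
  show ?thesis unfolding case_prod_beta' by measurable
qed

lemma PI_integrand_measurable:
  assumes "adm B w"
  shows "(\<lambda>s. Ps w t x s) \<in> borel_measurable borel"
    and "(\<lambda>s. P (t - s) (F w s) x) \<in> borel_measurable borel"
proof -
  have "(\<lambda>s. (t - s, s, x)) \<in> measurable borel (borel \<Otimes>\<^sub>M (borel :: real measure) \<Otimes>\<^sub>M (borel :: 'h measure))"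
    by measurable
  from measurable_compose[OF this P_meas[OF F_measurable[OF assms]]]
  show [measurable]: "(\<lambda>s. P (t - s) (F w s) x) \<in> borel_measurable borel" by simp
  show "(\<lambda>s. Ps w t x s) \<in> borel_measurable borel"
    by measurable
qed

lemma VI_integrand_measurable':
  assumes "adm B w"
  shows "(\<lambda>s. Vs w t x s) \<in> borel_measurable borel"
proof -
  have "(\<lambda>s. ((t, x), s)) \<in> measurable borel ((borel \<Otimes>\<^sub>M borel) \<Otimes>\<^sub>M borel)" by measurable
  from measurable_compose[OF this VI_integrand_measurable[OF assms]] show ?thesis by simp
qed

lemma VI_integrand_bound:
  assumes w: "adm B w" and t: "0 < t" "t \<le> T"
  shows "norm (Vs w t x s) \<le> K * cB B * k t s"
proof (cases "s \<in> {0<..<t}")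
  case True
  then have "norm (V (t - s) (F w s) x) \<le> K * (t - s) powr (- \<gamma>) * (cB B * s powr (- \<gamma>))"
    using t by (intro V_bound F_continuous[OF w] F_bound[OF w]) auto
  then show ?thesis using True by (simp add: k_def mult_ac)
next
  case False
  then show ?thesis using K cB_nonneg w k_nonneg[of t s] by (simp add: adm_def)
qed

lemma VI_integrable:
  assumes w: "adm B w" and t: "0 < t" "t \<le> T"
  shows "integrable lborel (\<lambda>s. Vs w t x s)"
proof (rule Bochner_Integration.integrable_bound[where f="\<lambda>s. K * cB B * (k t s * exp (0 * s))"])
  show "integrable lborel (\<lambda>s. K * cB B * (k t s * exp (0 * s)))"
    by (intro integrable_mult_right k_integrable t order_refl)
  show "AE s in lborel. norm (Vs w t x s) \<le> norm (K * cB B * (k t s * exp (0 * s)))"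
    using order_trans[OF VI_integrand_bound[OF w t] abs_ge_self] by (intro AE_I2) simp
qed (use VI_integrand_measurable'[OF w] in simp)

lemma VI_bound:
  assumes w: "adm B w" and t: "0 < t" "t \<le> T"
  shows "norm (VI w t x) \<le> K * cB B * (8 * g 0) * t powr (- \<gamma>)"
proof -
  have "norm (VI w t x) \<le> (\<integral>s. K * cB B * (k t s * exp (0 * s)) \<partial>lborel)"
    unfolding VI_def
  proof (rule Bochner_Integration.integral_norm_bound_integral[OF VI_integrable[OF w t]])
    show "integrable lborel (\<lambda>s. K * cB B * (k t s * exp (0 * s)))"
      by (intro integrable_mult_right k_integrable t order_refl)
  qed (use VI_integrand_bound[OF w t] in simp)
  also have "\<dots> = K * cB B * (\<integral>s. k t s * exp (0 * s) \<partial>lborel)" by (rule integral_mult_right_zero)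
  also have "\<dots> \<le> K * cB B * (8 * g 0 * (t powr (- \<gamma>) * exp (0 * t)))"
    using K cB_nonneg w by (intro mult_left_mono k_integral t order_refl) (auto simp: adm_def)
  finally show ?thesis by (simp add: mult_ac)
qed

text \<open>The kernel \<open>k t\<close> dominates the integrand uniformly in x, so continuity of V
  in space passes through the integral.\<close>

lemma VI_continuous:
  assumes w: "adm B w" and t: "0 < t" "t \<le> T"
  shows "continuous_on UNIV (VI w t)"
  unfolding continuous_on_sequentially
proof (intro ballI allI impI)
  fix z and a :: 'h assume z: "(\<forall>n. z n \<in> UNIV) \<and> z \<longlonglongrightarrow> a"
  have "(\<lambda>n. VI w t (z n)) \<longlonglongrightarrow> VI w t a"
    unfolding VI_def
  proof (rule integral_dominated_convergence[where w="\<lambda>s. K * cB B * (k t s * exp (0 * s))"])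
    show "integrable lborel (\<lambda>s. K * cB B * (k t s * exp (0 * s)))"
      by (intro integrable_mult_right k_integrable t order_refl)
    show "AE s in lborel. (\<lambda>n. Vs w t (z n) s) \<longlonglongrightarrow> Vs w t a s"
    proof (rule AE_I2)
      fix s
      show "(\<lambda>n. Vs w t (z n) s) \<longlonglongrightarrow> Vs w t a s"
      proof (cases "s \<in> {0<..<t}")
        case True
        then have "continuous_on UNIV (V (t - s) (F w s))"
          using t by (intro V_cont[OF F_continuous[OF w] F_bound[OF w]]) auto
        then have "(\<lambda>n. V (t - s) (F w s) (z n)) \<longlonglongrightarrow> V (t - s) (F w s) a"
          using z by (auto simp: continuous_on_sequentially o_def)
        then show ?thesis by (intro tendsto_intros)
      qed simp
    qed
    show "AE s in lborel. norm (Vs w t (z n) s) \<le> K * cB B * (k t s * exp (0 * s))" for n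
      using VI_integrand_bound[OF w t] by (intro AE_I2) simp
  qed (use VI_integrand_measurable'[OF w] in simp_all)
  then show "(VI w t \<circ> z) \<longlonglongrightarrow> VI w t a" by (simp add: o_def)
qed

lemma \<Gamma>_adm:
  assumes w: "adm B w"
  shows "adm (K * A + K * cB B * (8 * g 0)) (\<Gamma> w)"
  unfolding adm_def
proof (intro conjI ballI allI)
  show "0 \<le> K * A + K * cB B * (8 * g 0)"
    using K A cB_nonneg g_nonneg w by (intro add_nonneg_nonneg mult_nonneg_nonneg) (auto simp: adm_def)
  have "(\<lambda>(s :: real, y). h y) \<in> borel_measurable (borel \<Otimes>\<^sub>M borel)"
    using borel_measurable_continuous_onI[OF h(1)] by measurable
  note Vh = V_meas[OF this]
  have "(\<lambda>z. (fst z, 0, snd z)) \<in> measurable (borel \<Otimes>\<^sub>M borel) ((borel :: real measure) \<Otimes>\<^sub>M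
      (borel :: real measure) \<Otimes>\<^sub>M (borel :: 'h measure))"
    by measurable
  from measurable_compose[OF this Vh]
  have [measurable]: "(\<lambda>z. V (fst z) h (snd z)) \<in> borel_measurable (borel \<Otimes>\<^sub>M borel)" by simp
  have [measurable]: "(\<lambda>z. VI w (fst z) (snd z)) \<in> borel_measurable (borel \<Otimes>\<^sub>M borel)"
    unfolding VI_def
    by (rule lborel.borel_measurable_lebesgue_integral)
      (use VI_integrand_measurable[OF w] in \<open>simp add: case_prod_beta'\<close>)
  show "(\<lambda>(t, x). \<Gamma> w t x) \<in> borel_measurable (borel \<Otimes>\<^sub>M borel)"
    unfolding \<Gamma>_def case_prod_beta' by measurable
next
  fix t assume t: "t \<in> {0<..T}"
  then have tt: "0 < t" "t \<le> T" by auto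
  have "continuous_on UNIV (\<lambda>x. V t h x + VI w t x)"
    by (intro continuous_on_add V_cont[OF h tt(1)] VI_continuous[OF w tt])
  then show "continuous_on UNIV (\<Gamma> w t)" using t by (simp add: \<Gamma>_def[abs_def])
  fix x
  have "norm (\<Gamma> w t x) \<le> norm (V t h x) + norm (VI w t x)" using t by (simp add: \<Gamma>_def norm_triangle_ineq)
  also have "\<dots> \<le> K * t powr (- \<gamma>) * A + K * cB B * (8 * g 0) * t powr (- \<gamma>)"
    by (intro add_mono V_bound[OF h tt(1)] VI_bound[OF w tt])
  finally show "norm (\<Gamma> w t x) \<le> (K * A + K * cB B * (8 * g 0)) * t powr (- \<gamma>)" by (simp add: algebra_simps)
qed

text \<open>The weighted distance at time s meets the smoothing factor (t - s) powr (- \<gamma>) and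
  produces exactly the kernel of \<open>k_integral\<close>. The term with h cancels, so the factor 8
  K L g \<theta> is all that remains.\<close>

lemma \<Gamma>_diff:
  assumes w: "adm B w" "adm B' w'" and D: "0 \<le> D" "\<And>t x. t \<in> {0<..T} \<Longrightarrow> norm (w t x - w' t x) \<le>
      D * (t powr (- \<gamma>) * exp (\<theta> * t))"
    and \<theta>: "0 \<le> \<theta>" and t: "t \<in> {0<..T}"
  shows "norm (\<Gamma> w t x - \<Gamma> w' t x) \<le> (K * L * (8 * g \<theta>)) * D * (t powr (- \<gamma>) * exp (\<theta> * t))"
proof -
  have tt: "0 < t" "t \<le> T" using t by auto
  note i1 = VI_integrable[OF w(1) tt, of x] and i2 = VI_integrable[OF w(2) tt, of x]
  have "\<Gamma> w t x - \<Gamma> w' t x = (\<integral>s. Vs w t x s - Vs w' t x s \<partial>lborel)"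
    using Bochner_Integration.integral_diff[OF i1 i2] t by (simp add: \<Gamma>_def VI_def)
  then have "norm (\<Gamma> w t x - \<Gamma> w' t x) = norm (\<integral>s. Vs w t x s - Vs w' t x s \<partial>lborel)"
    by (rule arg_cong)
  also have "\<dots> \<le> (\<integral>s. K * L * D * (k t s * exp (\<theta> * s)) \<partial>lborel)"
  proof (rule Bochner_Integration.integral_norm_bound_integral)
    show "integrable lborel (\<lambda>s. K * L * D * (k t s * exp (\<theta> * s)))"
      by (intro integrable_mult_right k_integrable tt \<theta>)
    show "norm (Vs w t x s - Vs w' t x s) \<le> K * L * D * (k t s * exp (\<theta> * s))" for s
    proof (cases "s \<in> {0<..<t}")
      case True
      then have s: "0 < s" "s \<le> T" "0 < t - s" using tt by auto
      have "norm (V (t - s) (F w s) x - V (t - s) (F w' s) x) \<le> K * (t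
          - s) powr (- \<gamma>) * (L * (D * (s powr (- \<gamma>) * exp (\<theta> * s))))"
        using s by (intro V_diff[OF F_continuous[OF w(1)] F_bound[OF w(1)] F_continuous[OF w(2)] F_bound[OF w(2)]] F_diff D(2)) auto
      then show ?thesis using True by (simp add: k_def mult_ac)
    qed (simp add: k_def)
  qed (use i1 i2 in simp)
  also have "\<dots> = K * L * D * (\<integral>s. k t s * exp (\<theta> * s) \<partial>lborel)" by (rule integral_mult_right_zero)
  also have "\<dots> \<le> K * L * D * (8 * g \<theta> * (t powr (- \<gamma>) * exp (\<theta> * t)))"
    using K L D by (intro mult_left_mono k_integral tt \<theta>) auto
  finally show ?thesis by (simp add: mult_ac)
qed

section \<open>Contraction and Picard iteration\<close>

lemma contraction_rate: "\<exists>\<theta>\<ge>0. K * L * (8 * g \<theta>) \<le> 1 / 2"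
proof -
  have "(\<lambda>n. K * L * (8 * g (real n))) \<longlonglongrightarrow> K * L * (8 * 0)"
    by (intro tendsto_intros g_tendsto)
  then have "\<forall>\<^sub>F n in sequentially. K * L * (8 * g (real n)) < 1 / 2"
    by (intro order_tendstoD) auto
  then obtain n where "K * L * (8 * g (real n)) < 1 / 2" by (auto simp: eventually_sequentially)
  then show ?thesis by (intro exI[of _ "real n"]) auto
qed

lemma adm_diff_bound:
  assumes "adm B w" "adm B' w'" "0 \<le> \<theta>" "t \<in> {0<..T}"
  shows "norm (w t x - w' t x) \<le> (B + B') * (t powr (- \<gamma>) * exp (\<theta> * t))"
proof -
  have "norm (w t x - w' t x) \<le> norm (w t x) + norm (w' t x)" by (rule norm_triangle_ineq4)
  also have "\<dots> \<le> B * t powr (- \<gamma>) + B' * t powr (- \<gamma>)"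
    using assms by (intro add_mono) (auto simp: adm_def)
  also have "\<dots> = (B + B') * (t powr (- \<gamma>) * 1)" by (simp add: algebra_simps)
  also have "\<dots> \<le> (B + B') * (t powr (- \<gamma>) * exp (\<theta> * t))"
    using assms by (intro mult_left_mono) (auto simp: adm_def)
  finally show ?thesis .
qed

text \<open>The admissible bounds make the weighted distance finite to begin with; applying the
  contraction n times shrinks it by 2 ^ n.\<close>

lemma fixpoint_unique:
  assumes w: "adm B w" "adm B' w'" and fix_: "\<And>t x. t \<in> {0<..T} \<Longrightarrow> \<Gamma> w t x = w t x" "\<And>t x. t \<in>
      {0<..T} \<Longrightarrow> \<Gamma> w' t x = w' t x"
    and t: "t \<in> {0<..T}"
  shows "w t x = w' t x"
proof -
  obtain \<theta> where \<theta>: "\<theta> \<ge> 0" "K * L * (8 * g \<theta>) \<le> 1 / 2" using contraction_rate by blast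
  define D where "D = B + B'"
  have D: "0 \<le> D" using w by (simp add: D_def adm_def)
  have it: "norm (w t x - w' t x) \<le> (D * (1 / 2) ^ n) * (t powr (- \<gamma>) * exp (\<theta> * t))" if "t \<in> {0<..T}" for n t x
    using that
  proof (induction n arbitrary: t x)
    case 0
    then show ?case using adm_diff_bound[OF w \<theta>(1)] by (simp add: D_def)
  next
    case (Suc n)
    have "norm (w t x - w' t x) = norm (\<Gamma> w t x - \<Gamma> w' t x)" using Suc.prems by (simp add: fix_)
    also have "\<dots> \<le> (K * L * (8 * g \<theta>)) * (D * (1 / 2) ^ n) * (t powr (- \<gamma>) * exp (\<theta> * t))"
      using Suc D by (intro \<Gamma>_diff[OF w _ _ \<theta>(1)]) auto
    also have "\<dots> \<le> (1 / 2) * (D * (1 / 2) ^ n) * (t powr (- \<gamma>) * exp (\<theta> * t))"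
      using \<theta>(2) D by (intro mult_right_mono) auto
    finally show ?case by simp
  qed
  have "(\<lambda>n. (D * (1 / 2) ^ n) * (t powr (- \<gamma>) * exp (\<theta> * t))) \<longlonglongrightarrow>
      (D * 0) * (t powr (- \<gamma>) * exp (\<theta> * t))"
    by (intro tendsto_intros LIMSEQ_realpow_zero) auto
  then have "norm (w t x - w' t x) \<le> (D * 0) * (t powr (- \<gamma>) * exp (\<theta> * t))"
    by (rule LIMSEQ_le_const) (use it[OF t] in auto)
  then show ?thesis by simp
qed

primrec iter :: "nat \<Rightarrow> real \<Rightarrow> 'h \<Rightarrow> 'h" where
  "iter 0 = (\<lambda>_ _. 0)"
| "iter (Suc n) = \<Gamma> (iter n)"

lemma iter_adm: "\<exists>B. adm B (iter n)"
proof (induction n)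
  case 0
  have "adm 0 (\<lambda>_ _. 0)" by (simp add: adm_def)
  then show ?case by auto
next
  case (Suc n)
  then show ?case using \<Gamma>_adm by auto
qed

text \<open>The iterates start at 0 and converge pointwise by completeness of H. The error bound is
  uniform in x for each t, which keeps the limit continuous in space. Outside (0,T] all iterates
  vanish, so the limit exists everywhere and is jointly measurable.\<close>

theorem fixpoint_exists: "\<exists>B w. adm B w \<and> (\<forall>t\<in>{0<..T}. \<forall>x. \<Gamma> w t x = w t x)"
proof -
  obtain \<theta> where \<theta>: "\<theta> \<ge> 0" "K * L * (8 * g \<theta>) \<le> 1 / 2" using contraction_rate by blast
  define q where "q t = t powr (- \<gamma>) * exp (\<theta> * t)" for t
  have q0: "0 \<le> q t" for t by (simp add: q_def)
  obtain D where D: "adm D (iter 1)" using iter_adm by blast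
  then have D0: "0 \<le> D" by (simp add: adm_def)
  have step: "norm (iter (Suc n) t x - iter n t x) \<le> D * (1 / 2) ^ n * q t" if "t \<in> {0<..T}" for n t x
    using that
  proof (induction n arbitrary: t x)
    case 0
    have "adm 0 (iter 0)" by (simp add: adm_def)
    from adm_diff_bound[OF D this \<theta>(1) 0] show ?case by (simp add: q_def)
  next
    case (Suc n)
    obtain B B' where B: "adm B (iter (Suc n))" "adm B' (iter n)" using iter_adm by blast
    have "norm (\<Gamma> (iter (Suc n)) t x - \<Gamma> (iter n) t x) \<le> (K * L * (8 * g \<theta>)) * (D * (1 / 2) ^ n) * q t"
      unfolding q_def using Suc D0 by (intro \<Gamma>_diff[OF B _ _ \<theta>(1)]) (auto simp: q_def simp del: iter.simps)
    also have "\<dots> \<le> (1 / 2) * (D * (1 / 2) ^ n) * q t"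
      using \<theta>(2) D0 q0 by (intro mult_right_mono) auto
    finally show ?case by simp
  qed
  have tele: "norm (iter (n + i) t x - iter n t x) \<le> 2 * D * (1 / 2) ^ n * q t - 2 * D * (1 / 2) ^ (n + i) * q t" if t: "t \<in>
      {0<..T}" for n i t x
  proof (induction i)
    case (Suc i)
    have "norm (iter (n + Suc i) t x - iter n t x) \<le> norm (iter (Suc (n + i)) t x - iter (n + i) t x) + norm (iter (n + i) t x - iter n t x)"
      using norm_triangle_ineq[of "iter (Suc (n + i)) t x - iter (n + i) t x" "iter (n + i) t x - iter n t x"]
      by (simp del: iter.simps)
    also have "\<dots> \<le> D * (1 / 2) ^ (n + i) * q t + (2 * D * (1 / 2) ^ n * q t - 2 * D * (1 / 2) ^ (n + i) * q t)"
      by (intro add_mono step[OF t] Suc)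
    also have "\<dots> = 2 * D * (1 / 2) ^ n * q t - 2 * D * (1 / 2) ^ (n + Suc i) * q t" by simp
    finally show ?case .
  qed simp
  have tele': "norm (iter (n + i) t x - iter n t x) \<le> 2 * D * (1 / 2) ^ n * q t" if t: "t \<in> {0<..T}" for n i t x
  proof -
    have "0 \<le> 2 * D * (1 / 2) ^ (n + i) * q t" using D0 q0[of t] by simp
    then show ?thesis using tele[OF t, of n i x] by linarith
  qed
  have zero: "iter n t x = 0" if "t \<notin> {0<..T}" for n t x
    using that by (cases n) (auto simp: \<Gamma>_def)
  have lim0: "(\<lambda>n. 2 * D * (1 / 2) ^ n * q t) \<longlonglongrightarrow> 0" for t
    using tendsto_mult_right_zero[OF LIMSEQ_realpow_zero[of "1 / 2 :: real"], of "2 * D * q t"] by (simp add: mult_ac)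
  have cauchy: "convergent (\<lambda>n. iter n t x)" for t x
  proof (cases "t \<in> {0<..T}")
    case True
    have "Cauchy (\<lambda>n. iter n t x)"
      unfolding Cauchy_altdef2
    proof (intro allI impI)
      fix \<epsilon> :: real assume "0 < \<epsilon>"
      then have "\<forall>\<^sub>F n in sequentially. 2 * D * (1 / 2) ^ n * q t < \<epsilon>" by (rule order_tendstoD(2)[OF lim0])
      then obtain n where n: "2 * D * (1 / 2) ^ n * q t < \<epsilon>" by (auto simp: eventually_sequentially)
      have "dist (iter m t x) (iter n t x) < \<epsilon>" if "m \<ge> n" for m
        using tele'[OF True, of n "m - n" x] that n by (simp add: dist_norm)
      then show "\<exists>N. \<forall>m\<ge>N. dist (iter m t x) (iter N t x) < \<epsilon>" by blast
    qed
    then show ?thesis by (rule Cauchy_convergent)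
  next
    case False
    then show ?thesis using zero[OF False] by (simp add: convergent_const)
  qed
  define w where "w t x = lim (\<lambda>n. iter n t x)" for t x
  have wlim: "(\<lambda>n. iter n t x) \<longlonglongrightarrow> w t x" for t x
    unfolding w_def using cauchy convergent_LIMSEQ_iff by blast
  have wdist: "norm (w t x - iter n t x) \<le> 2 * D * (1 / 2) ^ n * q t" if t: "t \<in> {0<..T}" for n t x
  proof (rule LIMSEQ_le_const2)
    show "(\<lambda>i. norm (iter (n + i) t x - iter n t x)) \<longlonglongrightarrow> norm (w t x - iter n t x)"
      using LIMSEQ_ignore_initial_segment[OF wlim, of n t x] by (intro tendsto_intros) (simp add: add.commute)
  qed (use tele'[OF t] in auto)
  have w_adm: "adm (2 * D * exp (\<theta> * T)) w"
    unfolding adm_def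
  proof (intro conjI ballI allI)
    show "0 \<le> 2 * D * exp (\<theta> * T)" using D0 by simp
    have m: "(\<lambda>z. iter n (fst z) (snd z)) \<in> borel_measurable (borel \<Otimes>\<^sub>M borel)" for n
      using iter_adm[of n] by (auto simp: adm_def case_prod_beta')
    show "(\<lambda>(s, y). w s y) \<in> borel_measurable (borel \<Otimes>\<^sub>M borel)"
      unfolding case_prod_beta' by (rule borel_measurable_LIMSEQ_metric[OF m]) (rule wlim)
  next
    fix t assume t: "t \<in> {0<..T}"
    have "uniform_limit UNIV (\<lambda>n. iter n t) (w t) sequentially"
    proof (rule uniform_limitI)
      fix \<epsilon> :: real assume "0 < \<epsilon>"
      then have "\<forall>\<^sub>F n in sequentially. 2 * D * (1 / 2) ^ n * q t < \<epsilon>" by (rule order_tendstoD(2)[OF lim0])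
      then show "\<forall>\<^sub>F n in sequentially. \<forall>x\<in>UNIV. dist (iter n t x) (w t x) < \<epsilon>"
      proof eventually_elim
        case (elim n)
        then show ?case using order_le_less_trans[OF wdist[OF t]] by (simp add: dist_norm norm_minus_commute)
      qed
    qed
    moreover have "continuous_on UNIV (iter n t)" for n
      using iter_adm[of n] t by (auto simp: adm_def)
    ultimately show "continuous_on UNIV (w t)"
      by (intro uniform_limit_theorem[where f="\<lambda>n. iter n t"]) auto
    fix x
    have "norm (w t x) \<le> 2 * D * q t" using wdist[OF t, of x 0] by simp
    also have "\<dots> \<le> 2 * D * (t powr (- \<gamma>) * exp (\<theta> * T))"
      unfolding q_def using D0 t \<theta> by (intro mult_left_mono) (auto intro: mult_left_mono)
    finally show "norm (w t x) \<le> 2 * D * exp (\<theta> * T) * t powr (- \<gamma>)" by (simp add: mult_ac)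
  qed
  have "\<Gamma> w t x = w t x" if t: "t \<in> {0<..T}" for t x
  proof -
    have b: "norm (iter (Suc n) t x - \<Gamma> w t x) \<le> 2 * D * (1 / 2) ^ n * q t" for n
    proof -
      obtain B where B: "adm B (iter n)" using iter_adm by blast
      have "norm (\<Gamma> w t x - \<Gamma> (iter n) t x) \<le> (K * L * (8 * g \<theta>)) * (2 * D * (1 / 2) ^ n) * q t"
        unfolding q_def using wdist D0 t by (intro \<Gamma>_diff[OF w_adm B _ _ \<theta>(1)]) (auto simp: q_def)
      also have "\<dots> \<le> 1 * (2 * D * (1 / 2) ^ n) * q t"
        using \<theta>(2) D0 q0 by (intro mult_right_mono) auto
      finally show ?thesis by (simp add: norm_minus_commute)
    qed
    have "(\<lambda>n. iter (Suc n) t x - \<Gamma> w t x) \<longlonglongrightarrow> 0"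
      by (rule Lim_null_comparison[OF _ lim0[of t]]) (use b in simp)
    then have "(\<lambda>n. iter (Suc n) t x) \<longlonglongrightarrow> \<Gamma> w t x" by (simp add: LIM_zero_iff del: iter.simps)
    moreover have "(\<lambda>n. iter (Suc n) t x) \<longlonglongrightarrow> w t x" by (rule LIMSEQ_Suc[OF wlim])
    ultimately show ?thesis by (rule LIMSEQ_unique)
  qed
  with w_adm show ?thesis by blast
qed


section \<open>The function recovered from a gradient\<close>

lemma PI_integrand_bound:
  assumes w: "adm B w" and s: "s \<le> T"
  shows "norm (Ps w t x s) \<le> cB B * p 0 s"
proof (cases "s \<in> {0<..<t}")
  case True
  then have "\<bar>P (t - s) (F w s) x\<bar> \<le> cB B * s powr (- \<gamma>)"
    using s by (intro P_bound[OF F_continuous[OF w] F_bound[OF w]]) auto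
  then show ?thesis using True s by (simp add: p_def)
next
  case False
  then show ?thesis using cB_nonneg w p_nonneg[of 0 s] by (simp add: adm_def)
qed

lemma PI_integrand_bound':
  assumes w: "adm B w" and t: "t \<le> T"
  shows "norm (Ps w t x s) \<le> cB B * p 0 s"
proof (cases "s \<le> T")
  case False
  then have "s \<notin> {0<..<t}" using t by auto
  then show ?thesis using cB_nonneg w p_nonneg[of 0 s] by (simp add: adm_def)
qed (rule PI_integrand_bound[OF w])

lemma PI_integrable:
  assumes w: "adm B w" and t: "t \<le> T"
  shows "integrable lborel (\<lambda>s. Ps w t x s)"
proof (rule Bochner_Integration.integrable_bound[where f="\<lambda>s. cB B * p 0 s"])
  show "integrable lborel (\<lambda>s. cB B * p 0 s)" by (intro integrable_mult_right p_zero_integrable)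
  show "AE s in lborel. norm (Ps w t x s) \<le> norm (cB B * p 0 s)"
    using order_trans[OF PI_integrand_bound'[OF w t] abs_ge_self] by (intro AE_I2) simp
qed (use PI_integrand_measurable[OF w] in simp)

lemma PI_bound:
  assumes w: "adm B w" and t: "t \<le> T"
  shows "\<bar>PI w t x\<bar> \<le> cB B * g 0"
proof -
  have "norm (PI w t x) \<le> (\<integral>s. cB B * p 0 s \<partial>lborel)"
    unfolding PI_def
  proof (rule Bochner_Integration.integral_norm_bound_integral[OF PI_integrable[OF w t]])
    show "integrable lborel (\<lambda>s. cB B * p 0 s)" by (intro integrable_mult_right p_zero_integrable)
  qed (use PI_integrand_bound'[OF w t] in simp)
  then show ?thesis by (simp add: g_def)
qed

definition sol :: "(real \<Rightarrow> 'h \<Rightarrow> 'h) \<Rightarrow> real \<Rightarrow> 'h \<Rightarrow> real" where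
  "sol w t x = P t h x + PI w t x"

lemma sol_bounded:
  assumes w: "adm B w" and t: "t \<le> T"
  shows "\<bar>sol w t x\<bar> \<le> A + cB B * g 0"
  using PI_bound[OF w t, of x] P_bound[OF h, of t x] by (simp add: sol_def)

text \<open>The interval of integration moves with t. Its indicator converges at every s except the
  limiting endpoint, which is a null set, and the bound \<open>p 0\<close> does not depend on
  t.\<close>

lemma PI_continuous:
  assumes w: "adm B w"
  shows "continuous_on ({0..T} \<times> UNIV) (\<lambda>(t, x). PI w t x)"
  unfolding continuous_on_sequentially
proof (intro ballI allI impI)
  fix z and a :: "real \<times> 'h" assume a: "a \<in> {0..T} \<times> UNIV" and z: "(\<forall>n. z n \<in> {0..T} \<times> UNIV) \<and> z \<longlonglongrightarrow>
      a"
  have zT: "0 \<le> fst (z n)" "fst (z n) \<le> T" for n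
  proof -
    have "z n \<in> {0..T} \<times> UNIV" using z by (elim conjE) (rule spec)
    then show "0 \<le> fst (z n)" "fst (z n) \<le> T" by (simp_all add: mem_Times_iff)
  qed
  have z1: "(\<lambda>n. fst (z n)) \<longlonglongrightarrow> fst a" using z by (auto intro: tendsto_fst)
  have "(\<lambda>n. PI w (fst (z n)) (snd (z n))) \<longlonglongrightarrow> PI w (fst a) (snd a)"
    unfolding PI_def
  proof (rule integral_dominated_convergence[where w="\<lambda>s. cB B * p 0 s"])
    show "integrable lborel (\<lambda>s. cB B * p 0 s)" by (intro integrable_mult_right p_zero_integrable)
    show "AE s in lborel. (\<lambda>n. Ps w (fst (z n)) (snd (z n)) s)
       \<longlonglongrightarrow> Ps w (fst a) (snd a) s"
      using AE_lborel_singleton[of "fst a"]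
    proof eventually_elim
      case (elim s)
      show ?case
      proof (cases "0 < s \<and> s < fst a")
        case True
        then have sT: "0 < s" "s \<le> T" using a by (auto simp: mem_Times_iff)
        have c: "continuous_on ({0..} \<times> UNIV) (\<lambda>(t, x). P t (F w s) x)"
          by (rule P_cont[OF F_continuous[OF w sT] F_bound[OF w sT]])
        have ev: "\<forall>\<^sub>F n in sequentially. s < fst (z n)"
          using z1 True by (intro order_tendstoD) auto
        \<comment> \<open>Continuity of P is known only for nonnegative times; the clamp keeps the
          early members of the sequence in that domain and is eventually inactive.\<close>
        define y where "y n = (max 0 (fst (z n) - s), snd (z n))" for n
        have "(\<lambda>n. fst (z n) - s) \<longlonglongrightarrow> fst a - s" by (intro tendsto_intros z1)
        then have "(\<lambda>n. max 0 (fst (z n) - s)) \<longlonglongrightarrow> max 0 (fst a - s)" by (intro tendsto_max tendsto_const)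
        then have "y \<longlonglongrightarrow> (fst a - s, snd a)"
          unfolding y_def using True z by (intro tendsto_Pair) (auto intro: tendsto_snd)
        then have "(\<lambda>n. (\<lambda>(t, x). P t (F w s) x) (y n)) \<longlonglongrightarrow> (\<lambda>(t, x). P t (F w s) x) (fst a - s, snd a)"
          by (rule continuous_on_tendsto_compose[OF c]) (use True in \<open>simp_all add: y_def\<close>)
        then have lim: "(\<lambda>n. P (max 0 (fst (z n) - s)) (F w s) (snd (z n))) \<longlonglongrightarrow> P (fst a - s) (F w s) (snd a)"
          by (simp only: y_def prod.case)
        have "\<forall>\<^sub>F n in sequentially. P (max 0 (fst (z n) - s)) (F w s) (snd (z n)) =
          Ps w (fst (z n)) (snd (z n)) s"
          using ev by eventually_elim (use True in \<open>simp add: max_def\<close>)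
        from Lim_transform_eventually[OF lim this] show ?thesis using True by simp
      next
        case False
        then have "s \<le> 0 \<or> fst a < s" using elim by auto
        then have "\<forall>\<^sub>F n in sequentially. Ps w (fst (z n)) (snd (z n)) s = 0"
        proof
          assume "fst a < s"
          then have "\<forall>\<^sub>F n in sequentially. fst (z n) < s" using z1 by (intro order_tendstoD)
          then show ?thesis by eventually_elim simp
        qed simp
        then have "(\<lambda>n. Ps w (fst (z n)) (snd (z n)) s) \<longlonglongrightarrow> 0"
          by (rule tendsto_eventually)
        moreover have "Ps w (fst a) (snd a) s = 0"
          using False by (simp add: indicator_def)
        ultimately show ?thesis by (simp only:)
      qed
    qed
    show "AE s in lborel. norm (Ps w (fst (z n)) (snd (z n)) s) \<le> cB B * p 0 s" for n
      by (intro AE_I2 PI_integrand_bound'[OF w zT(2)])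
  qed (use PI_integrand_measurable[OF w] in simp_all)
  then show "((\<lambda>(t, x). PI w t x) \<circ> z) \<longlonglongrightarrow> (case a of (t, x) \<Rightarrow> PI w t x)"
    by (simp add: o_def case_prod_beta')
qed

lemma sol_continuous:
  assumes w: "adm B w"
  shows "continuous_on ({0..T} \<times> UNIV) (\<lambda>(t, x). sol w t x)"
proof -
  have "continuous_on ({0..T} \<times> UNIV) (\<lambda>(t, x). P t h x)"
    by (rule continuous_on_subset[OF P_cont[OF h]]) auto
  from continuous_on_add[OF this PI_continuous[OF w]] show ?thesis
    by (simp add: sol_def case_prod_beta')
qed

lemma GDERIV_lipschitz:
  fixes f :: "'h \<Rightarrow> real"
  assumes "\<And>x. GDERIV f x :> D x" "\<And>x. norm (D x) \<le> b"
  shows "\<bar>f y - f x\<bar> \<le> b * norm (y - x)"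
proof -
  have "norm (f y - f x) \<le> b * norm (y - x)"
  proof (rule differentiable_bound[of UNIV f "\<lambda>x h. h \<bullet> D x"])
    fix z :: 'h
    show "(f has_derivative (\<lambda>h. h \<bullet> D z)) (at z within UNIV)" using assms(1) by (simp add: gderiv_def)
    show "onorm (\<lambda>h. h \<bullet> D z) \<le> b"
    proof (rule onorm_bound)
      show "0 \<le> b" by (rule order_trans[OF norm_ge_zero assms(2)])
      fix h
      have "norm (h \<bullet> D z) \<le> norm h * norm (D z)" by (simp add: Cauchy_Schwarz_ineq2)
      also have "\<dots> \<le> b * norm h" using mult_left_mono[OF assms(2)[of z], of "norm h"] by (simp add: mult.commute)
      finally show "norm (h \<bullet> D z) \<le> b * norm h" .
    qed
  qed auto
  then show ?thesis by simp
qed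

text \<open>Differentiation under the integral. The remainder quotient \<open>q i s\<close> tends to
  0 for each s by \<open>P_GDERIV\<close>; the mean value inequality bounds it by twice the gradient
  bound at s, an integrable multiple of \<open>k t\<close>.\<close>

lemma PI_GDERIV:
  assumes w: "adm B w" and t: "0 < t" "t \<le> T"
  shows "GDERIV (PI w t) x :> VI w t x"
  unfolding gderiv_def has_derivative_iff_norm
proof (intro conjI bounded_linear_inner_left)
  show "((\<lambda>y. norm (PI w t y - PI w t x - (y - x) \<bullet> VI w t x) / norm (y - x)) \<longlongrightarrow> 0) (at x)"
    unfolding tendsto_at_iff_sequentially
  proof (intro allI impI)
    fix z assume z: "\<forall>i. z i \<in> UNIV - {x}" and lim: "z \<longlonglongrightarrow> x"
    have nz: "norm (z i - x) > 0" for i using z by auto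
    define q where "q i s = indicator {0<..<t} s *\<^sub>R
      ((P (t - s) (F w s) (z i) - P (t - s) (F w s) x - (z i - x) \<bullet> V (t - s) (F w s) x) / norm (z i - x))" for i s
    have Vi: "integrable lborel (\<lambda>s. (z i - x) \<bullet> (Vs w t x s))" for i
      using VI_integrable[OF w t, of x] by (rule integrable_inner_right)
    have qeq: "q i s = (Ps w t (z i) s - Ps w t x s
      - (z i - x) \<bullet> (Vs w t x s)) / norm (z i - x)" for i s
      by (simp add: q_def indicator_def)
    have qi: "integrable lborel (q i)" for i
      unfolding qeq by (intro Bochner_Integration.integrable_diff integrable_divide Vi PI_integrable[OF w t(2)])
    have qI: "(\<integral>s. q i s \<partial>lborel) = (PI w t (z i) - PI w t x - (z i - x) \<bullet> VI w t x) / norm (z i - x)" for i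
    proof -
      have "(\<integral>s. (z i - x) \<bullet> (Vs w t x s) \<partial>lborel) = (z i - x) \<bullet> VI w t x"
        unfolding VI_def using VI_integrable[OF w t, of x] by (rule integral_inner_right)
      then show ?thesis
        unfolding qeq PI_def
        by (simp only: integral_divide_zero Bochner_Integration.integral_diff[OF Bochner_Integration.integrable_diff[OF PI_integrable[OF w t(2)] PI_integrable[OF w t(2)]] Vi]
          Bochner_Integration.integral_diff[OF PI_integrable[OF w t(2)] PI_integrable[OF w t(2)]])
    qed
    have "(\<lambda>i. \<integral>s. q i s \<partial>lborel) \<longlonglongrightarrow> (\<integral>s. (0 :: real) \<partial>(lborel :: real measure))"
    proof (rule integral_dominated_convergence[where w="\<lambda>s. 2 * (K * cB B * (k t s * exp (0 * s)))"])
      show "integrable lborel (\<lambda>s. 2 * (K * cB B * (k t s * exp (0 * s))))"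
        by (intro integrable_mult_right k_integrable t order_refl)
      show "AE s in lborel. (\<lambda>i. q i s) \<longlonglongrightarrow> 0"
      proof (rule AE_I2)
        fix s
        show "(\<lambda>i. q i s) \<longlonglongrightarrow> 0"
        proof (cases "s \<in> {0<..<t}")
          case True
          then have "GDERIV (P (t - s) (F w s)) x :> V (t - s) (F w s) x"
            using t by (intro P_GDERIV[OF F_continuous[OF w] F_bound[OF w]]) auto
          then have "((\<lambda>y. norm (P (t - s) (F w s) y - P (t - s) (F w s) x - (y - x) \<bullet> V (t - s) (F w s) x) / norm (y - x)) \<longlongrightarrow>
              0) (at x)"
            unfolding gderiv_def has_derivative_iff_norm by blast
          then have "(\<lambda>i. norm (P (t - s) (F w s) (z i) - P (t - s) (F w s) x - (z i - x) \<bullet> V (t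
              - s) (F w s) x) / norm (z i - x)) \<longlonglongrightarrow> 0"
            unfolding tendsto_at_iff_sequentially using z lim by (auto simp: o_def)
          then have "(\<lambda>i. norm (q i s)) \<longlonglongrightarrow> 0" using True by (simp add: q_def)
          then show ?thesis by (rule tendsto_norm_zero_cancel)
        qed (simp add: q_def)
      qed
      show "AE s in lborel. norm (q i s) \<le> 2 * (K * cB B * (k t s * exp (0 * s)))" for i
      proof (rule AE_I2)
        fix s
        show "norm (q i s) \<le> 2 * (K * cB B * (k t s * exp (0 * s)))"
        proof (cases "s \<in> {0<..<t}")
          case True
          define b where "b = K * cB B * k t s"
          have Vb: "norm (V (t - s) (F w s) y) \<le> b" for y
            using VI_integrand_bound[OF w t, of s y] True by (simp add: b_def)
          have "\<bar>P (t - s) (F w s) (z i) - P (t - s) (F w s) x\<bar> \<le> b * norm (z i - x)"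
            using True t by (intro GDERIV_lipschitz[OF P_GDERIV[OF F_continuous[OF w] F_bound[OF w]] Vb]) auto
          moreover have "\<bar>(z i - x) \<bullet> V (t - s) (F w s) x\<bar> \<le> b * norm (z i - x)"
          proof -
            have "\<bar>(z i - x) \<bullet> V (t - s) (F w s) x\<bar> \<le> norm (z i - x) * norm (V (t - s) (F w s) x)"
              by (rule Cauchy_Schwarz_ineq2)
            also have "\<dots> \<le> norm (z i - x) * b" by (intro mult_left_mono Vb) simp
            finally show ?thesis by (simp add: mult.commute)
          qed
          ultimately have "\<bar>P (t - s) (F w s) (z i) - P (t - s) (F w s) x - (z i - x) \<bullet> V (t - s) (F w s) x\<bar> \<le>
              2 * b * norm (z i - x)"
            by linarith
          then show ?thesis using True nz[of i] by (simp add: q_def b_def divide_le_eq)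
        next
          case False
          then show ?thesis using K cB_nonneg w k_nonneg[of t s] by (simp add: q_def adm_def)
        qed
      qed
    qed (use qi in simp_all)
    then have "(\<lambda>i. (PI w t (z i) - PI w t x - (z i - x) \<bullet> VI w t x) / norm (z i - x)) \<longlonglongrightarrow> 0"
      by (simp add: qI)
    from tendsto_norm[OF this]
    show "((\<lambda>y. norm (PI w t y - PI w t x - (y - x) \<bullet> VI w t x) / norm (y - x)) \<circ> z) \<longlonglongrightarrow> 0"
      by (simp add: o_def)
  qed
qed

lemma sol_GDERIV:
  assumes w: "adm B w" and t: "t \<in> {0<..T}"
  shows "GDERIV (sol w t) x :> \<Gamma> w t x"
proof -
  have tt: "0 < t" "t \<le> T" using t by auto
  from GDERIV_add[OF P_GDERIV[OF h tt(1)] PI_GDERIV[OF w tt], of x]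
  show ?thesis using t by (simp add: sol_def[abs_def] \<Gamma>_def)
qed

end

section \<open>Mild solutions\<close>

lemma grad_eq:
  assumes "GDERIV \<phi> x :> d"
  shows "grad \<phi> x = d"
  unfolding grad_def
proof (rule the_equality)
  fix d' assume "GDERIV \<phi> x :> d'"
  then have "(\<lambda>h. h \<bullet> d') = (\<lambda>h. h \<bullet> d)"
    using assms unfolding gderiv_def by (rule has_derivative_unique)
  then have "(d' - d) \<bullet> d' = (d' - d) \<bullet> d" by (rule fun_cong)
  then have "(d' - d) \<bullet> (d' - d) = 0" by (simp add: inner_diff_right)
  then show "d' = d" by simp
qed (rule assms)

section \<open>Estimates for the Hamiltonian\<close>

definition hinf :: "real \<Rightarrow> 'h::real_inner \<Rightarrow> real" where
  "hinf R p = (INF l\<in>{l. norm l \<le> R}. l \<bullet> p + 1/2 * (norm l)\<^sup>2)"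

lemma hinf_lower:
  assumes "norm l \<le> R"
  shows "- (R * norm p) \<le> l \<bullet> p + 1/2 * (norm l)\<^sup>2"
proof -
  have "\<bar>l \<bullet> p\<bar> \<le> R * norm p"
    using Cauchy_Schwarz_ineq2[of l p] mult_right_mono[OF assms, of "norm p"] by simp
  moreover have "0 \<le> 1/2 * (norm l)\<^sup>2" by simp
  ultimately show ?thesis by linarith
qed

lemma hinf_le:
  assumes "norm l \<le> R"
  shows "hinf R p \<le> l \<bullet> p + 1/2 * (norm l)\<^sup>2"
  unfolding hinf_def
proof (rule cINF_lower)
  show "bdd_below ((\<lambda>l. l \<bullet> p + 1/2 * (norm l)\<^sup>2) ` {l. norm l \<le> R})"
    using hinf_lower[of _ R p] by (intro bdd_belowI2) simp
qed (use assms in simp)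

text \<open>An infimum over controls of norm at most R of functions that are affine in p with slope
  the control, hence R-Lipschitz in p.\<close>

lemma hinf_lipschitz:
  assumes R: "0 < R"
  shows "\<bar>hinf R p - hinf R q\<bar> \<le> R * norm (p - q)"
proof -
  have *: "hinf R p - R * norm (p - q) \<le> hinf R q" for p q :: 'a
    unfolding hinf_def[of R q]
  proof (rule cINF_greatest)
    show "{l :: 'a. norm l \<le> R} \<noteq> {}" using R by (auto intro: exI[of _ 0])
    fix l :: 'a assume "l \<in> {l. norm l \<le> R}"
    then have l: "norm l \<le> R" by simp
    have "l \<bullet> (p - q) \<le> R * norm (p - q)"
      using norm_cauchy_schwarz[of l "p - q"] mult_right_mono[OF l, of "norm (p - q)"] by simp
    then show "hinf R p - R * norm (p - q) \<le> l \<bullet> q + 1/2 * (norm l)\<^sup>2"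
      using hinf_le[OF l, of p] by (simp add: inner_diff_right)
  qed
  show ?thesis using *[of p q] *[of q p] by (simp add: norm_minus_commute abs_le_iff)
qed

lemma hinf_zero:
  assumes "0 < R"
  shows "hinf R (0 :: 'h::real_inner) = 0"
proof (rule antisym)
  show "hinf R (0 :: 'h) \<le> 0" using hinf_le[of "0 :: 'h" R 0] assms by simp
  show "0 \<le> hinf R (0 :: 'h)"
    unfolding hinf_def by (rule cINF_greatest) (use assms in \<open>auto intro: exI[of _ 0]\<close>)
qed

lemma hamiltonian_eq: "hamiltonian R F g x p = hinf R p + F x \<bullet> p + g x"
  by (simp add: hamiltonian_def hinf_def)

lemma hamiltonian_continuous:
  fixes F :: "'h \<Rightarrow> 'h::{real_inner, banach, polish_space}"
  assumes R: "0 < R" and F: "continuous_on UNIV F" and g: "continuous_on UNIV g"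
  shows "continuous_on UNIV (\<lambda>z. hamiltonian R F g (fst z) (snd z))"
proof -
  have "R-lipschitz_on UNIV (hinf R :: 'h \<Rightarrow> real)"
    using hinf_lipschitz[OF R] R by (intro lipschitz_onI) (auto simp: dist_norm)
  then have c: "continuous_on UNIV (hinf R :: 'h \<Rightarrow> real)" by (rule lipschitz_on_continuous_on)
  show ?thesis
    unfolding hamiltonian_eq
    by (intro continuous_intros continuous_on_compose2[OF c] continuous_on_compose2[OF F] continuous_on_compose2[OF g]) auto
qed

text \<open>Boundedness of F is what makes the constant independent of x.\<close>

lemma hamiltonian_lipschitz:
  assumes R: "0 < R" and F: "\<And>x. norm (F x) \<le> b"
  shows "\<bar>hamiltonian R F g x p - hamiltonian R F g x q\<bar> \<le> (R + b) * norm (p - q)"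
proof -
  have "\<bar>F x \<bullet> (p - q)\<bar> \<le> norm (F x) * norm (p - q)" by (rule Cauchy_Schwarz_ineq2)
  also have "\<dots> \<le> b * norm (p - q)" by (intro mult_right_mono F) simp
  finally have "\<bar>F x \<bullet> p - F x \<bullet> q\<bar> \<le> b * norm (p - q)" by (simp add: inner_diff_right)
  then show ?thesis using hinf_lipschitz[OF R, of p q] unfolding hamiltonian_eq distrib_right by linarith
qed

section \<open>Gradients of functions in the weighted space\<close>

text \<open>Expresses a derivative as the limit of one fixed sequence of difference quotients, the
  form in which measurability is inherited.\<close>

lemma GDERIV_directional_sequence:
  assumes "GDERIV \<phi> x :> d"
  shows "(\<lambda>k. real (Suc k) * (\<phi> (x + (1 / real (Suc k)) *\<^sub>R v) - \<phi> x)) \<longlonglongrightarrow> d \<bullet> v"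
proof -
  have 1: "((\<lambda>r. x + r *\<^sub>R v) has_derivative (\<lambda>r. r *\<^sub>R v)) (at (0::real))"
    by (auto intro!: derivative_eq_intros)
  have 2: "(\<phi> has_derivative (\<lambda>h. h \<bullet> d)) (at (x + 0 *\<^sub>R v))" using assms by (simp add: gderiv_def)
  have "((\<lambda>r. \<phi> (x + r *\<^sub>R v)) has_derivative (\<lambda>r. (r *\<^sub>R v) \<bullet> d)) (at 0)"
    by (rule has_derivative_compose[OF 1 2])
  moreover have "(\<lambda>r. (r *\<^sub>R v) \<bullet> d) = (*) (v \<bullet> d)" by (simp add: fun_eq_iff mult.commute)
  ultimately have "((\<lambda>r. \<phi> (x + r *\<^sub>R v)) has_real_derivative v \<bullet> d) (at 0)"
    by (simp only: has_field_derivative_def)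
  then have lim: "((\<lambda>r. (\<phi> (x + r *\<^sub>R v) - \<phi> (x + 0 *\<^sub>R v)) / (r - 0)) \<longlongrightarrow> v \<bullet> d) (at 0)"
    by (simp add: has_field_derivative_iff)
  have "filterlim (\<lambda>k. 1 / real (Suc k)) (at 0) sequentially"
    using LIMSEQ_inverse_real_of_nat by (auto simp: filterlim_at inverse_eq_divide)
  from filterlim_compose[OF lim this] show ?thesis
    by (simp add: inner_commute mult.commute del: of_nat_Suc)
qed

text \<open>A real supremum dominates its members only if they are bounded above; for each t this
  comes from the bounded gradient demanded by \<open>C1b\<close>.\<close>

lemma C1_weighted_grad_bound:
  assumes u: "u \<in> C1_weighted T \<gamma>"
  shows "\<exists>B\<ge>0. \<forall>t\<in>{0<..T}. \<forall>x. norm (grad (\<lambda>x. u (t, x)) x) \<le> B * t powr (- \<gamma>)"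
proof -
  obtain M where M: "\<And>t. t \<in> {0<..T} \<Longrightarrow> t powr \<gamma> * (SUP x. norm (grad (\<lambda>x. u (t, x)) x)) \<le> M"
    using u unfolding C1_weighted_def bdd_above_def by blast
  have "norm (grad (\<lambda>x. u (t, x)) x) \<le> max M 0 * t powr (- \<gamma>)" if t: "t \<in> {0<..T}" for t x
  proof -
    have "grad (\<lambda>x. u (t, x)) \<in> bcontfun" using u t by (auto simp: C1_weighted_def C1b_def)
    then have "bounded (range (grad (\<lambda>x. u (t, x))))" by (simp add: bcontfun_def)
    then obtain b where b: "\<And>x. norm (grad (\<lambda>x. u (t, x)) x) \<le> b" by (auto simp: bounded_iff)
    have "norm (grad (\<lambda>x. u (t, x)) x) \<le> (SUP x. norm (grad (\<lambda>x. u (t, x)) x))"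
      by (rule cSUP_upper) (use b in \<open>auto intro!: bdd_aboveI2\<close>)
    then have "t powr \<gamma> * norm (grad (\<lambda>x. u (t, x)) x) \<le> t powr \<gamma> * (SUP x. norm (grad (\<lambda>x. u (t, x)) x))"
      by (rule mult_left_mono) simp
    also have "\<dots> \<le> max M 0" using M[OF t] by simp
    finally show ?thesis using t by (simp add: powr_minus field_simps)
  qed
  then show ?thesis by (intro exI[of _ "max M 0"]) auto
qed

text \<open>The space demands no regularity of the gradient in t. Its coefficients along the basis
  are limits of difference quotients of u, which is jointly continuous, and the gradient is the sum
  of its expansion. Extension by zero makes u Borel on all of the line times H.\<close>

lemma C1_weighted_grad_measurable:
  fixes u :: "real \<times> 'h::{real_inner, banach, polish_space} \<Rightarrow> real" and e :: "nat \<Rightarrow> 'h"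
  assumes basis: "orthonormal_basis e" and u: "u \<in> C1_weighted T \<gamma>"
  shows "(\<lambda>(t, x). if t \<in> {0<..T} then grad (\<lambda>x. u (t, x)) x else 0) \<in> borel_measurable (borel \<Otimes>\<^sub>M borel)"
proof -
  define w where "w t x = (if t \<in> {0<..T} then grad (\<lambda>x. u (t, x)) x else 0)" for t x
  define u0 where "u0 z = indicator ({0..T} \<times> UNIV) z *\<^sub>R u z" for z
  have "closed ({0..T} \<times> (UNIV :: 'h set))" by (intro closed_Times) auto
  then have "u0 \<in> borel_measurable borel"
    unfolding u0_def[abs_def] using u
    by (intro borel_measurable_continuous_on_indicator) (auto simp: C1_weighted_def)
  then have [measurable]: "u0 \<in> borel_measurable (borel \<Otimes>\<^sub>M borel)" by (simp add: borel_prod)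
  have [measurable]: "(\<lambda>z. w (fst z) (snd z) \<bullet> e n) \<in> borel_measurable (borel \<Otimes>\<^sub>M borel)" for n
  proof (rule borel_measurable_LIMSEQ_real)
    fix z :: "real \<times> 'h"
    show "(\<lambda>k. indicator {0<..T} (fst z) * (real (Suc k) * (u0 (fst z, snd z + (1 / real (Suc k)) *\<^sub>R e n) - u0 (fst z, snd z))))
      \<longlonglongrightarrow> w (fst z) (snd z) \<bullet> e n"
    proof (cases "fst z \<in> {0<..T}")
      case True
      then have "GDERIV (\<lambda>x. u (fst z, x)) (snd z) :> grad (\<lambda>x. u (fst z, x)) (snd z)"
        using u by (auto simp: C1_weighted_def C1b_def)
      moreover have "u0 (fst z, y) = u (fst z, y)" for y using True by (simp add: u0_def)
      ultimately show ?thesis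
        using GDERIV_directional_sequence[of "\<lambda>x. u (fst z, x)" "snd z" _ "e n"] True
        by (simp only: w_def if_True indicator_simps mult_1)
    next
      case False
      then have "indicator {0<..T} (fst z) = (0 :: real)" "w (fst z) (snd z) = 0"
        unfolding w_def by (rule indicator_simps, simp only: if_False)
      then show ?thesis by (simp only: mult_zero_left inner_zero_left tendsto_const)
    qed
    show "(\<lambda>z. indicator {0<..T} (fst z) * (real (Suc k) * (u0 (fst z, snd z + (1 / real (Suc k)) *\<^sub>R e n) - u0 (fst z, snd z))))
      \<in> borel_measurable (borel \<Otimes>\<^sub>M borel)" for k
      by measurable
  qed
  have "(\<lambda>z. \<Sum>n. (w (fst z) (snd z) \<bullet> e n) *\<^sub>R e n) \<in> borel_measurable (borel \<Otimes>\<^sub>M borel)"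
    by measurable
  then show ?thesis
    by (simp add: orthonormal_basis_expansion[OF basis] w_def case_prod_beta')
qed

section \<open>Mild solutions as fixed points\<close>

context smoothing
begin

lemma C1_weighted_adm:
  fixes e :: "nat \<Rightarrow> 'h"
  assumes basis: "orthonormal_basis e" and u: "u \<in> C1_weighted T \<gamma>"
  shows "\<exists>B. adm B (\<lambda>t x. if t \<in> {0<..T} then grad (\<lambda>x. u (t, x)) x else 0)"
proof -
  obtain B where B: "B \<ge> 0" "\<And>t x. t \<in> {0<..T} \<Longrightarrow> norm (grad (\<lambda>x. u (t, x)) x) \<le> B * t powr (- \<gamma>)"
    using C1_weighted_grad_bound[OF u] by blast
  have "continuous_on UNIV (grad (\<lambda>x. u (t, x)))" if "t \<in> {0<..T}" for t
    using u that by (auto simp: C1_weighted_def C1b_def bcontfun_def)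
  then show ?thesis
    using B C1_weighted_grad_measurable[OF basis u] unfolding adm_def
    by (intro exI[of _ B]) auto
qed

text \<open>Links the definition, which integrates over (0,t], with \<open>sol\<close>, which
  integrates over (0,t) to stay clear of time 0 in V; the two differ by a null set. Integrability
  comes for free once the gradient is admissible. The semigroups \<open>PP\<close> and
  \<open>P\<close> are compared only on the continuous functions \<open>F w s\<close> and
  \<open>h\<close>.\<close>

lemma mild_solution_iff:
  assumes PP: "\<And>t \<phi> x. 0 \<le> t \<Longrightarrow> continuous_on UNIV \<phi> \<Longrightarrow> PP t \<phi> x = P t \<phi> x"
    and w: "adm B w" and gr: "\<And>s y. s \<in> {0<..T} \<Longrightarrow> grad (\<lambda>z. u (s, z)) y = w s y"
  shows "mild_solution T PP H h u \<longleftrightarrow> (\<forall>t\<in>{0..T}. \<forall>x. u (t, x) = sol w t x)"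
proof -
  have "set_integrable lborel {0<..t} (\<lambda>s. PP (t - s) (\<lambda>y. H y (grad (\<lambda>z. u (s, z)) y)) x) \<and>
    PP t h x + (LINT s:{0<..t}|lborel. PP (t - s) (\<lambda>y. H y (grad (\<lambda>z. u (s, z)) y)) x) = sol w t x"
    if t: "t \<in> {0..T}" for t x
  proof -
    have eq: "indicator {0<..t} s *\<^sub>R PP (t - s) (\<lambda>y. H y (grad (\<lambda>z. u (s, z)) y)) x =
      indicator {0<..t} s *\<^sub>R P (t - s) (F w s) x" for s
    proof (cases "s \<in> {0<..t}")
      case True
      then have s: "0 < s" "s \<le> T" "s \<in> {0<..T}" using t by auto
      have "(\<lambda>y. H y (grad (\<lambda>z. u (s, z)) y)) = F w s" by (simp add: F_def fun_eq_iff gr[OF s(3)])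
      then show ?thesis using PP[OF _ F_continuous[OF w s(1,2)], of "t - s" x] True by simp
    qed simp
    have m: "(\<lambda>s. indicator {0<..t} s *\<^sub>R P (t - s) (F w s) x) \<in> borel_measurable lborel"
      using PI_integrand_measurable(2)[OF w, of t x] by measurable
    have ae: "AE s in lborel. indicator {0<..<t} s *\<^sub>R P (t - s) (F w s) x = indicator {0<..t} s *\<^sub>R P (t - s) (F w s) x"
      using AE_lborel_singleton[of t]
    proof eventually_elim
      case (elim s)
      then have "indicator {0<..<t} s = (indicator {0<..t} s :: real)" by (auto simp: indicator_def)
      then show ?case by (simp only:)
    qed
    have i: "integrable lborel (\<lambda>s. indicator {0<..<t} s *\<^sub>R P (t - s) (F w s) x)"
      using PI_integrable[OF w] t by simp
    have "integrable lborel (\<lambda>s. indicator {0<..t} s *\<^sub>R P (t - s) (F w s) x)"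
      using i integrable_cong_AE[OF borel_measurable_integrable[OF i] m ae] by simp
    moreover have "(\<integral>s. indicator {0<..t} s *\<^sub>R P (t - s) (F w s) x \<partial>lborel) = PI w t x"
      unfolding PI_def by (rule integral_cong_AE[OF borel_measurable_integrable[OF i] m ae, symmetric])
    ultimately show ?thesis
      using PP[OF _ h(1), of t x] t unfolding set_integrable_def set_lebesgue_integral_def eq sol_def by simp
  qed
  then show ?thesis unfolding mild_solution_def by auto
qed

lemma sol_cong:
  assumes "\<And>s x. s \<in> {0<..T} \<Longrightarrow> w s x = w' s x" and t: "t \<in> {0..T}"
  shows "sol w t x = sol w' t x"
proof -
  have "indicator {0<..<t} s *\<^sub>R P (t - s) (F w s) x = indicator {0<..<t} s *\<^sub>R P (t - s) (F w' s) x" for s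
  proof (cases "s \<in> {0<..<t}")
    case True
    then have "F w s = F w' s" using assms(1)[of s] t by (auto simp: F_def fun_eq_iff)
    then show ?thesis by simp
  qed simp
  then show ?thesis by (simp only: sol_def PI_def)
qed

text \<open>\<open>sol\<close> turns a fixed point of \<Gamma> into a mild solution whose gradient
  is that fixed point. Conversely the gradient of any mild solution is admissible and fixed by
  \<Gamma>, so it is unique, and the solution is recovered from its gradient by
  \<open>sol\<close>.\<close>

theorem mild_solution_unique_existence:
  fixes e :: "nat \<Rightarrow> 'h"
  assumes basis: "orthonormal_basis e"
    and PP: "\<And>t \<phi> x. 0 \<le> t \<Longrightarrow> continuous_on UNIV \<phi> \<Longrightarrow> PP t \<phi> x = P t \<phi> x"
  shows "\<exists>!u. u \<in> C1_weighted T \<gamma> \<and> mild_solution T PP H h u"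
proof -
  obtain B w where w: "adm B w" and fp: "\<And>t x. t \<in> {0<..T} \<Longrightarrow> \<Gamma> w t x = w t x"
    using fixpoint_exists by blast
  define u where "u = restrict (\<lambda>(t, x). sol w t x) ({0..T} \<times> UNIV)"
  have u_eq: "u (t, x) = sol w t x" if "t \<in> {0..T}" for t x using that by (simp add: u_def)
  have uG: "GDERIV (\<lambda>x. u (t, x)) x :> w t x" if t: "t \<in> {0<..T}" for t x
  proof -
    have "(\<lambda>x. u (t, x)) = sol w t" using t by (auto simp: u_eq)
    then show ?thesis using sol_GDERIV[OF w t, of x] fp[OF t] by simp
  qed
  have ugr: "grad (\<lambda>x. u (t, x)) x = w t x" if t: "t \<in> {0<..T}" for t x
    by (rule grad_eq[OF uG[OF t]])
  have w_le: "norm (w t x) \<le> B * t powr (- \<gamma>)" if "t \<in> {0<..T}" for t x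
    using w that by (simp add: adm_def)
  have u_cont: "continuous_on ({0..T} \<times> UNIV) u"
    by (rule continuous_on_cong[THEN iffD1, OF refl _ sol_continuous[OF w]]) (auto simp: u_eq)
  have u_bd: "\<bar>u (t, x)\<bar> \<le> A + cB B * g 0" if "t \<in> {0..T}" for t x
    using sol_bounded[OF w, of t x] that by (simp add: u_eq)
  have u_C: "u \<in> C1_weighted T \<gamma>"
    unfolding C1_weighted_def
  proof (intro CollectI conjI ballI u_cont)
    show "u \<in> extensional ({0..T} \<times> UNIV)" by (simp add: u_def)
    show "bounded (u ` ({0..T} \<times> UNIV))"
      unfolding bounded_iff using u_bd by (intro exI[of _ "A + cB B * g 0"]) auto
  next
    fix t assume t: "t \<in> {0<..T}"
    have "continuous_on UNIV (\<lambda>x. u (t, x))"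
      by (rule continuous_on_compose2[OF u_cont]) (use t in \<open>auto intro!: continuous_intros\<close>)
    moreover have "bounded (range (\<lambda>x. u (t, x)))"
      unfolding bounded_iff using u_bd[of t] t by (intro exI[of _ "A + cB B * g 0"]) auto
    moreover have "grad (\<lambda>x. u (t, x)) = w t" using ugr[OF t] by auto
    moreover have "continuous_on UNIV (w t)" using w t by (simp add: adm_def)
    moreover have "bounded (range (w t))"
      unfolding bounded_iff using w_le[OF t] by auto
    ultimately show "(\<lambda>x. u (t, x)) \<in> C1b"
      using uG[OF t] by (simp add: C1b_def bcontfun_def)
  next
    show "bdd_above ((\<lambda>t. t powr \<gamma> * (SUP x. norm (grad (\<lambda>x. u (t, x)) x))) ` {0<..T})"
    proof (rule bdd_aboveI2)
      fix t assume t: "t \<in> {0<..T}"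
      have "(SUP x. norm (grad (\<lambda>x. u (t, x)) x)) \<le> B * t powr (- \<gamma>)"
        by (rule cSUP_least) (use ugr[OF t] w_le[OF t] in auto)
      then have "t powr \<gamma> * (SUP x. norm (grad (\<lambda>x. u (t, x)) x)) \<le> t powr \<gamma> * (B * t powr (- \<gamma>))"
        by (rule mult_left_mono) simp
      also have "\<dots> = B" using t by (simp add: powr_minus)
      finally show "t powr \<gamma> * (SUP x. norm (grad (\<lambda>x. u (t, x)) x)) \<le> B" .
    qed
  qed
  have u_mild: "mild_solution T PP H h u"
  proof -
    have "mild_solution T PP H h u \<longleftrightarrow> (\<forall>t\<in>{0..T}. \<forall>x. u (t, x) = sol w t x)"
      by (rule mild_solution_iff[OF PP w ugr])
    then show ?thesis using u_eq by simp
  qed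
  show ?thesis
  proof (rule ex1I[of _ u])
    show "u \<in> C1_weighted T \<gamma> \<and> mild_solution T PP H h u" using u_C u_mild by blast
    fix v assume v: "v \<in> C1_weighted T \<gamma> \<and> mild_solution T PP H h v"
    define wv where "wv t x = (if t \<in> {0<..T} then grad (\<lambda>x. v (t, x)) x else 0)" for t x
    obtain B' where wv: "adm B' wv"
      using C1_weighted_adm[OF basis, of v] v unfolding wv_def by blast
    have vgr: "grad (\<lambda>x. v (t, x)) x = wv t x" if "t \<in> {0<..T}" for t x using that by (simp add: wv_def)
    have v_eq: "v (t, x) = sol wv t x" if "t \<in> {0..T}" for t x
    proof -
      have "mild_solution T PP H h v \<longleftrightarrow> (\<forall>t\<in>{0..T}. \<forall>x. v (t, x) = sol wv t x)"
        by (rule mild_solution_iff[OF PP wv vgr])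
      then show ?thesis using v that by simp
    qed
    have vfp: "\<Gamma> wv t x = wv t x" if t: "t \<in> {0<..T}" for t x
    proof -
      have "(\<lambda>x. v (t, x)) = sol wv t" using t by (auto simp: v_eq)
      then have "GDERIV (\<lambda>x. v (t, x)) x :> \<Gamma> wv t x" using sol_GDERIV[OF wv t, of x] by simp
      from grad_eq[OF this] show ?thesis using vgr[OF t] by simp
    qed
    have "wv t x = w t x" if "t \<in> {0<..T}" for t x
      by (rule fixpoint_unique[OF wv w vfp fp that])
    then have "v (t, x) = u (t, x)" if "t \<in> {0..T}" for t x
      unfolding v_eq[OF that] u_eq[OF that] by (intro sol_cong that)
    then show "v = u"
      using v u_C by (intro extensionalityI[of v "{0..T} \<times> UNIV"]) (auto simp: C1_weighted_def)
  qed
qed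

end

theorem theorem4p2:
  fixes M :: "'w measure" and \<F> :: "real \<Rightarrow> 'w measure"
    and Z :: "nat \<Rightarrow> real \<Rightarrow> 'w \<Rightarrow> real"
    and e :: "nat \<Rightarrow> 'h::{real_inner, banach, polish_space}"
    and D :: "'h set" and A :: "'h \<Rightarrow> 'h" and S :: "real \<Rightarrow> 'h \<Rightarrow> 'h"
    and \<gamma>s \<beta> :: "nat \<Rightarrow> real" and \<alpha> \<gamma> C T R :: real
    and F :: "'h \<Rightarrow> 'h" and g h :: "'h \<Rightarrow> real"
  assumes "orthonormal_basis e"
    and "1 < \<alpha>" "\<alpha> < 2"
    and "\<And>n. \<beta> n > 0"
    and "stochastic_basis M \<F>"
    and "\<And>n. stable_levy_process M \<F> \<alpha> (Z n)"
    and "independent_processes M Z"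
    and "self_adjoint D A"
    and "range e \<subseteq> D" "\<And>n. \<gamma>s n > 0" "filterlim \<gamma>s at_top sequentially"
      "\<And>n. A (e n) = - \<gamma>s n *\<^sub>R e n"
    and "1 / \<alpha> \<le> \<gamma>" "\<gamma> < 1" "C > 0" "\<And>n. \<beta> n \<ge> C * \<gamma>s n powr (1 / \<alpha> - \<gamma>)"
    and "summable (\<lambda>n. \<beta> n powr \<alpha> / \<gamma>s n)"
    and "semigroup_generated_by D A S"
    and "T > 0" "R > 0"
    and "\<exists>L. L-lipschitz_on UNIV F" "bounded (range F)"
    and "g \<in> bcontfun" "h \<in> bcontfun"
  shows "\<exists>!u. u \<in> C1_weighted T \<gamma> \<and>
           mild_solution T (ou_semigroup M Z S e \<gamma>s \<beta>) (hamiltonian R F g) h u"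
proof -
  \<comment> \<open>Subordination halves the index. Both \<alpha> / 2 < 1, for existence of the
    positive stable law, and \<alpha> / 2 >= 1/2, for its inverse moment, come from the range of
    \<alpha>.\<close>
  have \<alpha>2: "0 < \<alpha> / 2" "\<alpha> / 2 < 1" "1 / 2 \<le> \<alpha> / 2" using assms(2,3) by auto
  obtain \<mu> where \<mu>: "real_distribution \<mu>" "AE x in \<mu>. 0 < x"
    "\<And>l. l \<ge> 0 \<Longrightarrow> (\<integral>x. exp (- l * x) \<partial>\<mu>) = exp (- (l powr (\<alpha> / 2)))"
    using positive_stable_exists[OF \<alpha>2(1,2)] by blast
  interpret om: ou_model \<mu> \<alpha> e \<gamma>s \<beta> \<gamma> C
    by (intro ou_model.intro stable_noise.intro ou_model_axioms.intro positive_stable_inverse_moment[OF \<alpha>2(3) \<mu>])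
      (rule \<mu> assms | assumption)+
  obtain LF where "LF-lipschitz_on UNIV F" using assms by blast
  then have Fc: "continuous_on UNIV F" by (rule lipschitz_on_continuous_on)
  obtain bF where bF: "\<And>x. norm (F x) \<le> bF" using assms(22) by (auto simp: bounded_iff)
  obtain bg where bg: "\<And>x. \<bar>g x\<bar> \<le> bg" using assms(23) by (auto simp: bcontfun_def bounded_iff)
  obtain bh where bh: "\<And>x. \<bar>h x\<bar> \<le> bh" using assms(24) by (auto simp: bcontfun_def bounded_iff)
  have gc: "continuous_on UNIV g" "continuous_on UNIV h" using assms(23,24) by (auto simp: bcontfun_def)
  have bF0: "0 \<le> bF" using order_trans[OF norm_ge_zero bF] .
  define K where "K = 2 * \<alpha> powr (1 / \<alpha>) / C * sqrt (\<integral>x. 1 / \<bar>2 * x\<bar> \<partial>\<mu>)"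
  have K: "0 \<le> K" "om.B t = K * t powr (- \<gamma>)" for t
    using \<open>C > 0\<close> om.inverse_moment(2) by (auto simp: K_def om.B_def)
  have bm: "\<phi> \<in> borel_measurable borel" if "continuous_on UNIV \<phi>" for \<phi> :: "'h \<Rightarrow> real"
    using that by (rule borel_measurable_continuous_onI)
  \<comment> \<open>In the Lipschitz constant R comes from the controls and \<open>bF\<close> from
    the drift. At p = 0 the infimum over controls vanishes, so the Hamiltonian reduces to g and is
    bounded by \<open>bg\<close>.\<close>
  interpret sm: smoothing om.P om.V "hamiltonian R F g" h K \<gamma> T "R + bF" bg bh
  proof
    have "0 < 1 / \<alpha>" using assms(2) by simp
    then show "0 < \<gamma>" using assms(13) by linarith
    fix t x B b B' and \<phi> \<psi> :: "'h \<Rightarrow> real"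
    assume \<phi>: "continuous_on UNIV \<phi>" "\<And>x. \<bar>\<phi> x\<bar> \<le> B"
    show "\<bar>om.P t \<phi> x\<bar> \<le> B" by (rule om.P_bound[OF bm[OF \<phi>(1)] \<phi>(2)])
    show "continuous_on ({0..} \<times> UNIV) (\<lambda>(t, x). om.P t \<phi> x)" by (rule om.P_continuous[OF \<phi>])
    assume t: "0 < t"
    show "GDERIV (om.P t \<phi>) x :> om.V t \<phi> x" by (rule om.P_GDERIV[OF \<phi> t])
    show "continuous_on UNIV (om.V t \<phi>)" by (rule om.V_continuous[OF \<phi> t])
    assume \<psi>: "continuous_on UNIV \<psi>" "\<And>x. \<bar>\<psi> x\<bar> \<le> B'" "\<And>x. \<bar>\<phi> x - \<psi> x\<bar> \<le> b"
    show "norm (om.V t \<phi> x - om.V t \<psi> x) \<le> K * t powr (- \<gamma>) * b"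
      using om.V_diff_le[OF bm[OF \<phi>(1)] bm[OF \<psi>(1)] \<phi>(2) \<psi>(2,3) t] K(2) by simp
  next
    fix \<phi> :: "real \<Rightarrow> 'h \<Rightarrow> real" assume \<phi>: "(\<lambda>(s, y). \<phi> s y) \<in>
        borel_measurable (borel \<Otimes>\<^sub>M borel)"
    show "(\<lambda>(t, s, x). om.P t (\<phi> s) x) \<in> borel_measurable (borel \<Otimes>\<^sub>M borel \<Otimes>\<^sub>M borel)"
      unfolding case_prod_beta' by (rule om.P_measurable[OF \<phi>]) measurable
    show "(\<lambda>(t, s, x). om.V t (\<phi> s) x) \<in> borel_measurable (borel \<Otimes>\<^sub>M borel \<Otimes>\<^sub>M borel)"
      unfolding case_prod_beta' by (rule om.V_measurable[OF \<phi>]) measurable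
  next
    show "continuous_on UNIV (\<lambda>z. hamiltonian R F g (fst z) (snd z))"
      by (rule hamiltonian_continuous[OF \<open>R > 0\<close> Fc gc(1)])
    show "\<bar>hamiltonian R F g x p - hamiltonian R F g x q\<bar> \<le> (R + bF) * norm (p - q)" for x p q
      by (rule hamiltonian_lipschitz[OF \<open>R > 0\<close> bF])
    show "\<bar>hamiltonian R F g x 0\<bar> \<le> bg" for x
      using bg[of x] by (simp add: hamiltonian_eq hinf_zero[OF \<open>R > 0\<close>])
    show "om.V t (\<lambda>_. 0) x = 0" for t x by (rule om.V_zero)
    show "0 \<le> R + bF" using \<open>R > 0\<close> bF0 by simp
  qed (rule assms K gc bh)+
  show ?thesis
    by (rule sm.mild_solution_unique_existence[OF assms(1)])
      (rule om.ou_semigroup_eq[OF assms(5,6,7,18,9,12) _ bm])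
qed

end
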